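(* Let $\mathfrak H=\mathfrak H_1\oplus\mathfrak H_2$ be an orthogonal decomposition of the Hilbert space $\mathfrak H$ and let $$A^0=\begin{pmatrix} A_{11} & A_{12} \\ A_{21} & \ast \end{pmatrix}$$ be an incomplete block operator with respect to this decomposition, where $A_{11}\in[\mathfrak H_1]$, $A_{12}\in[\mathfrak H_2,\mathfrak H_1]$, $A_{21}\in[\mathfrak H_1,\mathfrak H_2]$ and the entry $\ast$ is unspecified. Assume that $A_{11}=A_{11}^*$ and $A_{21}=A_{12}^*$ are bounded, that $\nu_-(A_{11})=\kappa<\infty$, where $\kappa\in\mathbb Z_+$, and let $J=\operatorname{sign}(A_{11})$ be the (unitary) signature operator of $A_{11}$. Then: (i) There exists a completion $A=\begin{pmatrix} A_{11} & A_{12} \\ A_{21} & A_{22} \end{pmatrix}\in[\mathfrak H]$ of $A^0$ with some operator $A_{22}=A_{22}^*\in[\mathfrak H_2]$ such that $\nu_-(A)=\nu_-(A_{11})=\kappa$ if and only if $$\operatorname{ran}A_{12}\subset\operatorname{ran}|A_{11}|^{1/2}.$$ (ii) In this case the operator $S=|A_{11}|^{[-1/2]}A_{12}$ is well defined and $S\in[\mathfrak H_2,\mathfrak H_1]$. Moreover, $S^*JS$ is the smallest operator in the solution set $$\mathcal A:=\{A_{22}=A_{22}^*\in[\mathfrak H_2]:\ A=(A_{ij})_{i,j=1}^2 \text{ satisfies } \nu_-(A)=\kappa\}$$ and this solution set admits a description as the (semibounded) operator interval $$\mathcal A=\{A_{22}\in[\mathfrak H_2]:\ A_{22}=S^*JS+Y,\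 Y=Y^*\ge 0\}.$$
   Context: $[\mathfrak H,\mathfrak K]$ denotes the bounded everywhere defined linear operators from the Hilbert space $\mathfrak H$ to the Hilbert space $\mathfrak K$, and $[\mathfrak H]=[\mathfrak H,\mathfrak H]$. For a bounded selfadjoint operator $X$ with spectral family $E_t$: $\nu_-(X)$ is the dimension of the spectral subspace of $X$ corresponding to $(-\infty,0)$ (the number of negative eigenvalues, counted with multiplicity, when finite); $|X|=(X^2)^{1/2}$; and $\operatorname{sign}(X)=\int_{\mathbb R}\operatorname{sign}(t)\,dE_t$ with $\operatorname{sign}(t)=1$ for $t\ge0$ and $\operatorname{sign}(t)=-1$ for $t<0$. $|X|^{[-1/2]}$ denotes the (generalized) Moore–Penrose inverse of $|X|^{1/2}$: it is defined on $\operatorname{ran}|X|^{1/2}\oplus\ker X$, equals the inverse of $|X|^{1/2}$ restricted to $(\ker X)^\perp$ on $\operatorname{ran}|X|^{1/2}$, and is zero on $\ker X$. Smallest refers to the usual order of bounded selfadjoint operators. *)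

theory Defs
  imports "HOL-Analysis.Analysis" "HOL-Library.Extended_Nat"
begin

text \<open>Complex Hilbert spaces. The class \<open>complex_inner\<close> sits on top of \<open>real_inner\<close>, the
  real inner product being the real part of the complex one, so that norm, topology,
  completeness and \<open>bounded_linear\<close> are those of the library. Positive definiteness of
  \<open>cinner\<close> is inherited from \<open>inner\<close>.\<close>

class complex_vector = real_vector +
  fixes scaleC :: "complex \<Rightarrow> 'a \<Rightarrow> 'a"  (infixr \<open>*\<^sub>C\<close> 75)
  assumes scaleC_add_right: "c *\<^sub>C (x + y) = c *\<^sub>C x + c *\<^sub>C y"
    and scaleC_add_left: "(c + d) *\<^sub>C x = c *\<^sub>C x + d *\<^sub>C x"
    and scaleC_scaleC: "c *\<^sub>C d *\<^sub>C x = (c * d) *\<^sub>C x"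
    and scaleC_one: "1 *\<^sub>C x = x"
    and scaleR_scaleC: "scaleR r x = complex_of_real r *\<^sub>C x"

class complex_inner = complex_vector + real_inner +
  fixes cinner :: "'a \<Rightarrow> 'a \<Rightarrow> complex"
  assumes cinner_commute: "cinner x y = cnj (cinner y x)"
    and cinner_add_left: "cinner (x + y) z = cinner x z + cinner y z"
    and cinner_scaleC_left: "cinner (c *\<^sub>C x) y = c * cinner x y"
    and inner_eq_Re_cinner: "inner x y = Re (cinner x y)"

class chilbert_space = complex_inner + complete_space

global_interpretation complex_vector: vector_space "scaleC :: complex \<Rightarrow> 'a \<Rightarrow> 'a::complex_vector"
  defines cspan = complex_vector.span
    and cdim = complex_vector.dim
  by unfold_locales (simp_all add: scaleC_add_right scaleC_add_left scaleC_scaleC scaleC_one)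

instantiation complex :: chilbert_space
begin
definition scaleC_complex :: "complex \<Rightarrow> complex \<Rightarrow> complex"
  where "scaleC_complex c x = c * x"
definition cinner_complex :: "complex \<Rightarrow> complex \<Rightarrow> complex"
  where "cinner_complex x y = x * cnj y"
instance
  by standard (auto simp: scaleC_complex_def cinner_complex_def algebra_simps
      scaleR_conv_of_real inner_complex_def)
end

text \<open>The orthogonal direct sum of two Hilbert spaces is their product type; its library norm
  is already \<open>sqrt ((norm x)\<^sup>2 + (norm y)\<^sup>2)\<close>.\<close>

instantiation prod :: (complex_vector, complex_vector) complex_vector
begin
definition scaleC_prod :: "complex \<Rightarrow> 'a \<times> 'b \<Rightarrow> 'a \<times> 'b"
  where "scaleC_prod c p = (c *\<^sub>C fst p, c *\<^sub>C snd p)"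
instance
  by standard (auto simp: scaleC_prod_def scaleC_add_right scaleC_add_left scaleC_scaleC
      scaleC_one scaleR_scaleC prod_eq_iff)
end

instantiation prod :: (complex_inner, complex_inner) complex_inner
begin
definition cinner_prod :: "'a \<times> 'b \<Rightarrow> 'a \<times> 'b \<Rightarrow> complex"
  where "cinner_prod p q = cinner (fst p) (fst q) + cinner (snd p) (snd q)"
instance
proof
  fix x y z :: "'a \<times> 'b" and c :: complex
  show "cinner x y = cnj (cinner y x)"
    by (simp add: cinner_prod_def cinner_commute[symmetric])
  show "cinner (x + y) z = cinner x z + cinner y z"
    by (simp add: cinner_prod_def cinner_add_left)
  show "cinner (c *\<^sub>C x) y = c * cinner x y"
    by (simp add: cinner_prod_def scaleC_prod_def cinner_scaleC_left distrib_left)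
  show "inner x y = Re (cinner x y)"
    by (simp add: cinner_prod_def inner_prod_def inner_eq_Re_cinner)
qed
end

instance prod :: (chilbert_space, chilbert_space) chilbert_space ..


section \<open>Bounded operators\<close>

definition bounded_clinear :: "('a::complex_inner \<Rightarrow> 'b::complex_inner) \<Rightarrow> bool"
  where "bounded_clinear T \<longleftrightarrow> bounded_linear T \<and> (\<forall>c x. T (c *\<^sub>C x) = c *\<^sub>C T x)"

text \<open>Meaningful for bounded operators between Hilbert spaces, where the adjoint exists and is
  unique.\<close>
definition cadjoint :: "('a::chilbert_space \<Rightarrow> 'b::chilbert_space) \<Rightarrow> 'b \<Rightarrow> 'a"
  where "cadjoint T = (THE T'. \<forall>x y. cinner (T x) y = cinner x (T' y))"

definition selfadjoint :: "('a::chilbert_space \<Rightarrow> 'a) \<Rightarrow> bool"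
  where "selfadjoint T \<longleftrightarrow> bounded_clinear T \<and> T = cadjoint T"

text \<open>The usual order of bounded selfadjoint operators (quadratic forms of selfadjoint operators
  are real).\<close>
definition op_le :: "('a::chilbert_space \<Rightarrow> 'a) \<Rightarrow> ('a \<Rightarrow> 'a) \<Rightarrow> bool"
  where "op_le S T \<longleftrightarrow> (\<forall>x. Re (cinner (S x) x) \<le> Re (cinner (T x) x))"

definition nonneg_op :: "('a::chilbert_space \<Rightarrow> 'a) \<Rightarrow> bool"
  where "nonneg_op T \<longleftrightarrow> selfadjoint T \<and> op_le (\<lambda>x. 0) T"

text \<open>The nonnegative square root of a nonnegative bounded operator.\<close>
definition op_sqrt :: "('a::chilbert_space \<Rightarrow> 'a) \<Rightarrow> 'a \<Rightarrow> 'a"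
  where "op_sqrt T = (THE R. nonneg_op R \<and> R \<circ> R = T)"

definition op_abs :: "('a::chilbert_space \<Rightarrow> 'a) \<Rightarrow> 'a \<Rightarrow> 'a"
  where "op_abs X = op_sqrt (X \<circ> X)"

definition op_ker :: "('a::zero \<Rightarrow> 'b::zero) \<Rightarrow> 'a set"
  where "op_ker T = {x. T x = 0}"

definition orth_complement :: "'a::complex_inner set \<Rightarrow> 'a set"
  where "orth_complement M = {x. \<forall>y\<in>M. cinner x y = 0}"


section \<open>Spectral families\<close>

definition orth_projection :: "('a::chilbert_space \<Rightarrow> 'a) \<Rightarrow> bool"
  where "orth_projection P \<longleftrightarrow> selfadjoint P \<and> P \<circ> P = P"

text \<open>Spectral families are nondecreasing and normalized to be continuous from the right, i.e.
  \<open>E t\<close> belongs to the half-line \<open>{..t}\<close>.\<close>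
definition resolution_of_identity :: "(real \<Rightarrow> 'a::chilbert_space \<Rightarrow> 'a) \<Rightarrow> bool"
  where "resolution_of_identity E \<longleftrightarrow>
    (\<forall>t. orth_projection (E t)) \<and>
    (\<forall>s t. s \<le> t \<longrightarrow> op_le (E s) (E t)) \<and>
    (\<forall>t x. ((\<lambda>s. E s x) \<longlongrightarrow> E t x) (at_right t)) \<and>
    (\<forall>x. ((\<lambda>t. E t x) \<longlongrightarrow> 0) at_bot) \<and>
    (\<forall>x. ((\<lambda>t. E t x) \<longlongrightarrow> x) at_top)"

text \<open>The Lebesgue--Stieltjes measure \<open>d(E\<^sub>t x, x)\<close>.\<close>
definition spectral_measure :: "(real \<Rightarrow> 'a::chilbert_space \<Rightarrow> 'a) \<Rightarrow> 'a \<Rightarrow> real measure"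
  where "spectral_measure E x = interval_measure (\<lambda>t. Re (cinner (E t x) x))"

text \<open>\<open>T\<close> is the integral of \<open>f\<close> with respect to \<open>E\<close>, in the weak sense; by polarization it
  suffices to consider the diagonal \<open>(T x, x)\<close>, and \<open>T\<close> is unique.\<close>
definition has_spectral_integral ::
    "(real \<Rightarrow> 'a::chilbert_space \<Rightarrow> 'a) \<Rightarrow> (real \<Rightarrow> real) \<Rightarrow> ('a \<Rightarrow> 'a) \<Rightarrow> bool"
  where "has_spectral_integral E f T \<longleftrightarrow> bounded_clinear T \<and>
    (\<forall>x. integrable (spectral_measure E x) f \<and>
         cinner (T x) x = complex_of_real (\<integral>t. f t \<partial>spectral_measure E x))"

definition spectral_integral ::
    "(real \<Rightarrow> 'a::chilbert_space \<Rightarrow> 'a) \<Rightarrow> (real \<Rightarrow> real) \<Rightarrow> 'a \<Rightarrow> 'a"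
  where "spectral_integral E f = (THE T. has_spectral_integral E f T)"

text \<open>By the spectral theorem a bounded selfadjoint operator has exactly one spectral family.\<close>
definition spectral_family :: "('a::chilbert_space \<Rightarrow> 'a) \<Rightarrow> real \<Rightarrow> 'a \<Rightarrow> 'a"
  where "spectral_family X =
    (SOME E. resolution_of_identity E \<and> has_spectral_integral E (\<lambda>t. t) X)"

definition spectral_subspace :: "('a::chilbert_space \<Rightarrow> 'a) \<Rightarrow> real set \<Rightarrow> 'a set"
  where "spectral_subspace X B = range (spectral_integral (spectral_family X) (indicator B))"

text \<open>Hilbert space dimension, with all infinite cardinals identified; \<open>cdim\<close> by itself would
  return \<open>0\<close> in the infinite-dimensional case.\<close>
definition edim :: "'a::complex_vector set \<Rightarrow> enat"
  where "edim V = (if \<exists>B. finite B \<and> V \<subseteq> cspan B then enat (cdim V) else \<infinity>)"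

definition nu_minus :: "('a::chilbert_space \<Rightarrow> 'a) \<Rightarrow> enat"
  where "nu_minus X = edim (spectral_subspace X {..<0})"

text \<open>Not \<^const>\<open>sgn\<close>: here the sign of \<open>0\<close> is \<open>1\<close>.\<close>
definition op_sign :: "('a::chilbert_space \<Rightarrow> 'a) \<Rightarrow> 'a \<Rightarrow> 'a"
  where "op_sign X = spectral_integral (spectral_family X) (\<lambda>t. if t \<ge> 0 then 1 else -1)"


section \<open>The Moore--Penrose inverse of the square root of the modulus\<close>

definition abs_root :: "('a::chilbert_space \<Rightarrow> 'a) \<Rightarrow> 'a \<Rightarrow> 'a"
  where "abs_root X = op_sqrt (op_abs X)"

definition abs_root_pinv_dom :: "('a::chilbert_space \<Rightarrow> 'a) \<Rightarrow> 'a set"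
  where "abs_root_pinv_dom X = {r + k | r k. r \<in> range (abs_root X) \<and> k \<in> op_ker X}"

text \<open>On \<open>ran |X|\<^sup>1\<^sup>/\<^sup>2 \<oplus> ker X\<close>, the vector \<open>y = |X|\<^sup>1\<^sup>/\<^sup>2 x + k\<close> with \<open>x \<in> (ker X)\<^sup>\<bottom>\<close> and
  \<open>k \<in> ker X\<close> is sent to \<open>x\<close>. Values outside \<open>abs_root_pinv_dom X\<close> are meaningless.\<close>
definition abs_root_pinv :: "('a::chilbert_space \<Rightarrow> 'a) \<Rightarrow> 'a \<Rightarrow> 'a"
  where "abs_root_pinv X y =
    (THE x. x \<in> orth_complement (op_ker X) \<and> (\<exists>k\<in>op_ker X. y = abs_root X x + k))"


section \<open>Completions of the incomplete block operator\<close>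

definition block_op :: "('a \<Rightarrow> 'a) \<Rightarrow> ('b \<Rightarrow> 'a) \<Rightarrow> ('a \<Rightarrow> 'b) \<Rightarrow> ('b \<Rightarrow> 'b) \<Rightarrow>
    ('a::chilbert_space \<times> 'b::chilbert_space) \<Rightarrow> 'a \<times> 'b"
  where "block_op A11 A12 A21 A22 = (\<lambda>(x, y). (A11 x + A12 y, A21 x + A22 y))"

definition completion_set :: "('a::chilbert_space \<Rightarrow> 'a) \<Rightarrow> ('b::chilbert_space \<Rightarrow> 'a) \<Rightarrow>
    ('a \<Rightarrow> 'b) \<Rightarrow> nat \<Rightarrow> ('b \<Rightarrow> 'b) set"
  where "completion_set A11 A12 A21 \<kappa> =
    {A22. selfadjoint A22 \<and> nu_minus (block_op A11 A12 A21 A22) = enat \<kappa>}"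

end

theory Submission
  imports Defs
begin

text \<open>Write \<open>P\<close> for the spectral projection of \<open>A11\<close> for the negative half-line, \<open>J = I - 2 P\<close> and
  \<open>R\<close> for the square root of \<open>\<bar>A11\<bar> = J A11\<close>, so that \<open>A11 = R J R\<close>. If \<open>A12 = R S\<close>, completing the
  square gives
  \<open>(A (x, y), (x, y)) = (J (R x + J S y), R x + J S y) + ((A22 - S\<^sup>* J S) y, y)\<close>,
  and a completion has \<open>\<kappa>\<close> negative squares iff the last summand is nonnegative: if it is, then
  \<open>(x, y) \<mapsto> P (R x + J S y)\<close> is injective on every negative subspace, and if it is not, then a vector
  with \<open>R x + J S y\<close> almost \<open>0\<close> enlarges the negative subspace \<open>ran P \<times> 0\<close>. Conversely, maximality of
  \<open>ran P \<times> 0\<close> forces \<open>\<bar>(A12 y, x)\<bar> \<le> C \<parallel>R x\<parallel>\<close> on \<open>ker P\<close>, which puts \<open>A12 y\<close> into the range of \<open>R\<close>.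

  The spectral theorem is obtained from square roots of nonnegative operators: the projections
  onto the kernels of the positive parts of \<open>X - t\<close> form the spectral family of \<open>X\<close>.\<close>

section \<open>Operators on real Hilbert spaces\<close>

text \<open>\<open>spectral_family\<close> picks some resolution that is tied to \<open>X\<close>
  only by scalar integrals on the diagonal. Negativity, nonnegativity and commutation with
  \<open>X\<close> are therefore derived for an arbitrary such resolution, and only for its left
  limit at 0, the one projection that \<open>nu_minus\<close> and \<open>op_sign\<close> see. The
  analysis is real; an operator in the bicommutant of a complex linear one commutes with complex
  scalars, which restores complex linearity. Negative indices are compared through injective linear
  maps between finite-dimensional negative subspaces. When the dimensions agree these maps are onto,
  and this surjectivity is how finiteness of the index is exploited. In particular \<open>R\<close>
  maps the range of \<open>P\<close> onto itself, so the range condition on \<open>A12\<close> has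
  content only on the kernel of \<open>P\<close>. Since 0 need not be isolated in the spectrum of
  \<open>A11\<close>, the range of \<open>R\<close> may fail to be closed: hence a Baire argument
  for the boundedness of \<open>S\<close>, and vectors \<open>R x\<close> that only approximate
  \<open>J S y\<close>.\<close>

lemma quadratic_nonneg_discriminant:
  fixes a b c :: real
  assumes quad: "\<And>t. 0 \<le> a + 2 * t * b + t\<^sup>2 * c" and "0 \<le> c"
  shows "b\<^sup>2 \<le> a * c"
proof (cases "c = 0")
  case True
  have "b = 0"
  proof (rule ccontr)
    assume "b \<noteq> 0"
    \<comment> \<open>This \<open>t\<close> gives the affine function \<open>a + 2 * t * b\<close>
      the value -1.\<close>
    with quad[of "- (a + 1) / (2 * b)"] True show False by (simp add: field_simps)
  qed
  with True show ?thesis by simp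
next
  case False
  with \<open>0 \<le> c\<close> have c: "0 < c" by simp
  have "0 \<le> a + 2 * (- b / c) * b + (- b / c)\<^sup>2 * c" by (rule quad)
  also have "\<dots> = a - b\<^sup>2 / c" using c by (simp add: field_simps power2_eq_square)
  finally show ?thesis using c by (simp add: field_simps)
qed

text \<open>Serves as the first-order condition at a minimum.\<close>

lemma quadratic_nonneg_imp_zero:
  fixes d q :: real
  assumes quad: "\<And>t. 0 \<le> t * d + t\<^sup>2 * q"
  shows "d = 0"
proof -
  have q: "0 \<le> q" using quad[of 1] quad[of "-1"] by simp
  have "(d / 2)\<^sup>2 \<le> 0 * q"
    by (rule quadratic_nonneg_discriminant[OF _ q]) (use quad in simp)
  then show ?thesis by simp
qed

lemma norm_add_scaleR_square:
  fixes a b :: "'a::real_inner"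
  shows "(norm (a + t *\<^sub>R b))\<^sup>2 = (norm a)\<^sup>2 + 2 * t * (a \<bullet> b) + t\<^sup>2 * (norm b)\<^sup>2"
  unfolding power2_norm_eq_inner
  by (simp add: inner_add_left inner_add_right inner_commute power2_eq_square)

text \<open>Minimizes \<open>(norm (R x))\<^sup>2 / 2 - g x\<close> over \<open>M\<close>. A
  minimizing sequence need not converge, but its image under \<open>R\<close> is Cauchy, so the
  representing vector lies in the closure of the image. Leaving \<open>M\<close> and
  \<open>R\<close> free lets one minimization yield the Riesz theorem, orthogonal projections, a
  density argument and a range criterion.\<close>

lemma riesz_subspace:
  fixes R :: "'v::real_vector \<Rightarrow> 'a::{real_inner,complete_space}" and g :: "'v \<Rightarrow> real"
  assumes M: "subspace M" and R: "linear R" and g: "linear g"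
    and bd: "\<And>x. x \<in> M \<Longrightarrow> \<bar>g x\<bar> \<le> C * norm (R x)"
  shows "\<exists>u\<in>closure (R ` M). \<forall>h\<in>M. g h = u \<bullet> R h"
proof -
  define \<phi> where "\<phi> x = (norm (R x))\<^sup>2 / 2 - g x" for x
  have lower: "- (C\<^sup>2 / 2) \<le> \<phi> x" if "x \<in> M" for x
  proof -
    have "0 \<le> (norm (R x) - C)\<^sup>2" by simp
    then show ?thesis
      using bd[OF that] by (simp add: \<phi>_def power2_diff field_simps)
  qed
  have bdd: "bdd_below (\<phi> ` M)" using lower by (auto simp: bdd_below_def)
  have ne: "\<phi> ` M \<noteq> {}" using M subspace_0 by blast
  define I where "I = Inf (\<phi> ` M)"
  have I: "I \<le> \<phi> x" if "x \<in> M" for x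
    unfolding I_def using that bdd by (intro cInf_lower) auto
  define \<delta> where "\<delta> n = inverse (real (Suc n))" for n
  have \<delta>0: "0 < \<delta> n" for n by (simp add: \<delta>_def)
  have "\<exists>x\<in>M. \<phi> x < I + \<delta> n" for n
    using cInf_lessD[OF ne, of "I + \<delta> n"] \<delta>0[of n] by (auto simp: I_def)
  then obtain X where XM: "\<And>n. X n \<in> M" and X: "\<And>n. \<phi> (X n) < I + \<delta> n"
    by metis
  \<comment> \<open>Parallelogram identity: the left side equals four times the sum of the values at
    \<open>x\<close> and \<open>y\<close> minus twice the value at their midpoint, and the last
    value is at least \<open>I\<close>.\<close>
  have par: "(norm (R x - R y))\<^sup>2 \<le> 4 * (\<phi> x + \<phi> y - 2 * I)" if "x \<in> M" "y \<in> M" for x y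
  proof -
    have "(1/2) *\<^sub>R (x + y) \<in> M" using M that by (simp add: subspace_add subspace_scale)
    from I[OF this] have "I \<le> (norm (R x + R y))\<^sup>2 / 8 - (g x + g y) / 2"
      by (simp add: \<phi>_def linear_scale[OF R] linear_scale[OF g] linear_add[OF R] linear_add[OF g]
          power_divide del: scaleR_half_double)
    then show ?thesis
      by (simp add: \<phi>_def power2_norm_eq_inner inner_add_left inner_add_right inner_diff_left
          inner_diff_right inner_commute field_simps)
  qed
  have "Cauchy (\<lambda>n. R (X n))"
  proof (rule CauchyI)
    fix e :: real assume e: "0 < e"
    obtain N where N: "\<delta> N < e\<^sup>2 / 8"
      using reals_Archimedean[of "e\<^sup>2 / 8"] e by (auto simp: \<delta>_def)
    have "norm (R (X m) - R (X n)) < e" if "m \<ge> N" "n \<ge> N" for m n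
    proof -
      have le: "\<delta> k \<le> \<delta> N" if "k \<ge> N" for k
        using that unfolding \<delta>_def by (intro le_imp_inverse_le) auto
      have "(norm (R (X m) - R (X n)))\<^sup>2 < e\<^sup>2"
      proof -
        have "\<phi> (X m) + \<phi> (X n) - 2 * I < e\<^sup>2 / 4"
          using X[of m] X[of n] le[OF that(1)] le[OF that(2)] N by linarith
        then have "4 * (\<phi> (X m) + \<phi> (X n) - 2 * I) < e\<^sup>2" by (simp add: field_simps)
        with par[OF XM[of m] XM[of n]] show ?thesis by (rule order.strict_trans1)
      qed
      then show ?thesis using e by (simp add: power_less_imp_less_base)
    qed
    then show "\<exists>M. \<forall>m\<ge>M. \<forall>n\<ge>M. norm (R (X m) - R (X n)) < e" by blast
  qed
  then obtain u where u: "(\<lambda>n. R (X n)) \<longlonglongrightarrow> u"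
    using Cauchy_convergent convergent_def by blast
  have "g h = u \<bullet> R h" if h: "h \<in> M" for h
  proof -
    \<comment> \<open>Moving \<open>X n\<close> by \<open>t *\<^sub>R h\<close> gains at most
      \<open>\<delta> n\<close> over the infimum; in the limit the perturbation of the minimum
      itself is nonnegative.\<close>
    have "0 \<le> t * (u \<bullet> R h - g h) + t\<^sup>2 * ((norm (R h))\<^sup>2 / 2)" for t
    proof -
      have "0 \<le> \<delta> n + (t * (R (X n) \<bullet> R h - g h) + t\<^sup>2 * ((norm (R h))\<^sup>2 / 2))" for n
      proof -
        have "X n + t *\<^sub>R h \<in> M" using M XM h by (simp add: subspace_add subspace_scale)
        from I[OF this] have "I \<le> \<phi> (X n) + (t * (R (X n) \<bullet> R h - g h) + t\<^sup>2 * ((norm (R h))\<^sup>2 / 2))"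
          by (simp add: \<phi>_def linear_scale[OF R] linear_scale[OF g] linear_add[OF R] linear_add[OF g]
              norm_add_scaleR_square field_simps)
        with X[of n] show ?thesis by simp
      qed
      moreover have "(\<lambda>n. \<delta> n + (t * (R (X n) \<bullet> R h - g h) + t\<^sup>2 * ((norm (R h))\<^sup>2 / 2)))
          \<longlonglongrightarrow> 0 + (t * (u \<bullet> R h - g h) + t\<^sup>2 * ((norm (R h))\<^sup>2 / 2))"
        unfolding \<delta>_def by (intro tendsto_intros u LIMSEQ_inverse_real_of_nat)
      ultimately show ?thesis
        by (metis (no_types, lifting) LIMSEQ_le_const add_0)
    qed
    from quadratic_nonneg_imp_zero[OF this] show ?thesis by simp
  qed
  moreover have "u \<in> closure (R ` M)"
    using u XM by (auto simp: closure_sequential intro!: exI[of _ "\<lambda>n. R (X n)"])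
  ultimately show ?thesis by blast
qed

lemma riesz_representation:
  fixes g :: "'a::{real_inner,complete_space} \<Rightarrow> real"
  assumes "bounded_linear g"
  obtains u where "\<And>x. g x = u \<bullet> x"
proof -
  from bounded_linear.bounded[OF assms] obtain K where "\<And>x. norm (g x) \<le> norm x * K" by blast
  then have "\<bar>g x\<bar> \<le> K * norm (id x)" for x by (simp add: mult.commute)
  from riesz_subspace[OF subspace_UNIV linear_id bounded_linear.linear[OF assms] this] that
  show ?thesis by auto
qed

lemma closed_subspace_decomposition:
  fixes x :: "'a::{real_inner,complete_space}"
  assumes "subspace M" "closed M"
  obtains u where "u \<in> M" "\<And>y. y \<in> M \<Longrightarrow> (x - u) \<bullet> y = 0"
proof -
  have "\<bar>x \<bullet> y\<bar> \<le> norm x * norm (id y)" for y by (simp add: Cauchy_Schwarz_ineq2)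
  from riesz_subspace[OF assms(1) linear_id bounded_linear.linear[OF bounded_linear_inner_right] this]
  obtain u where "u \<in> closure M" "\<And>y. y \<in> M \<Longrightarrow> x \<bullet> y = u \<bullet> y" by auto
  with assms(2) that show ?thesis by (auto simp: inner_diff_left)
qed

lemma adjoint_exists:
  fixes T :: "'a::{real_inner,complete_space} \<Rightarrow> 'b::real_inner"
  assumes T: "bounded_linear T"
  obtains T' where "bounded_linear T'" "\<And>x y. T x \<bullet> y = x \<bullet> T' y"
proof -
  have "\<exists>u. \<forall>x. T x \<bullet> y = u \<bullet> x" for y
  proof -
    have "bounded_linear (\<lambda>x. T x \<bullet> y)"
      by (intro bounded_linear_compose[OF bounded_linear_inner_left T])
    then show ?thesis using riesz_representation by metis
  qed
  then obtain T' where T': "\<And>x y. T x \<bullet> y = T' y \<bullet> x" by metis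
  obtain K where K: "\<And>x. norm (T x) \<le> norm x * K" and K0: "0 < K"
    using bounded_linear.pos_bounded[OF T] by blast
  have "bounded_linear T'"
  proof (rule bounded_linear_intro)
    show "T' (x + y) = T' x + T' y" for x y
      by (subst vector_eq_rdot[symmetric]) (simp add: inner_add_left inner_add_right T'[symmetric])
    show "T' (r *\<^sub>R x) = r *\<^sub>R T' x" for r x
      by (subst vector_eq_rdot[symmetric]) (simp add: T'[symmetric])
    show "norm (T' y) \<le> norm y * K" for y
    proof -
      have "(norm (T' y))\<^sup>2 = T (T' y) \<bullet> y" by (simp add: T' power2_norm_eq_inner)
      also have "\<dots> \<le> norm (T (T' y)) * norm y" by (rule norm_cauchy_schwarz)
      also have "\<dots> \<le> (norm (T' y) * K) * norm y" by (intro mult_right_mono K) auto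
      finally show ?thesis
        by (cases "T' y = 0") (use K0 in \<open>auto simp: power2_eq_square mult_ac\<close>)
    qed
  qed
  with that T' show ?thesis by (simp add: inner_commute)
qed

text \<open>A complex Hilbert space is a real one
  for the real part of its inner product, and a complex linear operator is selfadjoint iff it is
  symmetric for the real part.\<close>

definition sym_op :: "('a::real_inner \<Rightarrow> 'a) \<Rightarrow> bool"
  where "sym_op T \<longleftrightarrow> bounded_linear T \<and> (\<forall>x y. T x \<bullet> y = x \<bullet> T y)"

definition pos_op :: "('a::real_inner \<Rightarrow> 'a) \<Rightarrow> bool"
  where "pos_op T \<longleftrightarrow> sym_op T \<and> (\<forall>x. 0 \<le> T x \<bullet> x)"

lemma sym_opD: "sym_op T \<Longrightarrow> T x \<bullet> y = x \<bullet> T y"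
  by (simp add: sym_op_def)

lemma pos_opD: "pos_op T \<Longrightarrow> 0 \<le> T x \<bullet> x"
  by (simp add: pos_op_def)

lemma sym_op_add: "sym_op S \<Longrightarrow> sym_op T \<Longrightarrow> sym_op (\<lambda>x. S x + T x)"
  by (auto simp: sym_op_def bounded_linear_add inner_add_left inner_add_right)

lemma sym_op_diff: "sym_op S \<Longrightarrow> sym_op T \<Longrightarrow> sym_op (\<lambda>x. S x - T x)"
  by (auto simp: sym_op_def bounded_linear_sub inner_diff_left inner_diff_right)

lemma sym_op_scaleR: "sym_op T \<Longrightarrow> sym_op (\<lambda>x. r *\<^sub>R T x)"
  by (auto simp: sym_op_def bounded_linear_const_scaleR)

lemma sym_op_ident: "sym_op (\<lambda>x. x)"
  by (simp add: sym_op_def)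

lemma sym_op_compose_commute:
  assumes "sym_op S" "sym_op T" "\<And>x. S (T x) = T (S x)"
  shows "sym_op (\<lambda>x. S (T x))"
  using assms by (auto simp: sym_op_def bounded_linear_compose)

lemma pos_op_square: "sym_op T \<Longrightarrow> pos_op (\<lambda>x. T (T x))"
  using sym_opD[of T "T _" _] by (auto simp: pos_op_def sym_op_compose_commute)

lemma sym_op_bound:
  assumes "sym_op T"
  obtains K where "0 < K" "\<And>x. norm (T x) \<le> K * norm x" "\<And>x. \<bar>T x \<bullet> x\<bar> \<le> K * (norm x)\<^sup>2"
proof -
  obtain K where K: "0 < K" "\<And>x. norm (T x) \<le> norm x * K"
    using bounded_linear.pos_bounded assms unfolding sym_op_def by blast
  have "\<bar>T x \<bullet> x\<bar> \<le> K * (norm x)\<^sup>2" for x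
  proof -
    have "\<bar>T x \<bullet> x\<bar> \<le> norm (T x) * norm x" by (rule Cauchy_Schwarz_ineq2)
    also have "\<dots> \<le> (norm x * K) * norm x" by (intro mult_right_mono K) auto
    finally show ?thesis by (simp add: power2_eq_square mult_ac)
  qed
  with K that show ?thesis by (metis mult.commute)
qed

section \<open>Cauchy-Schwarz for positive operators and monotone convergence\<close>

lemma pos_op_Cauchy_Schwarz:
  assumes "pos_op T"
  shows "(T x \<bullet> y)\<^sup>2 \<le> (T x \<bullet> x) * (T y \<bullet> y)"
proof -
  have T: "bounded_linear T" and s: "\<And>x y. T x \<bullet> y = x \<bullet> T y" and p: "\<And>x. 0 \<le> T x \<bullet> x"
    using assms by (auto simp: pos_op_def sym_op_def)
  interpret T: bounded_linear T by fact
  define a b c where "a = T x \<bullet> x" and "b = T x \<bullet> y" and "c = T y \<bullet> y"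
  have quad: "0 \<le> c + 2 * t * b + t\<^sup>2 * a" for t
  proof -
    have "0 \<le> T (t *\<^sub>R x + y) \<bullet> (t *\<^sub>R x + y)" by (rule p)
    also have "\<dots> = c + 2 * t * b + t\<^sup>2 * a"
      by (simp add: a_def b_def c_def T.add T.scaleR inner_add_left inner_add_right s[of x y]
          power2_eq_square inner_commute[of x "T y"] algebra_simps)
    finally show ?thesis .
  qed
  have "b\<^sup>2 \<le> c * a" by (rule quadratic_nonneg_discriminant[OF quad]) (simp add: a_def p)
  then show ?thesis by (simp add: a_def b_def c_def mult.commute)
qed

text \<open>Cauchy-Schwarz for the form of \<open>T\<close> with second vector \<open>T x\<close>.
  It turns convergence of quadratic forms into norm convergence of vectors.\<close>

lemma pos_op_norm_le:
  assumes "pos_op T" and K: "\<And>x. T x \<bullet> x \<le> K * (norm x)\<^sup>2"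
  shows "(norm (T x))\<^sup>2 \<le> K * (T x \<bullet> x)"
proof (cases "T x = 0")
  case False
  have "((norm (T x))\<^sup>2)\<^sup>2 = (T x \<bullet> T x)\<^sup>2" by (simp add: power2_norm_eq_inner)
  also have "\<dots> \<le> (T x \<bullet> x) * (T (T x) \<bullet> T x)" by (rule pos_op_Cauchy_Schwarz[OF assms(1)])
  also have "\<dots> \<le> (T x \<bullet> x) * (K * (norm (T x))\<^sup>2)"
    by (intro mult_left_mono K pos_opD assms)
  finally show ?thesis using False by (simp add: power2_eq_square mult_ac)
qed auto

lemma pos_op_zero:
  assumes "pos_op T" "T x \<bullet> x = 0"
  shows "T x = 0"
proof -
  obtain K where "\<And>x. \<bar>T x \<bullet> x\<bar> \<le> K * (norm x)\<^sup>2"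
    using assms sym_op_bound unfolding pos_op_def by metis
  then have "(norm (T x))\<^sup>2 \<le> K * (T x \<bullet> x)"
    by (intro pos_op_norm_le assms) (auto simp: abs_le_iff)
  with assms show ?thesis by simp
qed

text \<open>A general filter covers both sequences and one-sided limits. In the uses
  \<open>m\<close> is a monotone bounded quadratic form, and its convergence carries over to the
  vectors.\<close>

lemma tendsto_if_norm_dominated:
  fixes f :: "'i \<Rightarrow> 'a::{real_normed_vector,complete_space}" and m :: "'i \<Rightarrow> real"
  assumes m: "(m \<longlongrightarrow> L) F" and F: "F \<noteq> bot"
    and le: "\<And>i j. (norm (f i - f j))\<^sup>2 \<le> \<bar>m i - m j\<bar>"
  shows "\<exists>l. (f \<longlongrightarrow> l) F"
proof -
  have "cauchy_filter (filtermap f F)"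
    unfolding cauchy_filter_metric_filtermap
  proof (intro allI impI)
    fix e :: real assume e: "0 < e"
    then have "eventually (\<lambda>i. dist (m i) L < e\<^sup>2 / 2) F" by (intro tendstoD[OF m]) simp
    moreover have "dist (f i) (f j) < e" if "dist (m i) L < e\<^sup>2 / 2" "dist (m j) L < e\<^sup>2 / 2" for i j
    proof -
      have "(norm (f i - f j))\<^sup>2 \<le> \<bar>m i - m j\<bar>" by (rule le)
      also have "\<dots> < e\<^sup>2"
        using that abs_triangle_ineq[of "m i - L" "L - m j"]
        by (simp add: dist_real_def abs_minus_commute)
      finally have "norm (f i - f j) < e" using e by (simp add: power_less_imp_less_base)
      then show ?thesis by (simp add: dist_norm)
    qed
    ultimately show "\<exists>P. eventually P F \<and> (\<forall>x y. P x \<and> P y \<longrightarrow> dist (f x) (f y) < e)" by blast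
  qed
  moreover have "complete (UNIV :: 'a set)"
    by (meson Cauchy_convergent UNIV_I complete_def convergent_def)
  ultimately have "\<exists>l\<in>UNIV. filtermap f F \<le> nhds l"
    using F unfolding complete_uniform by (simp add: filtermap_bot_iff)
  then show ?thesis by (simp add: filterlim_def)
qed

text \<open>\<open>T\<close> ranges over all bounded real-linear operators, not only symmetric ones,
  so that it may be multiplication by a complex scalar.\<close>

definition bicommutant :: "('a::real_normed_vector \<Rightarrow> 'a) \<Rightarrow> ('a \<Rightarrow> 'a) set"
  where "bicommutant A = {R. \<forall>T. bounded_linear T \<longrightarrow> (\<forall>x. T (A x) = A (T x)) \<longrightarrow> (\<forall>x. T (R x) = R (T x))}"

lemma bicommutantI:
  "(\<And>T x. bounded_linear T \<Longrightarrow> (\<And>x. T (A x) = A (T x)) \<Longrightarrow> T (R x) = R (T x)) \<Longrightarrow> R \<in> bicommutant A"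
  by (simp add: bicommutant_def)

lemma bicommutantD:
  "R \<in> bicommutant A \<Longrightarrow> bounded_linear T \<Longrightarrow> (\<And>x. T (A x) = A (T x)) \<Longrightarrow> T (R x) = R (T x)"
  by (simp add: bicommutant_def)

section \<open>Square roots\<close>

text \<open>\<open>nonneg_poly_ident\<close> is the constant polynomial 1 and
  \<open>nonneg_poly_step\<close> multiplies by the variable. Describing the functions instead of
  coefficient lists lets positivity and commutation go by rule induction.\<close>

inductive nonneg_poly :: "('a::real_vector \<Rightarrow> 'a) \<Rightarrow> ('a \<Rightarrow> 'a) \<Rightarrow> bool" for B where
  nonneg_poly_zero: "nonneg_poly B (\<lambda>x. 0)"
| nonneg_poly_ident: "nonneg_poly B (\<lambda>x. x)"
| nonneg_poly_add: "nonneg_poly B f \<Longrightarrow> nonneg_poly B g \<Longrightarrow> nonneg_poly B (\<lambda>x. f x + g x)"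
| nonneg_poly_scale: "nonneg_poly B f \<Longrightarrow> 0 \<le> r \<Longrightarrow> nonneg_poly B (\<lambda>x. r *\<^sub>R f x)"
| nonneg_poly_step: "nonneg_poly B f \<Longrightarrow> nonneg_poly B (\<lambda>x. B (f x))"

lemma nonneg_poly_comp:
  assumes "nonneg_poly B f" "nonneg_poly B g"
  shows "nonneg_poly B (\<lambda>x. f (g x))"
  using assms(1)
proof (induction rule: nonneg_poly.induct)
  case (nonneg_poly_step f)
  from nonneg_poly.nonneg_poly_step[OF this(2)] show ?case .
qed (use assms(2) in \<open>simp_all add: nonneg_poly_zero nonneg_poly_add nonneg_poly_scale\<close>)

lemma nonneg_poly_commute:
  assumes "nonneg_poly B f" "linear T" "\<And>x. T (B x) = B (T x)"
  shows "T (f x) = f (T x)"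
  using assms(1)
  by (induction arbitrary: x rule: nonneg_poly.induct)
    (simp_all add: assms linear_0 linear_add linear_scale)

lemma nonneg_poly_pos:
  assumes B: "pos_op B" and "nonneg_poly B f"
  shows "pos_op f"
proof -
  have lin: "linear B" and sB: "sym_op B"
    using B by (auto simp: pos_op_def sym_op_def bounded_linear.linear)
  \<comment> \<open>The induction carries positivity of \<open>B f\<close> along with that of
    \<open>f\<close>: one more factor is then handled by
    \<open>B (B (f x)) \<bullet> x = f (B x) \<bullet> B x\<close>.\<close>
  have "sym_op f \<and> (\<forall>x. 0 \<le> f x \<bullet> x \<and> 0 \<le> B (f x) \<bullet> x)"
    using assms(2)
  proof (induction rule: nonneg_poly.induct)
    case nonneg_poly_zero
    then show ?case using lin by (simp add: sym_op_def linear_0)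
  next
    case nonneg_poly_ident
    then show ?case using pos_opD[OF B] by (simp add: sym_op_ident)
  next
    case (nonneg_poly_add f g)
    then show ?case using lin by (simp add: sym_op_add linear_add inner_add_left)
  next
    case (nonneg_poly_scale f r)
    then show ?case using lin by (simp add: sym_op_scaleR linear_scale)
  next
    case (nonneg_poly_step f)
    have c: "B (f x) = f (B x)" for x
      by (rule nonneg_poly_commute[OF nonneg_poly_step(1) lin]) simp
    have "0 \<le> B (B (f x)) \<bullet> x" for x
      using nonneg_poly_step.IH c[of x] by (simp add: sym_opD[OF sB])
    moreover have "sym_op (\<lambda>x. B (f x))"
      using sym_op_compose_commute[of B f] sB c nonneg_poly_step.IH by blast
    ultimately show ?case using nonneg_poly_step.IH by blast
  qed
  then show ?thesis by (simp add: pos_op_def)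
qed

text \<open>The square root of \<open>I - B\<close> is \<open>I - Z\<close> with \<open>Z = (B + Z\<^sup>2) / 2\<close>. The iterates increase because
  their differences are polynomials in \<open>B\<close> with nonnegative coefficients.\<close>
primrec sqrt_iter :: "('a::real_vector \<Rightarrow> 'a) \<Rightarrow> nat \<Rightarrow> 'a \<Rightarrow> 'a" where
  "sqrt_iter B 0 = (\<lambda>x. 0)"
| "sqrt_iter B (Suc n) = (\<lambda>x. (1/2) *\<^sub>R (B x + sqrt_iter B n (sqrt_iter B n x)))"

lemma nonneg_poly_base: "nonneg_poly B B"
  using nonneg_poly_step[OF nonneg_poly_ident] .

lemma nonneg_poly_sqrt_iter: "nonneg_poly B (sqrt_iter B n)"
proof (induction n)
  case 0
  show ?case using nonneg_poly_zero by simp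
next
  case (Suc n)
  show ?case
    using nonneg_poly_scale[OF nonneg_poly_add[OF nonneg_poly_base nonneg_poly_comp[OF Suc Suc]], of "1/2"] by simp
qed

lemma nonneg_poly_sqrt_iter_step:
  assumes "linear B"
  shows "nonneg_poly B (\<lambda>x. sqrt_iter B (Suc n) x - sqrt_iter B n x)"
proof (induction n)
  case 0
  show ?case using nonneg_poly_scale[OF nonneg_poly_base, of "1/2" B] by simp
next
  case (Suc n)
  let ?Z = "sqrt_iter B"
  have lin: "linear f" if "nonneg_poly B f" for f
    using that
    by (induction rule: nonneg_poly.induct)
      (simp_all add: linear_zero linear_ident linear_compose_add linear_compose_scale_right
        linear_compose[OF _ assms, unfolded comp_def])
  define a where "a = ?Z n"
  define b where "b = ?Z (Suc n)"
  have a: "nonneg_poly B a" and b: "nonneg_poly B b" and d: "nonneg_poly B (\<lambda>x. b x - a x)"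
    using nonneg_poly_sqrt_iter[of B n] nonneg_poly_sqrt_iter[of B "Suc n"] Suc by (simp_all only: a_def b_def)
  \<comment> \<open>The difference of the squares of \<open>b\<close> and \<open>a\<close> is
    written as \<open>(b - a) b + a (b - a)\<close>, a sum of products of polynomials already known
    to have nonnegative coefficients.\<close>
  have "?Z (Suc (Suc n)) x - b x
      = (1/2) *\<^sub>R ((b (b x) - a (b x)) + a (b x - a x))" for x
  proof -
    have 1: "?Z (Suc (Suc n)) x = (1/2) *\<^sub>R (B x + b (b x))" by (simp only: sqrt_iter.simps(2) b_def)
    have 2: "b x = (1/2) *\<^sub>R (B x + a (a x))" by (simp only: sqrt_iter.simps(2) b_def a_def)
    have "?Z (Suc (Suc n)) x - b x = (1/2) *\<^sub>R (b (b x) - a (a x))"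
      unfolding arg_cong2[of _ _ _ _ minus, OF 1 2] by (simp flip: scaleR_diff_right)
    also have "b (b x) - a (a x) = (b (b x) - a (b x)) + a (b x - a x)"
      by (simp only: linear_diff[OF lin[OF a]]) simp
    finally show ?thesis .
  qed
  moreover have "nonneg_poly B (\<lambda>x. (1/2) *\<^sub>R ((b (b x) - a (b x)) + a (b x - a x)))"
    by (rule nonneg_poly_scale[OF nonneg_poly_add[OF nonneg_poly_comp[OF d b] nonneg_poly_comp[OF a d]]]) simp
  ultimately show ?case by (simp only: b_def)
qed

lemma nonneg_poly_sqrt_iter_diff:
  assumes "linear B" "m \<le> n"
  shows "nonneg_poly B (\<lambda>x. sqrt_iter B n x - sqrt_iter B m x)"
  using assms(2)
proof (induction n rule: dec_induct)
  case base
  show ?case by (simp add: nonneg_poly_zero)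
next
  case (step n)
  have "(\<lambda>x. sqrt_iter B (Suc n) x - sqrt_iter B m x) =
      (\<lambda>x. (sqrt_iter B n x - sqrt_iter B m x) + (sqrt_iter B (Suc n) x - sqrt_iter B n x))"
    by (rule ext) (simp del: sqrt_iter.simps)
  then show ?case
    using nonneg_poly_add[OF step(3) nonneg_poly_sqrt_iter_step[OF assms(1), of n]] by (simp only:)
qed

lemma sqrt_iter_limit:
  fixes B :: "'a::{real_inner,complete_space} \<Rightarrow> 'a"
  assumes B: "pos_op B" and B1: "\<And>x. B x \<bullet> x \<le> (norm x)\<^sup>2"
  obtains Z where "sym_op Z" "\<And>x. Z x \<bullet> x \<le> (norm x)\<^sup>2" "\<And>x. 2 *\<^sub>R Z x = B x + Z (Z x)"
    "Z \<in> bicommutant B"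
proof -
  let ?Z = "sqrt_iter B"
  have lin: "linear B" using B by (auto simp: pos_op_def sym_op_def bounded_linear.linear)
  have pos: "pos_op (?Z n)" for n by (rule nonneg_poly_pos[OF B nonneg_poly_sqrt_iter])
  then have blZ: "bounded_linear (?Z n)" and symZ: "?Z n x \<bullet> y = x \<bullet> ?Z n y" for n x y
    by (auto simp: pos_op_def sym_op_def)
  have normB: "norm (B x) \<le> norm x" for x
  proof -
    have "(norm (B x))\<^sup>2 \<le> 1 * (B x \<bullet> x)" by (rule pos_op_norm_le[OF B]) (simp add: B1)
    also have "\<dots> \<le> (norm x)\<^sup>2" using B1 by simp
    finally show ?thesis by (rule power2_le_imp_le) simp
  qed
  have normZ: "norm (?Z n x) \<le> norm x" for n x
  proof (induction n arbitrary: x)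
    case (Suc n)
    have "norm (B x + ?Z n (?Z n x)) \<le> norm (B x) + norm (?Z n (?Z n x))" by (rule norm_triangle_ineq)
    also have "\<dots> \<le> norm x + norm x"
      using normB[of x] Suc[of "?Z n x"] Suc[of x] by linarith
    finally show ?case by simp
  qed simp
  have Zle: "?Z n x \<bullet> x \<le> (norm x)\<^sup>2" for n x
  proof -
    have "?Z n x \<bullet> x \<le> norm (?Z n x) * norm x" by (rule norm_cauchy_schwarz)
    also have "\<dots> \<le> norm x * norm x" by (intro mult_right_mono normZ) auto
    finally show ?thesis by (simp add: power2_eq_square)
  qed
  have diffpos: "pos_op (\<lambda>x. ?Z n x - ?Z m x)" if "m \<le> n" for m n
    by (rule nonneg_poly_pos[OF B nonneg_poly_sqrt_iter_diff[OF lin that]])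
  have mono: "?Z m x \<bullet> x \<le> ?Z n x \<bullet> x" if "m \<le> n" for m n x
    using pos_opD[OF diffpos[OF that], of x] by (simp add: inner_diff_left)
  \<comment> \<open>The difference of two iterates is positive and at most the identity, so its form
    controls its norm with constant 1.\<close>
  have dom': "(norm (?Z n x - ?Z m x))\<^sup>2 \<le> ?Z n x \<bullet> x - ?Z m x \<bullet> x" if "m \<le> n" for m n x
  proof -
    have "(norm (?Z n x - ?Z m x))\<^sup>2 \<le> 1 * ((?Z n x - ?Z m x) \<bullet> x)"
    proof (rule pos_op_norm_le[OF diffpos[OF that]])
      show "(?Z n x - ?Z m x) \<bullet> x \<le> 1 * (norm x)\<^sup>2" for x
        using Zle[of n x] pos_opD[OF pos, of m x] by (simp add: inner_diff_left)
    qed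
    then show ?thesis by (simp add: inner_diff_left)
  qed
  have dom: "(norm (?Z n x - ?Z m x))\<^sup>2 \<le> \<bar>?Z n x \<bullet> x - ?Z m x \<bullet> x\<bar>" for m n x
    using dom'[of m n x] dom'[of n m x] by (cases "m \<le> n") (auto simp: norm_minus_commute)
  have "\<exists>l. (\<lambda>n. ?Z n x) \<longlonglongrightarrow> l" for x
  proof -
    obtain L where "(\<lambda>n. ?Z n x \<bullet> x) \<longlonglongrightarrow> L"
    proof (rule incseq_convergent)
      show "incseq (\<lambda>n. ?Z n x \<bullet> x)" using mono by (simp add: incseq_def)
      show "\<forall>i. ?Z i x \<bullet> x \<le> (norm x)\<^sup>2" using Zle by simp
    qed
    then show ?thesis by (rule tendsto_if_norm_dominated) (auto intro: dom)
  qed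
  then obtain Z where Z: "\<And>x. (\<lambda>n. ?Z n x) \<longlonglongrightarrow> Z x" by metis
  have normlim: "norm (Z x) \<le> norm x" for x
    using LIMSEQ_le_const2[OF tendsto_norm[OF Z]] normZ by blast
  have blin: "bounded_linear Z"
  proof (rule bounded_linear_intro[of _ 1])
    show "Z (x + y) = Z x + Z y" for x y
      using tendsto_add[OF Z[of x] Z[of y]] Z[of "x + y"]
      by (intro LIMSEQ_unique[OF Z]) (simp add: linear_add[OF bounded_linear.linear[OF blZ]])
    show "Z (r *\<^sub>R x) = r *\<^sub>R Z x" for r x
      using tendsto_scaleR[OF tendsto_const Z[of x], of r]
      by (intro LIMSEQ_unique[OF Z]) (simp add: linear_scale[OF bounded_linear.linear[OF blZ]])
    show "norm (Z x) \<le> norm x * 1" for x using normlim by simp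
  qed
  have "Z x \<bullet> y = x \<bullet> Z y" for x y
  proof (rule LIMSEQ_unique)
    show "(\<lambda>n. ?Z n x \<bullet> y) \<longlonglongrightarrow> Z x \<bullet> y" by (intro tendsto_intros Z)
    show "(\<lambda>n. ?Z n x \<bullet> y) \<longlonglongrightarrow> x \<bullet> Z y"
      unfolding symZ by (intro tendsto_intros Z)
  qed
  with blin have "sym_op Z" by (simp add: sym_op_def)
  moreover have "Z x \<bullet> x \<le> (norm x)\<^sup>2" for x
  proof (rule LIMSEQ_le_const2)
    show "(\<lambda>n. ?Z n x \<bullet> x) \<longlonglongrightarrow> Z x \<bullet> x" by (intro tendsto_intros Z)
    show "\<exists>N. \<forall>n\<ge>N. ?Z n x \<bullet> x \<le> (norm x)\<^sup>2" using Zle by blast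
  qed
  moreover have "2 *\<^sub>R Z x = B x + Z (Z x)" for x
  proof -
    \<comment> \<open>The iterates are contractions; this uniform bound makes the product of two
      strongly convergent sequences converge.\<close>
    have "(\<lambda>n. ?Z n (?Z n x - Z x)) \<longlonglongrightarrow> 0"
    proof (rule Lim_null_comparison)
      show "\<forall>\<^sub>F n in sequentially. norm (?Z n (?Z n x - Z x)) \<le> norm (?Z n x - Z x)"
        using normZ by simp
      show "(\<lambda>n. norm (?Z n x - Z x)) \<longlonglongrightarrow> 0"
        using Z[of x] by (simp add: LIM_zero_iff tendsto_norm_zero)
    qed
    from tendsto_add[OF this Z[of "Z x"]] have "(\<lambda>n. ?Z n (?Z n x)) \<longlonglongrightarrow> Z (Z x)"
      by (simp add: linear_diff[OF bounded_linear.linear[OF blZ]])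
    from tendsto_add[OF tendsto_const[of "B x"] this]
    have "(\<lambda>n. 2 *\<^sub>R ?Z (Suc n) x) \<longlonglongrightarrow> B x + Z (Z x)" by simp
    moreover have "(\<lambda>n. 2 *\<^sub>R ?Z (Suc n) x) \<longlonglongrightarrow> 2 *\<^sub>R Z x"
      by (rule tendsto_scaleR[OF tendsto_const LIMSEQ_Suc[OF Z]])
    ultimately show ?thesis by (rule LIMSEQ_unique[rotated])
  qed
  moreover have "Z \<in> bicommutant B"
  proof (rule bicommutantI, rule LIMSEQ_unique)
    fix T x assume T: "bounded_linear T" "\<And>x. T (B x) = B (T x)"
    show "(\<lambda>n. T (?Z n x)) \<longlonglongrightarrow> T (Z x)" by (rule bounded_linear.tendsto[OF T(1) Z])
    have "T (?Z n x) = ?Z n (T x)" for n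
      by (rule nonneg_poly_commute[of B]) (simp_all add: nonneg_poly_sqrt_iter bounded_linear.linear T)
    then show "(\<lambda>n. T (?Z n x)) \<longlonglongrightarrow> Z (T x)" using Z by simp
  qed
  ultimately show ?thesis using that by blast
qed

section \<open>Existence and uniqueness of the positive square root\<close>

lemma pos_op_sqrt_exists:
  fixes A :: "'a::{real_inner,complete_space} \<Rightarrow> 'a"
  assumes A: "pos_op A"
  obtains R where "pos_op R" "\<And>x. R (R x) = A x"
    "R \<in> bicommutant A"
proof -
  have sA: "sym_op A" using A by (simp add: pos_op_def)
  obtain K where K: "0 < K" "\<And>x. \<bar>A x \<bullet> x\<bar> \<le> K * (norm x)\<^sup>2" using sym_op_bound[OF sA] by metis
  \<comment> \<open>Scaling by the form bound \<open>K\<close> puts \<open>B\<close> between 0 and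
    the identity. From \<open>2 Z = B + Z Z\<close> the square of \<open>I - Z\<close> is
    \<open>I - B\<close>, that is \<open>A / K\<close>.\<close>
  define B where "B x = x - (1 / K) *\<^sub>R A x" for x
  have "sym_op B" unfolding B_def by (intro sym_op_diff sym_op_ident sym_op_scaleR sA)
  moreover have "0 \<le> B x \<bullet> x" for x
    using K(2)[of x] K(1) by (simp add: B_def inner_diff_left power2_norm_eq_inner field_simps abs_le_iff)
  ultimately have pB: "pos_op B" by (simp add: pos_op_def)
  have B1: "B x \<bullet> x \<le> (norm x)\<^sup>2" for x
    using pos_opD[OF A, of x] K(1) by (simp add: B_def inner_diff_left power2_norm_eq_inner)
  obtain Z where Z: "sym_op Z" "\<And>x. Z x \<bullet> x \<le> (norm x)\<^sup>2" "\<And>x. 2 *\<^sub>R Z x = B x + Z (Z x)"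
    and Zc: "Z \<in> bicommutant B"
    using sqrt_iter_limit[OF pB B1] by blast
  have linZ: "linear Z" using Z(1) by (simp add: sym_op_def bounded_linear.linear)
  define R where "R x = sqrt K *\<^sub>R (x - Z x)" for x
  have "sym_op R" unfolding R_def by (intro sym_op_diff sym_op_ident sym_op_scaleR Z)
  moreover have "0 \<le> R x \<bullet> x" for x
    using Z(2)[of x] K(1) by (simp add: R_def inner_diff_left power2_norm_eq_inner)
  ultimately have "pos_op R" by (simp add: pos_op_def)
  moreover have "R (R x) = A x" for x
  proof -
    have "R (R x) = (sqrt K * sqrt K) *\<^sub>R ((x - Z x) - (Z x - Z (Z x)))"
      unfolding R_def linear_scale[OF linZ] linear_diff[OF linZ] scaleR_scaleR[symmetric]
      by (simp only: scaleR_diff_right)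
    also have "\<dots> = K *\<^sub>R (x - 2 *\<^sub>R Z x + Z (Z x))"
      using K(1) by (simp add: scaleR_2 diff_diff_eq add_diff_eq)
    also have "\<dots> = K *\<^sub>R (x - B x)" by (simp add: Z(3))
    also have "\<dots> = A x" using K(1) by (simp add: B_def)
    finally show ?thesis .
  qed
  moreover have "R \<in> bicommutant A"
  proof (rule bicommutantI)
    fix T x assume T: "bounded_linear T" "\<And>x. T (A x) = A (T x)"
    have lin: "linear T" using T(1) by (rule bounded_linear.linear)
    have "T (Z x) = Z (T x)" for x
      by (rule bicommutantD[OF Zc T(1)]) (simp add: B_def linear_diff[OF lin] linear_scale[OF lin] T(2))
    then show "T (R x) = R (T x)" by (simp add: R_def linear_diff[OF lin] linear_scale[OF lin])
  qed
  ultimately show ?thesis using that by blast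
qed

text \<open>Commutation makes \<open>R + S\<close> annihilate \<open>y = R x - S x\<close>. Both
  forms then vanish at \<open>y\<close>, so \<open>R y = S y = 0\<close>, and moving
  \<open>R - S\<close> across the inner product gives \<open>y \<bullet> y = 0\<close>.\<close>

lemma pos_op_sqrt_unique_commuting:
  assumes R: "pos_op R" and S: "pos_op S" and sq: "\<And>x. R (R x) = S (S x)"
    and comm: "\<And>x. R (S x) = S (R x)"
  shows "R = S"
proof
  fix x
  have lin: "linear R" "linear S" and sym: "sym_op R" "sym_op S"
    using R S by (auto simp: pos_op_def sym_op_def bounded_linear.linear)
  define y where "y = R x - S x"
  have "R y + S y = 0" by (simp add: y_def linear_diff lin sq comm)
  then have "R y \<bullet> y + S y \<bullet> y = 0" by (simp flip: inner_add_left)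
  then have "R y \<bullet> y = 0" "S y \<bullet> y = 0"
    using pos_opD[OF R, of y] pos_opD[OF S, of y] by linarith+
  then have "R y = 0" "S y = 0" using pos_op_zero R S by blast+
  then have "y \<bullet> y = 0"
    using sym_opD[OF sym(1), of x y] sym_opD[OF sym(2), of x y]
    by (subst y_def) (simp add: inner_diff_left)
  then show "R x = S x" by (simp add: y_def)
qed

text \<open>\<open>R\<close> and \<open>S\<close> are not known to commute with each other. Each
  commutes with the common square, hence with the root \<open>Q\<close> taken from its bicommutant,
  and is compared with \<open>Q\<close>.\<close>

lemma pos_op_sqrt_unique:
  fixes R :: "'a::{real_inner,complete_space} \<Rightarrow> 'a"
  assumes R: "pos_op R" and S: "pos_op S" and sq: "\<And>x. R (R x) = S (S x)"
  shows "R = S"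
proof -
  have bl: "bounded_linear R" "bounded_linear S" using R S by (auto simp: pos_op_def sym_op_def)
  obtain Q where Q: "pos_op Q" "\<And>x. Q (Q x) = R (R x)"
    and c: "Q \<in> bicommutant (\<lambda>x. R (R x))"
    using pos_op_sqrt_exists[OF pos_op_square[of R]] R unfolding pos_op_def by blast
  have "R = Q" by (rule pos_op_sqrt_unique_commuting[OF R Q(1)]) (use Q bicommutantD[OF c bl(1)] in auto)
  moreover have "S = Q"
    by (rule pos_op_sqrt_unique_commuting[OF S Q(1)]) (use Q bicommutantD[OF c bl(2)] sq in auto)
  ultimately show ?thesis by simp
qed

section \<open>Spectral projections\<close>

definition sym_proj :: "('a::real_inner \<Rightarrow> 'a) \<Rightarrow> bool"
  where "sym_proj P \<longleftrightarrow> sym_op P \<and> (\<forall>x. P (P x) = P x)"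

lemma sym_projD:
  assumes "sym_proj P"
  shows "linear P" "bounded_linear P" "P (P x) = P x" "P x \<bullet> y = x \<bullet> P y"
    "P x \<bullet> x = (norm (P x))\<^sup>2" "norm (P x) \<le> norm x"
proof -
  show bl: "bounded_linear P" and "linear P" and idem: "P (P x) = P x" for x
    using assms by (auto simp: sym_proj_def sym_op_def bounded_linear.linear)
  show s: "P x \<bullet> y = x \<bullet> P y" for x y using assms by (simp add: sym_proj_def sym_opD)
  show e: "P x \<bullet> x = (norm (P x))\<^sup>2" using s[of "P x" x] by (simp add: power2_norm_eq_inner idem)
  have "(norm (P x))\<^sup>2 \<le> norm (P x) * norm x" unfolding e[symmetric] by (rule norm_cauchy_schwarz)
  then show "norm (P x) \<le> norm x"
    by (cases "P x = 0") (auto simp: power2_eq_square)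
qed

lemma closed_subspace_projection:
  fixes M :: "'a::{real_inner,complete_space} set"
  assumes M: "subspace M" "closed M"
  obtains P where "sym_proj P" "range P = M" "\<And>x. x \<in> M \<Longrightarrow> P x = x"
    "\<And>x y. y \<in> M \<Longrightarrow> (x - P x) \<bullet> y = 0"
    "\<And>x u. u \<in> M \<Longrightarrow> (\<And>y. y \<in> M \<Longrightarrow> (x - u) \<bullet> y = 0) \<Longrightarrow> P x = u"
proof -
  define P where "P x = (SOME u. u \<in> M \<and> (\<forall>y\<in>M. (x - u) \<bullet> y = 0))" for x
  have "P x \<in> M \<and> (\<forall>y\<in>M. (x - P x) \<bullet> y = 0)" for x
    unfolding P_def
    by (rule someI_ex, rule closed_subspace_decomposition[OF M, of x], blast)
  then have PM: "P x \<in> M" and Pperp: "y \<in> M \<Longrightarrow> (x - P x) \<bullet> y = 0" for x y by blast+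
  have uniq: "P x = u" if u: "u \<in> M" "\<And>y. y \<in> M \<Longrightarrow> (x - u) \<bullet> y = 0" for x u
  proof -
    define w where "w = u - P x"
    have "w \<in> M" unfolding w_def using M(1) u(1) PM by (rule subspace_diff)
    then have "(x - P x) \<bullet> w - (x - u) \<bullet> w = 0" using u(2) Pperp by simp
    also have "(x - P x) \<bullet> w - (x - u) \<bullet> w = w \<bullet> w"
      unfolding inner_diff_left[symmetric] by (simp add: w_def)
    finally show ?thesis by (simp add: w_def)
  qed
  have id: "P x = x" if "x \<in> M" for x by (rule uniq[OF that]) simp
  have sym: "P x \<bullet> y = x \<bullet> P y" for x y
  proof -
    have "x \<bullet> P y = P x \<bullet> P y" "y \<bullet> P x = P y \<bullet> P x"
      using Pperp[OF PM[of y], of x] Pperp[OF PM[of x], of y] by (simp_all only: inner_diff_left right_minus_eq)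
    then show ?thesis by (metis inner_commute)
  qed
  have "norm (P x) \<le> norm x" for x
  proof -
    have "(norm (P x))\<^sup>2 = P x \<bullet> x"
      using sym[of "P x" x] by (simp add: power2_norm_eq_inner id[OF PM])
    also have "\<dots> \<le> norm (P x) * norm x" by (rule norm_cauchy_schwarz)
    finally show ?thesis by (cases "P x = 0") (auto simp: power2_eq_square)
  qed
  moreover have Pin: "P x \<bullet> y = x \<bullet> y" if "y \<in> M" for x y
    using Pperp[OF that, of x] by (simp add: inner_diff_left)
  have "P (x + y) = P x + P y" for x y
    by (rule uniq) (simp_all add: M(1) PM Pin subspace_add inner_diff_left inner_add_left)
  moreover have "P (r *\<^sub>R x) = r *\<^sub>R P x" for r x
    by (rule uniq) (simp_all add: M(1) PM Pin subspace_scale inner_diff_left)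
  ultimately have "bounded_linear P" by (intro bounded_linear_intro[of _ 1]) auto
  then have "sym_proj P" by (simp add: sym_proj_def sym_op_def sym id PM)
  moreover have "range P = M" using PM by (auto intro!: image_eqI id[symmetric])
  ultimately show ?thesis by (rule that[OF _ _ id Pperp uniq])
qed

lemma projection_onto_kernel:
  fixes W :: "'a::{real_inner,complete_space} \<Rightarrow> 'a"
  assumes W: "sym_op W"
  obtains P where "sym_proj P" "\<And>x. W (P x) = 0" "\<And>x. W x = 0 \<Longrightarrow> P x = x"
    "P \<in> bicommutant W"
proof -
  have bl: "bounded_linear W" using W by (simp add: sym_op_def)
  define M where "M = {x. W x = 0}"
  have lin: "linear W" using bl by (rule bounded_linear.linear)
  have "subspace M"
    by (auto simp: M_def subspace_def linear_0[OF lin] linear_add[OF lin] linear_scale[OF lin])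
  moreover have "closed M"
    unfolding M_def by (intro closed_Collect_eq continuous_on_const
        bounded_linear.continuous_on[OF bl continuous_on_id])
  ultimately obtain P where P: "sym_proj P" "range P = M" "\<And>x. x \<in> M \<Longrightarrow> P x = x"
    "\<And>x y. y \<in> M \<Longrightarrow> (x - P x) \<bullet> y = 0"
    "\<And>x u. u \<in> M \<Longrightarrow> (\<And>y. y \<in> M \<Longrightarrow> (x - u) \<bullet> y = 0) \<Longrightarrow> P x = u"
    using closed_subspace_projection by blast
  have PM: "P x \<in> M" for x using P(2) by auto
  have "P \<in> bicommutant W"
  proof (rule bicommutantI)
    fix T x assume T: "bounded_linear T" "\<And>x. T (W x) = W (T x)"
    obtain T' where T': "bounded_linear T'" "\<And>x y. T x \<bullet> y = x \<bullet> T' y"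
      using adjoint_exists[OF T(1)] by metis
    \<comment> \<open>\<open>T\<close> preserves the kernel of \<open>W\<close>. That it also
      preserves the orthogonal complement amounts to its adjoint preserving the kernel, which
      follows since \<open>W\<close> is symmetric.\<close>
    have comm': "W (T' y) = T' (W y)" for y
    proof (subst vector_eq_ldot[symmetric], rule allI)
      fix x
      have "x \<bullet> W (T' y) = T (W x) \<bullet> y" by (simp add: T'(2) sym_opD[OF W])
      also have "\<dots> = x \<bullet> T' (W y)" by (simp add: T(2) sym_opD[OF W] T'(2)[symmetric])
      finally show "x \<bullet> W (T' y) = x \<bullet> T' (W y)" .
    qed
    have "P (T x) = T (P x)"
    proof (rule P(5))
      show "T (P x) \<in> M" using PM[of x] linear_0[OF bounded_linear.linear[OF T(1)]]
        by (simp add: M_def flip: T(2))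
      fix y assume y: "y \<in> M"
      have "T' y \<in> M" using y linear_0[OF bounded_linear.linear[OF T'(1)]]
        by (simp add: M_def comm')
      then show "(T x - T (P x)) \<bullet> y = 0"
        using P(4) by (simp add: T'(2) linear_diff[OF bounded_linear.linear[OF T(1)], symmetric])
    qed
    then show "T (P x) = P (T x)" by simp
  qed
  with P PM that show ?thesis by (auto simp: M_def)
qed

text \<open>\<open>P\<close> is the projection onto the kernel of the positive part \<open>(\<bar>Y\<bar> + Y) / 2\<close>.\<close>
lemma nonpositive_part_projection:
  fixes Y :: "'a::{real_inner,complete_space} \<Rightarrow> 'a"
  assumes Y: "sym_op Y"
  obtains P where "sym_proj P"
    "P \<in> bicommutant Y"
    "\<And>x. P x = x \<Longrightarrow> Y x \<bullet> x \<le> 0"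
    "\<And>x. P x = 0 \<Longrightarrow> x \<noteq> 0 \<Longrightarrow> 0 < Y x \<bullet> x"
proof -
  have blY: "bounded_linear Y" and linY: "linear Y"
    using Y by (auto simp: sym_op_def bounded_linear.linear)
  obtain R where R: "pos_op R" "\<And>x. R (R x) = Y (Y x)"
    and Rc: "R \<in> bicommutant (\<lambda>x. Y (Y x))"
    using pos_op_sqrt_exists[OF pos_op_square[OF Y]] by blast
  have sR: "sym_op R" and linR: "linear R"
    using R(1) by (auto simp: pos_op_def sym_op_def bounded_linear.linear)
  have YR: "Y (R x) = R (Y x)" for x by (rule bicommutantD[OF Rc blY]) simp
  \<comment> \<open>With \<open>R\<close> the modulus of \<open>Y\<close>, \<open>W\<close> and
    \<open>D\<close> are twice the positive and the negative part of \<open>Y\<close>; their product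
    vanishes.\<close>
  define W where "W x = R x + Y x" for x
  define D where "D x = R x - Y x" for x
  have sW: "sym_op W" and sD: "sym_op D"
    unfolding W_def D_def by (intro sym_op_add sym_op_diff sR Y)+
  have WD: "W (D x) = 0" for x
    by (simp add: W_def D_def linear_diff[OF linR] linear_diff[OF linY] R(2) YR)
  have DW: "D (W x) = W (D x)" for x
    by (simp add: W_def D_def linear_diff[OF linR] linear_diff[OF linY] linear_add[OF linR] linear_add[OF linY] R(2) YR)
  obtain P where P: "sym_proj P" "\<And>x. W (P x) = 0" "\<And>x. W x = 0 \<Longrightarrow> P x = x"
    and Pc: "P \<in> bicommutant W"
    using projection_onto_kernel[OF sW] by blast
  have "P \<in> bicommutant Y"
  proof (rule bicommutantI)
    fix T x assume T: "bounded_linear T" "\<And>x. T (Y x) = Y (T x)"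
    have "T (R x) = R (T x)" for x by (rule bicommutantD[OF Rc T(1)]) (simp add: T(2))
    then show "T (P x) = P (T x)"
      by (intro bicommutantD[OF Pc T(1)]) (simp add: W_def linear_add[OF bounded_linear.linear[OF T(1)]] T(2))
  qed
  moreover have "Y x \<bullet> x \<le> 0" if "P x = x" for x
  proof -
    have "W x = 0" using P(2)[of x] that by simp
    then have "Y x = - R x" by (simp add: W_def add_eq_0_iff)
    then show ?thesis using pos_opD[OF R(1), of x] by simp
  qed
  \<comment> \<open>Here \<open>D x = P (D x) = D (P x) = 0\<close>, so \<open>Y x = R x\<close>.
    Strictness holds because \<open>R x = 0\<close> would put \<open>x\<close> into the kernel of
    \<open>W\<close>, the range of \<open>P\<close>.\<close>
  moreover have "0 < Y x \<bullet> x" if "P x = 0" "x \<noteq> 0" for x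
  proof -
    have "P (D x) = D x" by (rule P(3)[OF WD])
    moreover have "D (P x) = P (D x)" using sD
      by (intro bicommutantD[OF Pc] DW) (simp add: sym_op_def)
    ultimately have "D x = 0"
      using that(1) sD by (simp add: sym_op_def linear_0 bounded_linear.linear)
    then have e: "Y x = R x" by (simp add: D_def)
    have "R x \<bullet> x \<noteq> 0"
    proof
      assume "R x \<bullet> x = 0"
      then have "R x = 0" using pos_op_zero[OF R(1)] by blast
      with e have "W x = 0" by (simp add: W_def)
      with P(3) that show False by force
    qed
    with e pos_opD[OF R(1), of x] show ?thesis by simp
  qed
  ultimately show ?thesis using that P(1) by blast
qed

section \<open>Monotone families of projections\<close>

locale mono_proj_family =
  fixes E :: "real \<Rightarrow> 'a::{real_inner,complete_space} \<Rightarrow> 'a"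
  assumes proj: "sym_proj (E t)"
    and mono: "s \<le> t \<Longrightarrow> E s x \<bullet> x \<le> E t x \<bullet> x"
begin

lemmas idem = sym_projD(3)[OF proj] and sym = sym_projD(4)[OF proj]
  and bl = sym_projD(2)[OF proj] and lin = sym_projD(1)[OF proj]

lemma absorb_left:
  assumes "s \<le> t"
  shows "E t (E s x) = E s x"
proof -
  define y where "y = E s x"
  have "y \<bullet> y \<le> E t y \<bullet> y" using mono[OF assms, of y] by (simp add: y_def idem)
  moreover have "(y - E t y) \<bullet> (y - E t y) = y \<bullet> y - E t y \<bullet> y"
    using sym[of t "E t y" y] by (simp add: inner_diff_left inner_diff_right idem inner_commute)
  ultimately have "(y - E t y) \<bullet> (y - E t y) \<le> 0" by simp
  then have "y - E t y = 0" using inner_gt_zero_iff[of "y - E t y"] by linarith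
  then have "y = E t y" by simp
  then show ?thesis by (simp add: y_def)
qed

lemma absorb_right:
  assumes "s \<le> t"
  shows "E s (E t x) = E s x"
proof (subst vector_eq_ldot[symmetric], rule allI)
  show "z \<bullet> E s (E t x) = z \<bullet> E s x" for z
    by (simp only: sym[symmetric] absorb_left[OF assms])
qed

lemma bounds: "0 \<le> E t x \<bullet> x" "E t x \<bullet> x \<le> (norm x)\<^sup>2"
  using sym_projD(5,6)[OF proj, of t x] by (simp_all add: power_mono)

lemma norm_diff:
  assumes "s \<le> t"
  shows "(norm (E t x - E s x))\<^sup>2 = E t x \<bullet> x - E s x \<bullet> x"
proof -
  have "E t x \<bullet> E t x = E t x \<bullet> x" "E s x \<bullet> E s x = E s x \<bullet> x" "E t x \<bullet> E s x = E s x \<bullet> x"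
    using sym[of t x "E t x"] sym[of s x "E s x"] sym[of t x "E s x"]
    by (simp_all add: idem absorb_left[OF assms] inner_commute)
  then show ?thesis
    by (simp add: power2_norm_eq_inner inner_diff_left inner_diff_right inner_commute)
qed

lemma norm_diff_abs: "(norm (E t x - E s x))\<^sup>2 \<le> \<bar>E t x \<bullet> x - E s x \<bullet> x\<bar>"
  using norm_diff[of s t x] norm_diff[of t s x] mono[of s t x] mono[of t s x]
  by (cases "s \<le> t") (auto simp: norm_minus_commute)

lemma left_limit_exists: "\<exists>l. ((\<lambda>s. E s x) \<longlongrightarrow> l) (at_left t)"
proof -
  define L where "L = Sup ((\<lambda>s. E s x \<bullet> x) ` {..<t})"
  have ne: "(\<lambda>s. E s x \<bullet> x) ` {..<t} \<noteq> {}" using lessThan_iff[of "t - 1" t] by auto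
  have bdd: "bdd_above ((\<lambda>s. E s x \<bullet> x) ` {..<t})" using bounds(2) by (auto simp: bdd_above_def)
  have "((\<lambda>s. E s x \<bullet> x) \<longlongrightarrow> L) (at_left t)"
  proof (rule order_tendstoI)
    fix a assume "a < L"
    then obtain s where s: "s < t" "a < E s x \<bullet> x"
      unfolding L_def less_cSup_iff[OF ne bdd] by auto
    show "\<forall>\<^sub>F r in at_left t. a < E r x \<bullet> x"
      unfolding eventually_at_left_field
      using s mono[of s _ x] by (intro exI[of _ s]) (auto intro: less_le_trans less_imp_le)
  next
    fix a assume "L < a"
    moreover have "E r x \<bullet> x \<le> L" if "r < t" for r
      unfolding L_def using that by (intro cSup_upper bdd) auto
    ultimately show "\<forall>\<^sub>F r in at_left t. E r x \<bullet> x < a"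
      unfolding eventually_at_left_field by (intro exI[of _ "t - 1"]) (auto intro: le_less_trans)
  qed
  then show ?thesis by (rule tendsto_if_norm_dominated) (auto intro: norm_diff_abs)
qed

text \<open>In a right-continuous family \<open>E 0\<close> includes the kernel of the operator; the
  projection for the open half-line below 0 is the left limit.\<close>

definition left_lim :: "real \<Rightarrow> 'a \<Rightarrow> 'a"
  where "left_lim t x = Lim (at_left t) (\<lambda>s. E s x)"

lemma tendsto_left_lim: "((\<lambda>s. E s x) \<longlongrightarrow> left_lim t x) (at_left t)"
  unfolding left_lim_def using left_limit_exists by (metis tendsto_Lim trivial_limit_at_left_real)

lemma left_lim_eqI: "((\<lambda>s. E s x) \<longlongrightarrow> l) (at_left t) \<Longrightarrow> left_lim t x = l"
  by (rule tendsto_unique[OF _ tendsto_left_lim]) simp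

lemma left_lim_ge:
  assumes "t \<le> s"
  shows "E s (left_lim t x) = left_lim t x"
proof (rule tendsto_unique)
  show "((\<lambda>r. E s (E r x)) \<longlongrightarrow> E s (left_lim t x)) (at_left t)"
    by (rule bounded_linear.tendsto[OF bl tendsto_left_lim])
  show "((\<lambda>r. E s (E r x)) \<longlongrightarrow> left_lim t x) (at_left t)"
  proof (rule Lim_transform_eventually[OF tendsto_left_lim])
    show "\<forall>\<^sub>F r in at_left t. E r x = E s (E r x)"
      using assms unfolding eventually_at_left_field
      by (intro exI[of _ "t - 1"]) (auto simp: absorb_left)
  qed
qed simp

lemma left_lim_less:
  assumes "s < t"
  shows "E s (left_lim t x) = E s x"
proof (rule tendsto_unique)
  show "((\<lambda>r. E s (E r x)) \<longlongrightarrow> E s (left_lim t x)) (at_left t)"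
    by (rule bounded_linear.tendsto[OF bl tendsto_left_lim])
  show "((\<lambda>r. E s (E r x)) \<longlongrightarrow> E s x) (at_left t)"
  proof (rule Lim_transform_eventually[OF tendsto_const])
    show "\<forall>\<^sub>F r in at_left t. E s x = E s (E r x)"
      using assms unfolding eventually_at_left_field
      by (intro exI[of _ s]) (auto simp: absorb_right)
  qed
qed simp

lemma left_lim_proj: "sym_proj (left_lim t)"
proof -
  have "bounded_linear (left_lim t)"
  proof (rule bounded_linear_intro[of _ 1])
    show "left_lim t (x + y) = left_lim t x + left_lim t y" for x y
      by (rule left_lim_eqI) (simp add: linear_add[OF lin] tendsto_add tendsto_left_lim)
    show "left_lim t (r *\<^sub>R x) = r *\<^sub>R left_lim t x" for r x
      by (rule left_lim_eqI) (simp add: linear_scale[OF lin] tendsto_scaleR tendsto_left_lim)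
    show "norm (left_lim t x) \<le> norm x * 1" for x
    proof (rule tendsto_upperbound)
      show "((\<lambda>s. norm (E s x)) \<longlongrightarrow> norm (left_lim t x)) (at_left t)"
        by (rule tendsto_norm[OF tendsto_left_lim])
    qed (simp_all add: sym_projD(6)[OF proj])
  qed
  moreover have "left_lim t x \<bullet> y = x \<bullet> left_lim t y" for x y
  proof (rule tendsto_unique)
    show "((\<lambda>s. E s x \<bullet> y) \<longlongrightarrow> left_lim t x \<bullet> y) (at_left t)"
      by (intro tendsto_intros tendsto_left_lim)
    show "((\<lambda>s. E s x \<bullet> y) \<longlongrightarrow> x \<bullet> left_lim t y) (at_left t)"
      unfolding sym by (intro tendsto_intros tendsto_left_lim)
  qed simp
  moreover have "left_lim t (left_lim t x) = left_lim t x" for x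
  proof (rule left_lim_eqI, rule Lim_transform_eventually[OF tendsto_left_lim])
    show "\<forall>\<^sub>F s in at_left t. E s x = E s (left_lim t x)"
      unfolding eventually_at_left_field by (intro exI[of _ "t - 1"]) (auto simp: left_lim_less)
  qed
  ultimately show ?thesis by (simp add: sym_proj_def sym_op_def)
qed

end

lemma sym_proj_complement:
  assumes "sym_proj P"
  shows "sym_proj (\<lambda>x. x - P x)"
  using assms sym_op_diff[OF sym_op_ident, of P]
  by (simp add: sym_proj_def linear_diff[OF sym_projD(1)[OF assms]])

context mono_proj_family
begin

lemma right_limit_exists: "\<exists>l. ((\<lambda>s. E s x) \<longlongrightarrow> l) (at_right t)"
proof -
  \<comment> \<open>Reflecting the parameter and passing to complementary projections gives another
    increasing family, which turns right limits into left limits.\<close>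
  interpret refl: mono_proj_family "\<lambda>t x. x - E (- t) x"
    by unfold_locales (auto simp: inner_diff_left intro: mono sym_proj_complement[OF proj])
  obtain l where "((\<lambda>s. x - E (- s) x) \<longlongrightarrow> l) (at_left (- t))"
    using refl.left_limit_exists by blast
  then have "((\<lambda>s. x - E s x) \<longlongrightarrow> l) (at_right t)"
    by (simp add: filterlim_def at_left_minus[of "- t"] filtermap_filtermap)
  then have "((\<lambda>s. x - (x - E s x)) \<longlongrightarrow> x - l) (at_right t)" by (intro tendsto_intros)
  then show ?thesis by auto
qed

end

section \<open>Construction of the spectral family\<close>

lemma spectral_family_exists_real:
  fixes X :: "'a::{real_inner,complete_space} \<Rightarrow> 'a"
  assumes X: "sym_op X"
  obtains E K where "mono_proj_family E" "\<And>t. E t \<in> bicommutant X"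
    "\<And>t x. E t x = x \<Longrightarrow> X x \<bullet> x \<le> t * (norm x)\<^sup>2"
    "\<And>t x. E t x = 0 \<Longrightarrow> t * (norm x)\<^sup>2 \<le> X x \<bullet> x"
    "\<And>t x. ((\<lambda>s. E s x) \<longlongrightarrow> E t x) (at_right t)"
    "0 < K" "\<And>t x. t < - K \<Longrightarrow> E t x = 0" "\<And>t x. K \<le> t \<Longrightarrow> E t x = x"
proof -
  have blX: "bounded_linear X" using X by (simp add: sym_op_def)
  define good where "good t P \<longleftrightarrow> sym_proj P \<and> P \<in> bicommutant (\<lambda>x. X x - t *\<^sub>R x) \<and>
      (\<forall>x. P x = x \<longrightarrow> (X x - t *\<^sub>R x) \<bullet> x \<le> 0) \<and>
      (\<forall>x. P x = 0 \<longrightarrow> x \<noteq> 0 \<longrightarrow> 0 < (X x - t *\<^sub>R x) \<bullet> x)" for t P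
  have "\<exists>P. good t P" for t
    unfolding good_def
    by (rule nonpositive_part_projection[OF sym_op_diff[OF X sym_op_scaleR[OF sym_op_ident]]]) blast
  then obtain E where E: "\<And>t. good t (E t)" by metis
  have proj: "sym_proj (E t)"
    and bic: "E t \<in> bicommutant (\<lambda>x. X x - t *\<^sub>R x)"
    and le0: "E t x = x \<Longrightarrow> (X x - t *\<^sub>R x) \<bullet> x \<le> 0"
    and gr0: "E t x = 0 \<Longrightarrow> x \<noteq> 0 \<Longrightarrow> 0 < (X x - t *\<^sub>R x) \<bullet> x" for t x
    using E[of t] by (simp_all add: good_def)
  have le: "X x \<bullet> x \<le> t * (norm x)\<^sup>2" if "E t x = x" for t x
    using le0[OF that] by (simp add: inner_diff_left power2_norm_eq_inner)
  have gr: "t * (norm x)\<^sup>2 < X x \<bullet> x" if "E t x = 0" "x \<noteq> 0" for t x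
    using gr0[OF that] by (simp add: inner_diff_left power2_norm_eq_inner)
  have bicX: "E t \<in> bicommutant X" for t
  proof (rule bicommutantI)
    fix T x assume T: "bounded_linear T" "\<And>x. T (X x) = X (T x)"
    show "T (E t x) = E t (T x)"
      by (rule bicommutantD[OF bic T(1)])
        (simp add: T(2) linear_diff linear_scale bounded_linear.linear[OF T(1)])
  qed
  have lin: "linear (E t)" and blE: "bounded_linear (E t)" and idem: "E t (E t x) = E t x" for t x
    using sym_projD[OF proj] by auto
  have XE: "X (E t x) = E t (X x)" for t x by (rule bicommutantD[OF bicX blX]) simp
  have EE: "E s (E t x) = E t (E s x)" for s t x by (rule bicommutantD[OF bicX blE]) (simp add: XE)
  \<comment> \<open>Such a nonzero \<open>y\<close> would satisfy
    \<open>t |y|^2 < (X y, y) <= s |y|^2\<close>. With commutation this gives monotonicity of the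
    family.\<close>
  have zero: "y = 0" if "E s y = y" "E t y = 0" "s \<le> t" for s t y
  proof (rule ccontr)
    assume "y \<noteq> 0"
    then have "t * (norm y)\<^sup>2 < s * (norm y)\<^sup>2" using le[OF that(1)] gr[OF that(2)] by linarith
    with that(3) show False using mult_right_mono[of s t "(norm y)\<^sup>2"] by simp
  qed
  have absorb: "E t (E s x) = E s x" if "s \<le> t" for s t x
  proof -
    have "E s x - E t (E s x) = 0"
      by (rule zero[OF _ _ that]) (simp_all add: linear_diff[OF lin] idem EE[of s t])
    then show ?thesis by simp
  qed
  interpret mono_proj_family E
  proof
    fix s t :: real and x assume "s \<le> t"
    then have "norm (E s x) = norm (E s (E t x))" by (simp add: EE[of s t] absorb)
    also have "\<dots> \<le> norm (E t x)" by (rule sym_projD(6)[OF proj])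
    finally show "E s x \<bullet> x \<le> E t x \<bullet> x" by (simp add: sym_projD(5)[OF proj] power_mono)
  qed (rule proj)
  have rc: "((\<lambda>s. E s x) \<longlongrightarrow> E t x) (at_right t)" for t x
  proof -
    obtain l where l: "((\<lambda>s. E s x) \<longlongrightarrow> l) (at_right t)" using right_limit_exists by blast
    have up: "E s l = l" if "t < s" for s
    proof (rule tendsto_unique)
      show "((\<lambda>r. E s (E r x)) \<longlongrightarrow> E s l) (at_right t)" by (rule bounded_linear.tendsto[OF blE l])
      show "((\<lambda>r. E s (E r x)) \<longlongrightarrow> l) (at_right t)"
      proof (rule Lim_transform_eventually[OF l])
        show "\<forall>\<^sub>F r in at_right t. E r x = E s (E r x)"
          using that unfolding eventually_at_right_field
          by (intro exI[of _ s]) (auto simp: absorb)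
      qed
    qed simp
    have low: "E t l = E t x"
    proof (rule tendsto_unique)
      show "((\<lambda>r. E t (E r x)) \<longlongrightarrow> E t l) (at_right t)" by (rule bounded_linear.tendsto[OF blE l])
      show "((\<lambda>r. E t (E r x)) \<longlongrightarrow> E t x) (at_right t)"
      proof (rule Lim_transform_eventually[OF tendsto_const])
        show "\<forall>\<^sub>F r in at_right t. E t x = E t (E r x)"
          unfolding eventually_at_right_field
          by (intro exI[of _ "t + 1"]) (auto simp: absorb_right)
      qed
    qed simp
    \<comment> \<open>\<open>y\<close> lies in the range of every \<open>E s\<close> with
      \<open>s > t\<close> and in the kernel of \<open>E t\<close>. If it were nonzero its Rayleigh
      quotient would exceed \<open>t\<close> strictly, yet be at most every such
      \<open>s\<close>.\<close>
    define y where "y = l - E t x"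
    have Ey: "E s y = y" if "t < s" for s
      using that by (simp add: y_def linear_diff[OF lin] up absorb)
    have "E t y = 0" by (simp add: y_def linear_diff[OF lin] low idem)
    have "y = 0"
    proof (rule ccontr)
      assume "y \<noteq> 0"
      with \<open>E t y = 0\<close> have "t * (norm y)\<^sup>2 < X y \<bullet> y" by (rule gr)
      with \<open>y \<noteq> 0\<close> have "t < (X y \<bullet> y) / (norm y)\<^sup>2" by (simp add: field_simps)
      then obtain s where "t < s" "s < (X y \<bullet> y) / (norm y)\<^sup>2" using dense by blast
      with le[OF Ey, of s] \<open>y \<noteq> 0\<close> show False by (simp add: field_simps)
    qed
    with l show ?thesis by (simp add: y_def)
  qed
  obtain K where K: "0 < K" "\<And>x. \<bar>X x \<bullet> x\<bar> \<le> K * (norm x)\<^sup>2" using sym_op_bound[OF X] by metis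
  have "E t x = 0" if "t < - K" for t x
  proof (rule ccontr)
    assume *: "E t x \<noteq> 0"
    have "X (E t x) \<bullet> E t x \<le> t * (norm (E t x))\<^sup>2" by (rule le[OF idem])
    also have "\<dots> < - K * (norm (E t x))\<^sup>2" by (rule mult_strict_right_mono[OF that]) (use * in simp)
    finally show False using K(2)[of "E t x"] by (simp add: abs_le_iff)
  qed
  note 1 = this
  have 2: "E t x = x" if "K \<le> t" for t x
  proof (rule ccontr)
    assume *: "E t x \<noteq> x"
    define y where "y = x - E t x"
    have "t * (norm y)\<^sup>2 < X y \<bullet> y" using * by (intro gr) (simp_all add: y_def linear_diff[OF lin] idem)
    moreover have "K * (norm y)\<^sup>2 \<le> t * (norm y)\<^sup>2" using that by (simp add: mult_right_mono)
    ultimately show False using K(2)[of y] by (simp add: abs_le_iff)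
  qed
  have 3: "t * (norm x)\<^sup>2 \<le> X x \<bullet> x" if "E t x = 0" for t x
    using gr[OF that] linear_0[OF bounded_linear.linear[OF blX]] by (cases "x = 0") auto
  show ?thesis by (rule that[OF mono_proj_family_axioms bicX le 3 rc K(1) 1 2])
qed

section \<open>Stieltjes integrals of the identity\<close>

text \<open>Summing over \<open>n + 1\<close> equal steps bounds the total change by the mesh times
  \<open>F b - F a\<close>. Jumps of \<open>F\<close> do no harm.\<close>

lemma constant_if_increments_small:
  fixes D F :: "real \<Rightarrow> real"
  assumes D: "\<And>s t. s \<le> t \<Longrightarrow> \<bar>D t - D s\<bar> \<le> (t - s) * (F t - F s)"
  shows "D a = D b"
proof -
  have le: "D a = D b" if "a \<le> b" for a b
  proof -
    have "\<bar>D b - D a\<bar> \<le> ((b - a) * (F b - F a)) * inverse (real (Suc n))" for n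
    proof -
      define d where "d = (b - a) / real (Suc n)"
      define p where "p i = a + real i * d" for i
      have d: "0 \<le> d" using that by (simp add: d_def)
      have p: "p 0 = a" "p (Suc n) = b" by (simp_all add: p_def d_def)
      have step: "\<bar>D (p (Suc i)) - D (p i)\<bar> \<le> d * (F (p (Suc i)) - F (p i))" for i
      proof -
        have "p (Suc i) - p i = d" by (simp add: p_def distrib_right)
        then show ?thesis using D[of "p i" "p (Suc i)"] d by simp
      qed
      have "\<bar>D b - D a\<bar> = \<bar>\<Sum>i<Suc n. D (p (Suc i)) - D (p i)\<bar>"
        by (simp only: sum_lessThan_telescope[of "\<lambda>i. D (p i)"] p)
      also have "\<dots> \<le> (\<Sum>i<Suc n. d * (F (p (Suc i)) - F (p i)))"
        by (rule order_trans[OF sum_abs sum_mono[OF step]])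
      also have "\<dots> = d * (F b - F a)"
        by (simp only: sum_distrib_left[symmetric] sum_lessThan_telescope[of "\<lambda>i. F (p i)"] p)
      also have "\<dots> = ((b - a) * (F b - F a)) * inverse (real (Suc n))"
        by (simp only: d_def divide_inverse mult_ac)
      finally show ?thesis .
    qed
    moreover have "(\<lambda>n. ((b - a) * (F b - F a)) * inverse (real (Suc n))) \<longlonglongrightarrow> ((b - a) * (F b - F a)) * 0"
      by (intro tendsto_intros LIMSEQ_inverse_real_of_nat)
    ultimately have "\<bar>D b - D a\<bar> \<le> ((b - a) * (F b - F a)) * 0"
      using LIMSEQ_le_const by blast
    then show ?thesis by simp
  qed
  then show ?thesis using le[of a b] le[of b a] by linarith
qed

text \<open>The bounds that a single Riemann-Stieltjes step imposes on a primitive of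
  \<open>t dF\<close>. They fix it up to an additive constant, so an integral of the identity can be
  recognised from increments alone.\<close>

definition id_bounds :: "(real \<Rightarrow> real) \<Rightarrow> (real \<Rightarrow> real) \<Rightarrow> bool"
  where "id_bounds F \<Psi> \<longleftrightarrow> (\<forall>s t. s \<le> t \<longrightarrow> s * (F t - F s) \<le> \<Psi> t - \<Psi> s \<and> \<Psi> t - \<Psi> s \<le> t * (F t - F s))"

locale stieltjes =
  fixes F :: "real \<Rightarrow> real" and c :: real
  assumes monoF: "s \<le> t \<Longrightarrow> F s \<le> F t"
    and rcF: "(F \<longlongrightarrow> F t) (at_right t)"
    and botF: "(F \<longlongrightarrow> 0) at_bot" and topF: "(F \<longlongrightarrow> c) at_top"
begin

abbreviation "\<mu> \<equiv> interval_measure F"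

lemma measure_Ioc: "s \<le> t \<Longrightarrow> emeasure \<mu> {s<..t} = ennreal (F t - F s)"
  using rcF monoF by (intro emeasure_interval_measure_Ioc) (auto simp: continuous_within)

lemma emeasure_Iio:
  assumes "(F \<longlongrightarrow> l) (at_left a)"
  shows "emeasure \<mu> {..<a} = ennreal l"
proof -
  define \<delta> where "\<delta> n = inverse (real (Suc n))" for n
  have \<delta>: "0 < \<delta> n" "\<delta> n \<le> 1" "k \<le> n \<Longrightarrow> \<delta> n \<le> \<delta> k" for k n
    unfolding \<delta>_def by (simp, simp add: inverse_le_1_iff, intro le_imp_inverse_le) auto
  have \<delta>_lim: "\<delta> \<longlonglongrightarrow> 0" unfolding \<delta>_def by (rule LIMSEQ_inverse_real_of_nat)
  \<comment> \<open>The extra shift by 1 keeps the endpoints ordered already at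
    \<open>n = 0\<close>, where \<open>\<delta> n = 1\<close>.\<close>
  define I where "I n = {a - 1 - real n <.. a - \<delta> n}" for n
  have le: "a - 1 - real n \<le> a - \<delta> n" for n
    using \<delta>(2)[of n] by linarith
  have r: "range I \<subseteq> sets \<mu>" by (auto simp: I_def)
  have inc: "incseq I"
  proof (rule incseq_SucI)
    fix n
    have "\<delta> (Suc n) \<le> \<delta> n" by (rule \<delta>) simp
    then show "I n \<subseteq> I (Suc n)" by (auto simp: I_def)
  qed
  have "(\<Union>n. I n) = {..<a}"
  proof (intro equalityI subsetI)
    fix t assume "t \<in> (\<Union>n. I n)"
    then obtain n where "t \<le> a - \<delta> n" by (auto simp: I_def)
    moreover have "0 < \<delta> n" by (rule \<delta>)
    ultimately have "t < a" by linarith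
    then show "t \<in> {..<a}" by simp
  next
    fix t assume t: "t \<in> {..<a}"
    obtain n where n: "\<delta> n < a - t" using reals_Archimedean[of "a - t"] t by (auto simp: \<delta>_def)
    obtain m where m: "a - 1 - t < real m" using reals_Archimedean2 by blast
    have "\<delta> (max n m) \<le> \<delta> n" by (rule \<delta>) simp
    then have "t \<in> I (max n m)" using n m by (auto simp: I_def)
    then show "t \<in> (\<Union>n. I n)" by blast
  qed
  then have "(\<lambda>n. emeasure \<mu> (I n)) \<longlonglongrightarrow> emeasure \<mu> {..<a}"
    using Lim_emeasure_incseq[OF r inc] by simp
  moreover have "(\<lambda>n. emeasure \<mu> (I n)) \<longlonglongrightarrow> ennreal (l - 0)"
  proof -
    have "filterlim (\<lambda>n. a - \<delta> n) (at_left a) sequentially"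
      unfolding filterlim_at
    proof (intro conjI)
      show "(\<lambda>n. a - \<delta> n) \<longlonglongrightarrow> a"
        using tendsto_diff[OF tendsto_const \<delta>_lim, of a] by simp
    qed (use \<delta>(1) in \<open>auto simp: less_imp_neq[symmetric] intro!: always_eventually\<close>)
    from filterlim_compose[OF assms this] have 1: "(\<lambda>n. F (a - \<delta> n)) \<longlonglongrightarrow> l" .
    have "filterlim (\<lambda>n. (a - 1) + - real n) at_bot sequentially"
      by (subst filterlim_tendsto_add_at_bot_iff[OF tendsto_const])
        (simp add: filterlim_uminus_at_bot filterlim_real_sequentially)
    then have "filterlim (\<lambda>n. a - 1 - real n) at_bot sequentially" by simp
    from filterlim_compose[OF botF this] have 2: "(\<lambda>n. F (a - 1 - real n)) \<longlonglongrightarrow> 0" .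
    show ?thesis unfolding I_def measure_Ioc[OF le] by (intro tendsto_ennrealI tendsto_diff 1 2)
  qed
  ultimately show ?thesis using LIMSEQ_unique by fastforce
qed

lemma F_nonneg: "0 \<le> F t"
  by (rule tendsto_upperbound[OF botF]) (auto simp: eventually_at_bot_linorder intro: monoF)

lemma F_le: "F t \<le> c"
  by (rule tendsto_lowerbound[OF topF]) (auto simp: eventually_at_top_linorder intro: monoF)

lemma emeasure_UNIV: "emeasure \<mu> UNIV = ennreal c"
proof -
  define I where "I n = {- real n <.. real n}" for n
  have r: "range I \<subseteq> sets \<mu>" by (auto simp: I_def)
  have inc: "incseq I" by (auto simp: incseq_def I_def)
  have "(\<Union>n. I n) = UNIV"
  proof (intro equalityI subsetI)
    fix t :: real
    obtain n where "\<bar>t\<bar> < real n" using reals_Archimedean2 by blast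
    then have "t \<in> I n" by (auto simp: I_def)
    then show "t \<in> (\<Union>n. I n)" by blast
  qed simp
  then have "(\<lambda>n. emeasure \<mu> (I n)) \<longlonglongrightarrow> emeasure \<mu> UNIV"
    using Lim_emeasure_incseq[OF r inc] by simp
  moreover have "(\<lambda>n. emeasure \<mu> (I n)) \<longlonglongrightarrow> ennreal (c - 0)"
  proof -
    have 1: "(\<lambda>n. F (real n)) \<longlonglongrightarrow> c" by (rule filterlim_compose[OF topF filterlim_real_sequentially])
    have "filterlim (\<lambda>n. - real n) at_bot sequentially"
      by (simp add: filterlim_uminus_at_bot filterlim_real_sequentially)
    from filterlim_compose[OF botF this] have 2: "(\<lambda>n. F (- real n)) \<longlonglongrightarrow> 0" .
    show ?thesis unfolding I_def by (subst measure_Ioc, simp) (intro tendsto_ennrealI tendsto_diff 1 2)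
  qed
  ultimately show ?thesis using LIMSEQ_unique by fastforce
qed

sublocale finite_measure \<mu>
  by standard (simp add: emeasure_UNIV)

lemma measure_UNIV: "measure \<mu> UNIV = c"
  using F_nonneg[of 0] F_le[of 0] by (simp add: measure_def emeasure_UNIV)

lemma partial_integral:
  assumes int: "integrable \<mu> (\<lambda>t. t)"
  defines "\<Phi> \<equiv> \<lambda>t. LINT u:{..t}|\<mu>. u"
  shows "id_bounds F \<Phi>" "(\<Phi> \<longlongrightarrow> (\<integral>t. t \<partial>\<mu>)) at_top" "(\<Phi> \<longlongrightarrow> 0) at_bot"
proof -
  have si: "set_integrable \<mu> A (\<lambda>u. u)" if "A \<in> sets borel" for A :: "real set"
    unfolding set_integrable_def using that int integrable_mult_indicator[of A \<mu> "\<lambda>t. t"] by simp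
  show "id_bounds F \<Phi>"
    unfolding id_bounds_def
  proof (intro allI impI)
    fix s t :: real assume st: "s \<le> t"
    have U: "{..t} = {..s} \<union> {s<..t}" using st by auto
    have "\<Phi> t = \<Phi> s + (LINT u:{s<..t}|\<mu>. u)"
      unfolding \<Phi>_def U by (rule set_integral_Un) (auto intro!: si)
    then have d: "\<Phi> t - \<Phi> s = (LINT u:{s<..t}|\<mu>. u)" by simp
    have m: "measure \<mu> {s<..t} = F t - F s"
      using monoF[OF st] by (simp add: measure_def measure_Ioc[OF st])
    have c: "(LINT u:{s<..t}|\<mu>. r) = r * (F t - F s)" for r :: real
      by (subst set_integral_const) (auto simp: m emeasure_finite less_top)
    have ci: "set_integrable \<mu> {s<..t} (\<lambda>u. r)" for r :: real
      unfolding set_integrable_def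
      by (rule integrable_mult_indicator[OF _ integrable_const]) simp
    have "(LINT u:{s<..t}|\<mu>. s) \<le> (LINT u:{s<..t}|\<mu>. u)"
      by (rule set_integral_mono) (auto intro!: si ci)
    moreover have "(LINT u:{s<..t}|\<mu>. u) \<le> (LINT u:{s<..t}|\<mu>. t)"
      by (rule set_integral_mono) (auto intro!: si ci)
    ultimately show "s * (F t - F s) \<le> \<Phi> t - \<Phi> s \<and> \<Phi> t - \<Phi> s \<le> t * (F t - F s)"
      unfolding d c by simp
  qed
  show "(\<Phi> \<longlongrightarrow> (\<integral>t. t \<partial>\<mu>)) at_top"
    unfolding \<Phi>_def set_lebesgue_integral_def
    by (rule tendsto_integral_at_top) (use int in auto)
  show "(\<Phi> \<longlongrightarrow> 0) at_bot"
  proof (rule tendsto_at_botI_sequentially)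
    fix X :: "nat \<Rightarrow> real" assume X: "filterlim X at_bot sequentially"
    have "(\<lambda>n. \<integral>u. indicat_real {..X n} u *\<^sub>R u \<partial>\<mu>) \<longlonglongrightarrow> (\<integral>u. 0 \<partial>\<mu>)"
    proof (rule integral_dominated_convergence)
      show "integrable \<mu> (\<lambda>u. norm u)" using int by (rule integrable_norm)
      show "AE u in \<mu>. (\<lambda>n. indicat_real {..X n} u *\<^sub>R u) \<longlonglongrightarrow> 0"
      proof
        fix u
        have "eventually (\<lambda>n. X n < u) sequentially"
          using X by (simp add: filterlim_at_bot_dense)
        then show "(\<lambda>n. indicat_real {..X n} u *\<^sub>R u) \<longlonglongrightarrow> 0"
          by (intro tendsto_eventually, elim eventually_mono) (simp add: indicator_def)
      qed
      fix n show "AE u in \<mu>. norm (indicat_real {..X n} u *\<^sub>R u) \<le> norm u"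
        by (simp add: indicator_def)
    qed simp_all
    then show "(\<lambda>n. \<Phi> (X n)) \<longlonglongrightarrow> 0" by (simp add: \<Phi>_def set_lebesgue_integral_def)
  qed
qed

text \<open>Two primitives with the same step bounds differ by a constant. The behaviour at minus
  infinity makes it 0, and the limits at plus infinity are then equal.\<close>

lemma integral_eqI:
  assumes int: "integrable \<mu> (\<lambda>t. t)" and \<Psi>: "id_bounds F \<Psi>"
    and top: "(\<Psi> \<longlongrightarrow> L) at_top" and bot: "(\<Psi> \<longlongrightarrow> 0) at_bot"
  shows "(\<integral>t. t \<partial>\<mu>) = L"
proof -
  define \<Phi> where "\<Phi> = (\<lambda>t. LINT u:{..t}|\<mu>. u)"
  note \<Phi> = partial_integral[OF int, folded \<Phi>_def]
  define D where "D t = \<Phi> t - \<Psi> t" for t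
  have D: "\<bar>D t - D s\<bar> \<le> (t - s) * (F t - F s)" if "s \<le> t" for s t
  proof -
    have "s * (F t - F s) \<le> \<Phi> t - \<Phi> s" "\<Phi> t - \<Phi> s \<le> t * (F t - F s)"
      "s * (F t - F s) \<le> \<Psi> t - \<Psi> s" "\<Psi> t - \<Psi> s \<le> t * (F t - F s)"
      using \<Phi>(1) \<Psi> that by (simp_all add: id_bounds_def)
    then show ?thesis by (simp add: D_def left_diff_distrib abs_le_iff)
  qed
  have const: "D = (\<lambda>t. D 0)" by (rule ext) (rule constant_if_increments_small[OF D])
  have "(D \<longlongrightarrow> 0 - 0) at_bot" unfolding D_def by (intro tendsto_diff \<Phi>(3) bot)
  then have "D 0 = 0" by (subst (asm) const) (simp add: tendsto_const_iff)
  moreover have "(D \<longlongrightarrow> (\<integral>t. t \<partial>\<mu>) - L) at_top" unfolding D_def by (intro tendsto_diff \<Phi>(2) top)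
  then have "D 0 = (\<integral>t. t \<partial>\<mu>) - L" by (subst (asm) const) (simp add: tendsto_const_iff)
  ultimately show ?thesis by simp
qed

end

text \<open>The sum of the partial integrals for \<open>F1\<close> and \<open>F2\<close> obeys the
  step bounds for \<open>F\<close>, which gives additivity in the integrator without identifying the
  measures.\<close>

lemma stieltjes_integral_add:
  assumes F: "stieltjes F c" and F1: "stieltjes F1 c1" and F2: "stieltjes F2 c2"
    and eq: "\<And>t. F t = F1 t + F2 t"
    and int: "integrable (interval_measure F) (\<lambda>t. t)"
      "integrable (interval_measure F1) (\<lambda>t. t)" "integrable (interval_measure F2) (\<lambda>t. t)"
  shows "(\<integral>t. t \<partial>interval_measure F) = (\<integral>t. t \<partial>interval_measure F1) + (\<integral>t. t \<partial>interval_measure F2)"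
proof -
  note p1 = stieltjes.partial_integral[OF F1 int(2)] and p2 = stieltjes.partial_integral[OF F2 int(3)]
  let ?\<Phi> = "\<lambda>F t. LINT u:{..t}|interval_measure F. u"
  have 1: "id_bounds F (\<lambda>t. ?\<Phi> F1 t + ?\<Phi> F2 t)"
    unfolding id_bounds_def
  proof (intro allI impI)
    fix s t :: real assume "s \<le> t"
    with p1(1) p2(1) have "s * (F1 t - F1 s) \<le> ?\<Phi> F1 t - ?\<Phi> F1 s" "?\<Phi> F1 t - ?\<Phi> F1 s \<le> t * (F1 t - F1 s)"
      "s * (F2 t - F2 s) \<le> ?\<Phi> F2 t - ?\<Phi> F2 s" "?\<Phi> F2 t - ?\<Phi> F2 s \<le> t * (F2 t - F2 s)"
      by (simp_all add: id_bounds_def)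
    moreover have "s * (F t - F s) = s * (F1 t - F1 s) + s * (F2 t - F2 s)"
      "t * (F t - F s) = t * (F1 t - F1 s) + t * (F2 t - F2 s)"
      by (simp_all add: eq algebra_simps)
    ultimately show "s * (F t - F s) \<le> (?\<Phi> F1 t + ?\<Phi> F2 t) - (?\<Phi> F1 s + ?\<Phi> F2 s) \<and>
        (?\<Phi> F1 t + ?\<Phi> F2 t) - (?\<Phi> F1 s + ?\<Phi> F2 s) \<le> t * (F t - F s)"
      by linarith
  qed
  show ?thesis
    by (rule stieltjes.integral_eqI[OF F int(1) 1 tendsto_add[OF p1(2) p2(2)]])
      (use tendsto_add[OF p1(3) p2(3)] in simp)
qed

section \<open>Resolutions of the identity and the negative spectral projection\<close>

locale resolution = mono_proj_family E
  for E :: "real \<Rightarrow> 'a::{real_inner,complete_space} \<Rightarrow> 'a" +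
  assumes right_continuous: "((\<lambda>s. E s x) \<longlongrightarrow> E t x) (at_right t)"
    and at_bot: "((\<lambda>t. E t x) \<longlongrightarrow> 0) at_bot"
    and at_top: "((\<lambda>t. E t x) \<longlongrightarrow> x) at_top"
begin

lemma stieltjes: "stieltjes (\<lambda>t. E t x \<bullet> x) ((norm x)\<^sup>2)"
proof
  show "((\<lambda>t. E t x \<bullet> x) \<longlongrightarrow> 0) at_bot"
    using tendsto_inner[OF at_bot tendsto_const, of x x] by simp
  show "((\<lambda>t. E t x \<bullet> x) \<longlongrightarrow> (norm x)\<^sup>2) at_top"
    using tendsto_inner[OF at_top tendsto_const, of x x] by (simp add: power2_norm_eq_inner)
  show "((\<lambda>t. E t x \<bullet> x) \<longlongrightarrow> E t x \<bullet> x) (at_right t)" for t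
    by (rule tendsto_inner[OF right_continuous tendsto_const])
qed (rule mono)

abbreviation "M x \<equiv> interval_measure (\<lambda>t. E t x \<bullet> x)"

lemma finite_measure_M: "finite_measure (M x)"
  using stieltjes.emeasure_UNIV[OF stieltjes, of x] by (intro finite_measureI) simp

lemma emeasure_negative: "emeasure (M x) {..<0} = ennreal (left_lim 0 x \<bullet> x)"
  by (rule stieltjes.emeasure_Iio[OF stieltjes]) (rule tendsto_inner[OF tendsto_left_lim tendsto_const])

lemma measure_negative: "measure (M x) {..<0} = left_lim 0 x \<bullet> x"
  using sym_projD(5)[OF left_lim_proj, of 0 x] by (simp add: measure_def emeasure_negative)

text \<open>The cross terms vanish for every \<open>t\<close>: below 0 because
  \<open>E t y = 0\<close>, and from 0 on because \<open>E t x = x\<close> while \<open>x\<close>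
  and \<open>y\<close> are orthogonal.\<close>

lemma form_split:
  assumes x: "left_lim 0 x = x" and y: "left_lim 0 y = 0"
  shows "E t (x + y) \<bullet> (x + y) = E t x \<bullet> x + E t y \<bullet> y"
proof (cases "t < 0")
  case True
  have "E t y = 0" using left_lim_less[OF True, of y] by (simp add: y linear_0[OF lin])
  moreover have "E t x \<bullet> y = 0" using sym[of t x y] \<open>E t y = 0\<close> by simp
  ultimately show ?thesis by (simp add: linear_add[OF lin] inner_add_right)
next
  case False
  then have "E t x = x" using left_lim_ge[of 0 t x] by (simp add: x)
  moreover have "x \<bullet> y = 0" using sym_projD(4)[OF left_lim_proj, of 0 x y] by (simp add: x y)
  moreover have "E t y \<bullet> x = 0" using sym[of t y x] calculation by (simp add: inner_commute)
  ultimately show ?thesis by (simp add: linear_add[OF lin] inner_add_right inner_add_left)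
qed

context
  fixes X
  assumes X: "sym_op X"
    and int: "\<And>x. integrable (M x) (\<lambda>t. t)" and form: "\<And>x. X x \<bullet> x = (\<integral>t. t \<partial>M x)"
begin

text \<open>The whole mass of the measure of \<open>x\<close> already sits on the open negative
  half-line, so the integrand is negative almost everywhere; the mass is positive, which makes the
  inequality strict.\<close>

lemma left_lim_zero_neg:
  assumes "left_lim 0 x = x" "x \<noteq> 0"
  shows "X x \<bullet> x < 0"
proof -
  interpret finite_measure "M x" by (rule finite_measure_M)
  have U: "emeasure (M x) UNIV = ennreal ((norm x)\<^sup>2)" by (rule stieltjes.emeasure_UNIV[OF stieltjes])
  have "emeasure (M x) (space (M x) - {..<0}) = emeasure (M x) (space (M x)) - emeasure (M x) {..<0}"
    by (rule emeasure_compl) (auto simp: emeasure_negative)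
  also have "\<dots> = 0" by (simp add: U emeasure_negative assms(1) power2_norm_eq_inner)
  finally have "UNIV - {..<0} \<in> null_sets (M x)" by (auto simp: null_sets_def)
  then have "AE t in M x. t < 0" by (rule AE_I') auto
  then have "(\<integral>t. t \<partial>M x) < (\<integral>t. 0 \<partial>M x)"
    by (intro integral_less_AE_space int) (simp_all add: U assms(2))
  then show ?thesis by (simp add: form)
qed

lemma left_lim_zero_nonneg:
  assumes "left_lim 0 x = 0"
  shows "0 \<le> X x \<bullet> x"
proof -
  have "{..<0} \<in> null_sets (M x)" by (auto simp: null_sets_def emeasure_negative assms)
  then have "AE t in M x. 0 \<le> t" by (rule AE_I') auto
  then show ?thesis unfolding form by (rule integral_nonneg_AE)
qed

text \<open>Both spectral subspaces are orthogonal for the form of \<open>X\<close>, because the measures of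
  orthogonal components add up.\<close>
lemma left_lim_zero_commute: "X (left_lim 0 x) = left_lim 0 (X x)"
proof -
  let ?P = "left_lim 0"
  note P = sym_projD[OF left_lim_proj[of 0]]
  have lX: "linear X" using X by (simp add: sym_op_def bounded_linear.linear)
  have orth: "X x \<bullet> y = 0" if "?P x = x" "?P y = 0" for x y
  proof -
    have "X (x + y) \<bullet> (x + y) = X x \<bullet> x + X y \<bullet> y"
      unfolding form by (rule stieltjes_integral_add[OF stieltjes stieltjes stieltjes])
        (auto intro: int form_split that)
    moreover have "X y \<bullet> x = X x \<bullet> y" by (metis sym_opD[OF X] inner_commute)
    ultimately show ?thesis by (simp add: linear_add[OF lX] inner_add_left inner_add_right)
  qed
  have P0: "?P (z - ?P z) = 0" for z by (simp add: linear_diff[OF P(1)] P(3))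
  have PXP: "?P (X (?P z)) = X (?P z)" for z
  proof -
    let ?w = "X (?P z) - ?P (X (?P z))"
    have "X (?P z) \<bullet> ?w = 0" by (rule orth[OF P(3) P0])
    moreover have "?P (X (?P z)) \<bullet> ?w = 0" using P(4)[of "X (?P z)" ?w] P0 by simp
    ultimately have "?w \<bullet> ?w = 0" by (simp only: inner_diff_left)
    then show ?thesis by simp
  qed
  \<comment> \<open>Invariance of the range of the projection becomes commutation by taking
    adjoints, since both operators are symmetric.\<close>
  show ?thesis
  proof (subst vector_eq_ldot[symmetric], rule allI)
    fix z
    have "z \<bullet> X (?P x) = z \<bullet> ?P (X (?P x))" by (simp only: PXP)
    also have "\<dots> = ?P (X (?P z)) \<bullet> x"
      by (simp only: P(4)[symmetric] sym_opD[OF X, symmetric])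
    also have "\<dots> = z \<bullet> ?P (X x)" by (simp only: PXP P(4) sym_opD[OF X])
    finally show "z \<bullet> X (?P x) = z \<bullet> ?P (X x)" .
  qed
qed

end

end

section \<open>Spectral theorem for bounded symmetric operators\<close>

lemma spectral_theorem_real:
  fixes X :: "'a::{real_inner,complete_space} \<Rightarrow> 'a"
  assumes X: "sym_op X"
  obtains E where "resolution E" "\<And>t. E t \<in> bicommutant X"
    "\<And>x. integrable (interval_measure (\<lambda>t. E t x \<bullet> x)) (\<lambda>t. t)"
    "\<And>x. X x \<bullet> x = (\<integral>t. t \<partial>interval_measure (\<lambda>t. E t x \<bullet> x))"
proof -
  obtain E K where E: "mono_proj_family E" and bic: "\<And>t. E t \<in> bicommutant X"
    and le: "\<And>t x. E t x = x \<Longrightarrow> X x \<bullet> x \<le> t * (norm x)\<^sup>2"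
    and ge: "\<And>t x. E t x = 0 \<Longrightarrow> t * (norm x)\<^sup>2 \<le> X x \<bullet> x"
    and rc: "\<And>t x. ((\<lambda>s. E s x) \<longlongrightarrow> E t x) (at_right t)"
    and K: "0 < K" "\<And>t x. t < - K \<Longrightarrow> E t x = 0" "\<And>t x. K \<le> t \<Longrightarrow> E t x = x"
    using spectral_family_exists_real[OF X] by blast
  interpret mono_proj_family E by (rule E)
  have ev0: "\<forall>\<^sub>F t in at_bot. E t x = 0" for x
    unfolding eventually_at_bot_dense using K(2) by blast
  have ev1: "\<forall>\<^sub>F t in at_top. E t x = x" for x
    unfolding eventually_at_top_linorder using K(3) by blast
  have res: "resolution E"
  proof
    show "((\<lambda>t. E t x) \<longlongrightarrow> 0) at_bot" for x by (rule tendsto_eventually[OF ev0])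
    show "((\<lambda>t. E t x) \<longlongrightarrow> x) at_top" for x by (rule tendsto_eventually[OF ev1])
  qed (rule rc)
  interpret resolution E by (rule res)
  have blX: "bounded_linear X" and linX: "linear X"
    using X by (simp_all add: sym_op_def bounded_linear.linear)
  have XE: "X (E t x) = E t (X x)" for t x by (rule bicommutantD[OF bic blX]) simp
  have int: "integrable (M x) (\<lambda>t. t)" for x
  proof -
    interpret finite_measure "M x" by (rule finite_measure_M)
    have U: "emeasure (M x) UNIV = ennreal ((norm x)\<^sup>2)" by (rule stieltjes.emeasure_UNIV[OF stieltjes])
    \<comment> \<open>\<open>E\<close> is known to vanish only strictly below \<open>- K\<close>,
      hence the left endpoint \<open>-K-1\<close>.\<close>
    have I: "emeasure (M x) {-K-1<..K} = ennreal ((norm x)\<^sup>2)"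
      using K by (subst stieltjes.measure_Ioc[OF stieltjes]) (simp_all add: power2_norm_eq_inner)
    have "emeasure (M x) (space (M x) - {-K-1<..K}) = emeasure (M x) (space (M x)) - emeasure (M x) {-K-1<..K}"
      by (rule emeasure_compl) (auto simp: I)
    also have "\<dots> = 0" by (simp add: U I)
    finally have "UNIV - {-K-1<..K} \<in> null_sets (M x)" by (auto simp: null_sets_def)
    then have "AE t in M x. norm t \<le> K + 1" by (rule AE_I') (use K(1) in auto)
    then show ?thesis by (rule integrable_const_bound) simp
  qed
  have "(\<integral>t. t \<partial>M x) = X x \<bullet> x" for x
  proof (rule stieltjes.integral_eqI[OF stieltjes int])
    \<comment> \<open>The increment \<open>d\<close> lies in the range of \<open>E t\<close> and in
      the kernel of \<open>E s\<close>, so the form of \<open>X\<close> at \<open>d\<close> is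
      between \<open>s |d|^2\<close> and \<open>t |d|^2\<close>, and \<open>|d|^2\<close> is the
      increment of the integrator.\<close>
    show "id_bounds (\<lambda>t. E t x \<bullet> x) (\<lambda>t. X (E t x) \<bullet> x)"
      unfolding id_bounds_def
    proof (intro allI impI)
      fix s t :: real assume st: "s \<le> t"
      define d where "d = E t x - E s x"
      have "E t d = d" "E s d = 0"
        using st by (simp_all add: d_def linear_diff[OF lin] idem absorb_left absorb_right)
      then have "s * (norm d)\<^sup>2 \<le> X d \<bullet> d" "X d \<bullet> d \<le> t * (norm d)\<^sup>2" using le ge by blast+
      moreover have "(norm d)\<^sup>2 = E t x \<bullet> x - E s x \<bullet> x" unfolding d_def by (rule norm_diff[OF st])
      moreover have "X d \<bullet> d = X (E t x) \<bullet> x - X (E s x) \<bullet> x"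
      proof -
        have "X d \<bullet> d = E t (X d) \<bullet> x - E s (X d) \<bullet> x"
          unfolding d_def by (simp only: inner_diff_right sym)
        also have "\<dots> = X d \<bullet> x"
          by (simp add: XE[symmetric] \<open>E t d = d\<close> \<open>E s d = 0\<close> linear_0[OF linX])
        finally show ?thesis by (simp add: d_def linear_diff[OF linX] inner_diff_left)
      qed
      ultimately show "s * (E t x \<bullet> x - E s x \<bullet> x) \<le> X (E t x) \<bullet> x - X (E s x) \<bullet> x \<and>
          X (E t x) \<bullet> x - X (E s x) \<bullet> x \<le> t * (E t x \<bullet> x - E s x \<bullet> x)" by simp
    qed
    show "((\<lambda>t. X (E t x) \<bullet> x) \<longlongrightarrow> X x \<bullet> x) at_top"
      by (intro tendsto_inner bounded_linear.tendsto[OF blX] at_top tendsto_const)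
    show "((\<lambda>t. X (E t x) \<bullet> x) \<longlongrightarrow> 0) at_bot"
      using tendsto_inner[OF bounded_linear.tendsto[OF blX at_bot] tendsto_const, of x x]
      by (simp add: linear_0[OF linX])
  qed
  with res bic int that show ?thesis by (metis (no_types))
qed

section \<open>Complex Hilbert spaces\<close>

lemma cinner_add_right: "cinner x (y + z) = cinner x y + cinner x z"
  by (subst (1 2 3) cinner_commute) (simp add: cinner_add_left)

lemma cinner_scaleC_right: "cinner x (c *\<^sub>C y) = cnj c * cinner x y"
  by (subst (1 2) cinner_commute) (simp add: cinner_scaleC_left)

lemma cinner_diff_left: "cinner (x - y) z = cinner x z - cinner y z"
  using cinner_add_left[of "x - y" y z] by simp

text \<open>Lets an identity between complex inner products be checked on real parts alone, once at
  \<open>y\<close> and once at \<open>\<i> *\<^sub>C y\<close>.\<close>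

lemma Im_cinner: "Im (cinner x y) = x \<bullet> (\<i> *\<^sub>C (y::'a::complex_inner))"
  by (simp add: inner_eq_Re_cinner cinner_scaleC_right)

lemma inner_scaleC_right: "x \<bullet> (c *\<^sub>C (y::'a::complex_inner)) = (cnj c *\<^sub>C x) \<bullet> y"
  by (simp add: inner_eq_Re_cinner cinner_scaleC_right cinner_scaleC_left)

lemma norm_scaleC: "norm (c *\<^sub>C x) = cmod c * norm (x::'a::complex_inner)"
proof -
  have "(norm (c *\<^sub>C x))\<^sup>2 = ((cnj c * c) *\<^sub>C x) \<bullet> x"
    by (simp only: power2_norm_eq_inner inner_scaleC_right scaleC_scaleC)
  also have "cnj c * c = complex_of_real ((cmod c)\<^sup>2)"
    by (simp only: complex_norm_square mult.commute)
  also have "\<dots> *\<^sub>C x \<bullet> x = (cmod c * norm x)\<^sup>2"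
    by (simp only: scaleR_scaleC[symmetric] inner_scaleR_left power2_norm_eq_inner[symmetric] power_mult_distrib)
  finally show ?thesis by (simp add: power2_eq_iff_nonneg)
qed

lemma bounded_linear_scaleC: "bounded_linear (\<lambda>x::'a::complex_inner. c *\<^sub>C x)"
  by (rule bounded_linear_intro[of _ "cmod c"])
    (simp_all add: scaleC_add_right scaleR_scaleC scaleC_scaleC norm_scaleC mult.commute)

lemma bounded_clinearD:
  assumes "bounded_clinear T"
  shows "bounded_linear T" "linear T" "T (c *\<^sub>C x) = c *\<^sub>C T x"
  using assms by (auto simp: bounded_clinear_def bounded_linear.linear)

lemma bounded_clinear_bicommutant:
  assumes "bounded_clinear X" "R \<in> bicommutant X" "bounded_linear R"
  shows "bounded_clinear R"
  unfolding bounded_clinear_def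
  using assms(3) bicommutantD[OF assms(2) bounded_linear_scaleC] bounded_clinearD(3)[OF assms(1)]
  by metis

lemma cinner_adjointI:
  assumes T: "\<And>x y. T x \<bullet> y = x \<bullet> T' y" and clin: "\<And>c y. T' (c *\<^sub>C y) = c *\<^sub>C T' y"
  shows "cinner (T x) y = cinner x (T' y)"
proof (rule complex_eqI)
  show "Re (cinner (T x) y) = Re (cinner x (T' y))" using T by (simp add: inner_eq_Re_cinner)
  show "Im (cinner (T x) y) = Im (cinner x (T' y))" by (simp add: Im_cinner T clin)
qed

lemma cadjoint_eqI:
  assumes "\<And>x y. T x \<bullet> y = x \<bullet> T' y" "\<And>c y. T' (c *\<^sub>C y) = c *\<^sub>C T' y"
  shows "cadjoint T = T'"
  unfolding cadjoint_def
proof (rule the_equality)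
  show "\<forall>x y. cinner (T x) y = cinner x (T' y)" using cinner_adjointI[OF assms] by blast
  fix T'' assume "\<forall>x y. cinner (T x) y = cinner x (T'' y)"
  then have "x \<bullet> T'' y = x \<bullet> T' y" for x y
    using assms(1)[of x y] by (simp add: inner_eq_Re_cinner)
  then show "T'' = T'" by (metis ext vector_eq_ldot)
qed

lemma cadjoint:
  fixes T :: "'a::chilbert_space \<Rightarrow> 'b::chilbert_space"
  assumes T: "bounded_clinear T"
  shows "bounded_clinear (cadjoint T)" "T x \<bullet> y = x \<bullet> cadjoint T y"
proof -
  obtain T' where T': "bounded_linear T'" "\<And>x y. T x \<bullet> y = x \<bullet> T' y"
    using adjoint_exists[OF bounded_clinearD(1)[OF T]] by metis
  have clin: "T' (c *\<^sub>C y) = c *\<^sub>C T' y" for c y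
  proof (subst vector_eq_ldot[symmetric], rule allI)
    fix x
    have "x \<bullet> T' (c *\<^sub>C y) = T (cnj c *\<^sub>C x) \<bullet> y"
      by (simp add: T'(2)[symmetric] inner_scaleC_right bounded_clinearD(3)[OF T])
    then show "x \<bullet> T' (c *\<^sub>C y) = x \<bullet> (c *\<^sub>C T' y)" by (simp add: T'(2) inner_scaleC_right)
  qed
  have eq: "cadjoint T = T'" by (rule cadjoint_eqI[OF T'(2) clin])
  show "bounded_clinear (cadjoint T)" using T'(1) clin by (simp add: eq bounded_clinear_def)
  show "T x \<bullet> y = x \<bullet> cadjoint T y" by (simp add: eq T'(2))
qed

lemma selfadjoint_iff: "selfadjoint T \<longleftrightarrow> bounded_clinear T \<and> sym_op T"
proof
  assume "selfadjoint T"
  then have T: "bounded_clinear T" "T = cadjoint T" by (auto simp: selfadjoint_def)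
  then show "bounded_clinear T \<and> sym_op T"
    using cadjoint(2)[OF T(1)] by (simp add: sym_op_def bounded_clinearD(1))
next
  assume T: "bounded_clinear T \<and> sym_op T"
  then have "cadjoint T = T" by (intro cadjoint_eqI) (auto simp: sym_opD bounded_clinearD(3))
  with T show "selfadjoint T" by (simp add: selfadjoint_def)
qed

lemma op_le_iff: "op_le S T \<longleftrightarrow> (\<forall>x. S x \<bullet> x \<le> T x \<bullet> x)"
  by (simp add: op_le_def inner_eq_Re_cinner)

lemma nonneg_op_iff: "nonneg_op T \<longleftrightarrow> bounded_clinear T \<and> pos_op T"
  by (auto simp: nonneg_op_def pos_op_def selfadjoint_iff op_le_iff)

lemma orth_projection_iff: "orth_projection P \<longleftrightarrow> bounded_clinear P \<and> sym_proj P"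
  by (auto simp: orth_projection_def sym_proj_def selfadjoint_iff fun_eq_iff)

lemma op_sqrt_eqI:
  assumes "nonneg_op R" "\<And>x. R (R x) = T x"
  shows "op_sqrt T = R"
  unfolding op_sqrt_def
proof (rule the_equality)
  show "nonneg_op R \<and> R \<circ> R = T" using assms by auto
  fix Q assume "nonneg_op Q \<and> Q \<circ> Q = T"
  then show "Q = R"
    using assms by (intro pos_op_sqrt_unique) (auto simp: nonneg_op_iff fun_eq_iff)
qed

lemma op_sqrt:
  assumes T: "nonneg_op T"
  shows "nonneg_op (op_sqrt T)" "op_sqrt T (op_sqrt T x) = T x" "op_sqrt T \<in> bicommutant T"
proof -
  obtain R where R: "pos_op R" "\<And>x. R (R x) = T x" "R \<in> bicommutant T"
    using pos_op_sqrt_exists T unfolding nonneg_op_iff by metis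
  have "bounded_clinear R"
    by (rule bounded_clinear_bicommutant[OF _ R(3)]) (use T R(1) in \<open>auto simp: nonneg_op_iff pos_op_def sym_op_def\<close>)
  with R(1) have n: "nonneg_op R" by (simp add: nonneg_op_iff)
  have "op_sqrt T = R" by (rule op_sqrt_eqI[OF n R(2)])
  with n R show "nonneg_op (op_sqrt T)" "op_sqrt T (op_sqrt T x) = T x" "op_sqrt T \<in> bicommutant T"
    by simp_all
qed

lemma selfadjoint_cinner_self:
  assumes "selfadjoint T"
  shows "cinner (T x) x = complex_of_real (T x \<bullet> x)"
proof (rule complex_eqI)
  show "Re (cinner (T x) x) = Re (complex_of_real (T x \<bullet> x))" by (simp add: inner_eq_Re_cinner)
  have T: "bounded_clinear T" "sym_op T" using assms by (auto simp: selfadjoint_iff)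
  have "cinner (T x) x = cinner x (T x)"
    by (rule cinner_adjointI) (auto simp: sym_opD[OF T(2)] bounded_clinearD(3)[OF T(1)])
  also have "\<dots> = cnj (cinner (T x) x)" by (rule cinner_commute)
  finally show "Im (cinner (T x) x) = Im (complex_of_real (T x \<bullet> x))" by (simp add: complex_eq_iff)
qed

text \<open>Complex polarization: replacing \<open>x\<close> by \<open>\<i> *\<^sub>C x\<close>
  flips the relative sign of the two mixed terms, so each vanishes. This makes the definite
  description in \<open>spectral_integral\<close> unique.\<close>

lemma cinner_form_determines:
  assumes S: "bounded_clinear S" and T: "bounded_clinear T"
    and eq: "\<And>x. cinner (S x) x = cinner (T x) x"
  shows "S = T"
proof
  fix x
  define D where "D x = S x - T x" for x
  have add: "D (x + y) = D x + D y" and sc: "D (c *\<^sub>C x) = c *\<^sub>C D x" for x y c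
    using S T by (simp_all add: D_def linear_add[OF bounded_clinearD(2)] bounded_clinearD(3)
        complex_vector.scale_right_diff_distrib)
  have D0: "cinner (D x) x = 0" for x by (simp add: D_def cinner_diff_left eq)
  have pol: "cinner (D x) y + cinner (D y) x = 0" for x y
    using D0[of "x + y"] by (simp add: add cinner_add_left cinner_add_right D0 add.commute)
  have "cinner (D x) y = 0" for y
    using pol[of x y] pol[of "\<i> *\<^sub>C x" y]
    by (simp add: sc cinner_scaleC_left cinner_scaleC_right flip: right_diff_distrib)
  then have "D x \<bullet> D x = 0" by (simp add: inner_eq_Re_cinner)
  then show "S x = T x" by (simp add: D_def)
qed

section \<open>Spectral integrals and the spectral theorem in complex Hilbert spaces\<close>

lemma spectral_integral_eqI:
  assumes "has_spectral_integral E f T"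
  shows "spectral_integral E f = T"
  unfolding spectral_integral_def
proof (rule the_equality)
  show "has_spectral_integral E f T" by (rule assms)
  fix S assume "has_spectral_integral E f S"
  with assms show "S = T"
    by (intro cinner_form_determines) (auto simp: has_spectral_integral_def)
qed

lemma spectral_measure_eq: "spectral_measure E x = interval_measure (\<lambda>t. E t x \<bullet> x)"
  by (simp add: spectral_measure_def inner_eq_Re_cinner)

lemma resolution_of_identity_iff:
  "resolution_of_identity E \<longleftrightarrow> resolution E \<and> (\<forall>t. bounded_clinear (E t))"
  by (auto simp: resolution_of_identity_def resolution_def mono_proj_family_def resolution_axioms_def
      orth_projection_iff op_le_iff)

theorem spectral_theorem:
  assumes "selfadjoint X"
  shows "resolution_of_identity (spectral_family X) \<and> has_spectral_integral (spectral_family X) (\<lambda>t. t) X"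
proof -
  have X: "bounded_clinear X" "sym_op X" using assms by (auto simp: selfadjoint_iff)
  obtain E where E: "resolution E" "\<And>t. E t \<in> bicommutant X"
    "\<And>x. integrable (interval_measure (\<lambda>t. E t x \<bullet> x)) (\<lambda>t. t)"
    "\<And>x. X x \<bullet> x = (\<integral>t. t \<partial>interval_measure (\<lambda>t. E t x \<bullet> x))"
    using spectral_theorem_real[OF X(2)] by blast
  interpret resolution E by (rule E)
  have "bounded_clinear (E t)" for t by (rule bounded_clinear_bicommutant[OF X(1) E(2) bl])
  with E have "resolution_of_identity E \<and> has_spectral_integral E (\<lambda>t. t) X"
    by (simp add: resolution_of_identity_iff has_spectral_integral_def X spectral_measure_eq
        selfadjoint_cinner_self[OF assms])
  then show ?thesis unfolding spectral_family_def
    by (rule someI[where P = "\<lambda>E. resolution_of_identity E \<and> has_spectral_integral E (\<lambda>t. t) X"])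
qed

text \<open>The interface to the spectral calculus: \<open>nu_minus\<close> and
  \<open>op_sign\<close> are accessed only through this \<open>P\<close>. The sign function is 1
  minus twice the indicator of the open negative half-line, so the kernel counts as
  positive.\<close>

lemma negative_projection:
  assumes "selfadjoint X"
  obtains P where "bounded_clinear P" "sym_proj P" "\<And>x. X (P x) = P (X x)"
    "\<And>x. P x = x \<Longrightarrow> x \<noteq> 0 \<Longrightarrow> X x \<bullet> x < 0" "\<And>x. P x = 0 \<Longrightarrow> 0 \<le> X x \<bullet> x"
    "spectral_subspace X {..<0} = range P" "op_sign X = (\<lambda>x. x - 2 *\<^sub>R P x)"
proof -
  have X: "bounded_clinear X" "sym_op X" using assms by (auto simp: selfadjoint_iff)
  define E where "E = spectral_family X"
  have E: "resolution E" "\<And>t. bounded_clinear (E t)" and hs: "has_spectral_integral E (\<lambda>t. t) X"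
    using spectral_theorem[OF assms] by (auto simp: E_def resolution_of_identity_iff)
  interpret resolution E by (rule E)
  have int: "integrable (M x) (\<lambda>t. t)" and form: "X x \<bullet> x = (\<integral>t. t \<partial>M x)" for x
    using hs by (auto simp: has_spectral_integral_def spectral_measure_eq inner_eq_Re_cinner)
  let ?P = "left_lim 0"
  have cl: "bounded_clinear ?P"
  proof -
    have "?P (c *\<^sub>C x) = c *\<^sub>C ?P x" for c x
    proof (rule left_lim_eqI)
      show "((\<lambda>s. E s (c *\<^sub>C x)) \<longlongrightarrow> c *\<^sub>C ?P x) (at_left 0)"
        unfolding bounded_clinearD(3)[OF E(2)]
        by (rule bounded_linear.tendsto[OF bounded_linear_scaleC tendsto_left_lim])
    qed
    then show ?thesis using sym_projD(2)[OF left_lim_proj] by (simp add: bounded_clinear_def)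
  qed
  have saP: "selfadjoint ?P" using cl left_lim_proj by (simp add: selfadjoint_iff sym_proj_def)
  have ind: "integrable (M x) (indicat_real {..<0})" for x
    using stieltjes.emeasure_UNIV[OF stieltjes, of x]
    by (intro integrable_real_indicator) (auto simp: emeasure_negative)
  have "has_spectral_integral E (indicator {..<0}) ?P"
    using ind measure_negative
    by (simp add: has_spectral_integral_def cl spectral_measure_eq selfadjoint_cinner_self[OF saP])
  then have sub: "spectral_subspace X {..<0} = range ?P"
    by (simp add: spectral_subspace_def E_def spectral_integral_eqI)
  let ?J = "\<lambda>x. x - 2 *\<^sub>R ?P x"
  have clJ: "bounded_clinear ?J"
    unfolding bounded_clinear_def
    using bounded_clinearD(1,3)[OF cl]
    by (auto simp: complex_vector.scale_right_diff_distrib scaleR_scaleC scaleC_scaleC mult.commute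
        intro!: bounded_linear_sub bounded_linear_scaleC[THEN bounded_linear_compose])
  have saJ: "selfadjoint ?J"
    using saP clJ by (auto simp: selfadjoint_iff intro!: sym_op_diff sym_op_ident sym_op_scaleR)
  have sgn: "(\<lambda>t::real. if t \<ge> 0 then 1 else -1 :: real) = (\<lambda>t. 1 - 2 * indicator {..<0} t)"
    by (auto simp: indicator_def)
  have "has_spectral_integral E (\<lambda>t. if t \<ge> 0 then 1 else -1) ?J"
    unfolding has_spectral_integral_def spectral_measure_eq sgn
  proof (intro conjI allI clJ)
    fix x
    interpret finite_measure "M x" by (rule finite_measure_M)
    show "integrable (M x) (\<lambda>t. 1 - 2 * indicat_real {..<0} t)" using ind by simp
    have "(\<integral>t. 1 - 2 * indicator {..<0} t \<partial>M x) = (norm x)\<^sup>2 - 2 * (?P x \<bullet> x)"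
      using ind[of x] stieltjes.measure_UNIV[OF stieltjes, of x] by (simp add: measure_negative)
    then show "cinner (?J x) x = complex_of_real (\<integral>t. 1 - 2 * indicator {..<0} t \<partial>M x)"
      unfolding selfadjoint_cinner_self[OF saJ] by (simp add: inner_diff_left power2_norm_eq_inner)
  qed
  then have "op_sign X = ?J" by (simp add: op_sign_def E_def spectral_integral_eqI)
  then show ?thesis
    using that[OF cl left_lim_proj _ _ _ sub] left_lim_zero_commute[OF X(2) int form]
      left_lim_zero_neg[OF X(2) int form] left_lim_zero_nonneg[OF X(2) int form] by blast
qed

section \<open>Dimensions\<close>

lemma edim_enat:
  assumes "edim V = enat n"
  obtains B where "finite B" "card B = n" "B \<subseteq> V" "V \<subseteq> cspan B" "\<not> complex_vector.dependent B"
proof -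
  obtain C where C: "finite C" "V \<subseteq> cspan C" and n: "cdim V = n"
    using assms by (auto simp: edim_def split: if_splits)
  obtain B where B: "B \<subseteq> V" "\<not> complex_vector.dependent B" "V \<subseteq> cspan B" "card B = cdim V"
    by (rule complex_vector.basis_exists)
  have "finite B" using complex_vector.independent_span_bound[OF C(1) B(2)] B(1) C(2) by blast
  with B n that show ?thesis by blast
qed

text \<open>\<open>L\<close> sends a basis of \<open>V\<close> to independent vectors in the span of
  \<open>n\<close> vectors, which also forces \<open>V\<close> to be finite-dimensional. If the
  dimensions agree and the image missed a vector of \<open>W\<close>, adding it would give
  \<open>n + 1\<close> independent vectors there.\<close>

lemma
  fixes L :: "'a::complex_vector \<Rightarrow> 'b::complex_vector"
  assumes add: "\<And>x y. L (x + y) = L x + L y" and scale: "\<And>c x. L (c *\<^sub>C x) = c *\<^sub>C L x"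
    and V: "complex_vector.subspace V" and inj: "\<And>x. x \<in> V \<Longrightarrow> L x = 0 \<Longrightarrow> x = 0"
    and LW: "L ` V \<subseteq> W" and W: "edim W = enat n"
  shows edim_le_if_injective: "edim V \<le> enat n"
    and image_eq_if_edim_eq: "edim V = enat n \<Longrightarrow> L ` V = W"
proof -
  interpret module_hom scaleC scaleC L
    by (intro module_hom.intro complex_vector.module_axioms module_hom_axioms.intro add scale)
  have injV: "inj_on L V"
  proof (rule inj_onI)
    fix x y assume "x \<in> V" "y \<in> V" "L x = L y"
    then have "x - y \<in> V" "L (x - y) = 0"
      using complex_vector.subspace_diff[OF V] by (auto simp: diff)
    then show "x = y" using inj by fastforce
  qed
  obtain C where C: "finite C" "card C = n" "W \<subseteq> cspan C"
    using edim_enat[OF W] by metis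
  obtain B where B: "B \<subseteq> V" "\<not> complex_vector.dependent B" "V \<subseteq> cspan B" "card B = cdim V"
    by (rule complex_vector.basis_exists)
  have spB: "cspan B = V" using complex_vector.span_minimal[OF B(1) V] B(3) by blast
  have indL: "\<not> complex_vector.dependent (L ` B)"
    by (rule independent_injective_image) (use B(2) injV spB in \<open>simp_all add: cspan_def\<close>)
  have LB: "L ` B \<subseteq> cspan C" using B(1) LW C(3) by blast
  have fin: "finite (L ` B)" and le: "card (L ` B) \<le> n"
    using complex_vector.independent_span_bound[OF C(1) indL LB] C(2) by auto
  have injB: "inj_on L B" using injV B(1) by (rule inj_on_subset)
  have finB: "finite B" using fin injB by (rule finite_imageD)
  have dimV: "edim V = enat (card B)" using finB B(3,4) by (auto simp: edim_def)
  show "edim V \<le> enat n" using le by (simp add: dimV card_image[OF injB])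
  show "L ` V = W" if "edim V = enat n"
  proof (rule equalityI[OF LW], rule subsetI, rule ccontr)
    fix w assume w: "w \<in> W" "w \<notin> L ` V"
    have "w \<notin> cspan (L ` B)"
    proof
      assume "w \<in> cspan (L ` B)"
      also have "cspan (L ` B) = L ` cspan B" using span_image[of B] by (simp add: cspan_def)
      finally show False using w(2) spB by simp
    qed
    then have "\<not> complex_vector.dependent (insert w (L ` B))"
      using indL by (rule complex_vector.independent_insertI)
    moreover have "insert w (L ` B) \<subseteq> cspan C" using LB w(1) C(3) by blast
    ultimately have "card (insert w (L ` B)) \<le> n"
      using complex_vector.independent_span_bound[OF C(1)] C(2) by blast
    moreover have "w \<notin> L ` B" using w(2) B(1) by blast
    ultimately show False
      using that fin by (simp add: dimV card_image[OF injB])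
  qed
qed

section \<open>Boundedness\<close>

text \<open>Baire category: the preimages of the balls are closed, since they are cut out by the
  continuous functionals \<open>\<lambda>y. S y \<bullet> v\<close> with \<open>v\<close> in the dense set.\<close>
lemma bounded_linear_if_weakly_continuous:
  fixes S :: "'b::{real_normed_vector,complete_space} \<Rightarrow> 'a::real_inner"
  assumes lin: "linear S" and dense: "closure D = UNIV"
    and cont: "\<And>v. v \<in> D \<Longrightarrow> continuous_on UNIV (\<lambda>y. S y \<bullet> v)"
  shows "bounded_linear S"
proof -
  define K where "K n = {y. norm (S y) \<le> real n}" for n
  have K: "K n = (\<Inter>v\<in>D. {y. \<bar>S y \<bullet> v\<bar> \<le> real n * norm v})" for n
  proof (intro equalityI subsetI INT_I)
    fix y v assume y: "y \<in> K n"
    have "\<bar>S y \<bullet> v\<bar> \<le> norm (S y) * norm v" by (rule Cauchy_Schwarz_ineq2)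
    also have "\<dots> \<le> real n * norm v" using y by (intro mult_right_mono) (auto simp: K_def)
    finally show "y \<in> {y. \<bar>S y \<bullet> v\<bar> \<le> real n * norm v}" by simp
  next
    fix y assume y: "y \<in> (\<Inter>v\<in>D. {y. \<bar>S y \<bullet> v\<bar> \<le> real n * norm v})"
    have "closed {v. \<bar>S y \<bullet> v\<bar> \<le> real n * norm v}" by (intro closed_Collect_le continuous_intros)
    then have "closure D \<subseteq> {v. \<bar>S y \<bullet> v\<bar> \<le> real n * norm v}"
      using y by (intro closure_minimal) auto
    then have "\<bar>S y \<bullet> S y\<bar> \<le> real n * norm (S y)" using dense by blast
    then have "norm (S y) * norm (S y) \<le> real n * norm (S y)"
      by (simp add: power2_norm_eq_inner[symmetric] power2_eq_square)
    then show "y \<in> K n" by (cases "S y = 0") (auto simp: K_def)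
  qed
  have closed: "closed (K n)" for n
    unfolding K by (intro closed_INT ballI closed_Collect_le continuous_intros cont)
  have "(\<Union>n. K n) = UNIV"
    using real_arch_simple by (auto simp: K_def)
  moreover have "interior (\<Union>(range K)) = {}" if "\<And>n. interior (K n) = {}"
  proof -
    have "complete (UNIV :: 'b set)"
      by (meson Cauchy_convergent UNIV_I complete_def convergent_def)
    then show ?thesis
      using Met_TC.metric_Baire_category_alt[of "range K"] closed that by auto
  qed
  ultimately have "\<exists>n. interior (K n) \<noteq> {}" by auto
  then obtain n y where "y \<in> interior (K n)" by blast
  then obtain r where r: "0 < r" "ball y r \<subseteq> K n" by (auto simp: mem_interior)
  have small: "norm (S h) \<le> 2 * real n" if "norm h < r" for h
  proof -
    have "y + h \<in> K n" "y \<in> K n" using that r by (auto simp: dist_norm intro!: subsetD[OF r(2)])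
    moreover have "S h = S (y + h) - S y" by (simp add: linear_add[OF lin])
    ultimately show ?thesis using norm_triangle_ineq4[of "S (y + h)" "S y"] by (simp add: K_def)
  qed
  show ?thesis
  proof (rule bounded_linear_intro[of _ "4 * real n / r"])
    fix h
    show "norm (S h) \<le> norm h * (4 * real n / r)"
    proof (cases "h = 0")
      case False
      \<comment> \<open>Scales \<open>h\<close> to norm \<open>r / 2\<close>, inside the ball where
        \<open>S\<close> is bounded by \<open>2 * real n\<close>; this produces the constant
        \<open>4 * real n / r\<close>.\<close>
      define t where "t = r / (2 * norm h)"
      have t: "0 < t" using False r(1) by (simp add: t_def)
      have "norm (t *\<^sub>R h) < r" using False r(1) by (simp add: t_def)
      from small[OF this] have "t * norm (S h) \<le> 2 * real n" using t by (simp add: linear_scale[OF lin])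
      then show ?thesis using False r(1) by (simp add: t_def field_simps)
    qed (simp add: linear_0[OF lin])
  qed (simp_all add: linear_add[OF lin] linear_scale[OF lin])
qed

text \<open>The bound makes \<open>R x \<mapsto> f \<bullet> x\<close> a well-defined bounded
  functional on the range of \<open>R\<close>; if \<open>u\<close> represents it, symmetry of
  \<open>R\<close> gives \<open>f = R u\<close>.\<close>

lemma range_if_dominated:
  fixes R :: "'a::{real_inner,complete_space} \<Rightarrow> 'a"
  assumes R: "sym_op R" and f: "\<And>x. \<bar>f \<bullet> x\<bar> \<le> C * norm (R x)"
  shows "f \<in> range R"
proof -
  have "linear R" using R by (simp add: sym_op_def bounded_linear.linear)
  from riesz_subspace[OF subspace_UNIV this bounded_linear.linear[OF bounded_linear_inner_right] f]
  obtain u where "f \<bullet> h = u \<bullet> R h" for h by auto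
  then have "f \<bullet> h = R u \<bullet> h" for h by (simp add: sym_opD[OF R])
  then have "f = R u" by (metis vector_eq_rdot)
  then show ?thesis by simp
qed

section \<open>Bounded complex linear operators and block operators\<close>

lemma bounded_clinear_compose: "bounded_clinear S \<Longrightarrow> bounded_clinear T \<Longrightarrow> bounded_clinear (\<lambda>x. S (T x))"
  by (auto simp: bounded_clinear_def intro: bounded_linear_compose)

lemma bounded_clinear_diff: "bounded_clinear S \<Longrightarrow> bounded_clinear T \<Longrightarrow> bounded_clinear (\<lambda>x. S x - T x)"
  by (auto simp: bounded_clinear_def complex_vector.scale_right_diff_distrib intro: bounded_linear_sub)

lemma bounded_clinear_ident: "bounded_clinear (\<lambda>x. x)"
  by (simp add: bounded_clinear_def)

lemma bounded_clinear_scaleR: "bounded_clinear T \<Longrightarrow> bounded_clinear (\<lambda>x. r *\<^sub>R T x)"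
  by (auto simp: bounded_clinear_def scaleR_scaleC scaleC_scaleC mult.commute
      intro: bounded_linear_compose[OF bounded_linear_scaleC])

lemma subspace_range:
  assumes "bounded_clinear T"
  shows "complex_vector.subspace (range T)"
  unfolding complex_vector.subspace_def
  using linear_0[OF bounded_clinearD(2)[OF assms]] linear_add[OF bounded_clinearD(2)[OF assms]]
    bounded_clinearD(3)[OF assms]
  by (metis (no_types, lifting) rangeE rangeI)

lemma bounded_clinear_block_op:
  assumes "bounded_clinear A11" "bounded_clinear A12" "bounded_clinear A21" "bounded_clinear A22"
  shows "bounded_clinear (block_op A11 A12 A21 A22)"
proof -
  have "bounded_linear (\<lambda>p. (A11 (fst p) + A12 (snd p), A21 (fst p) + A22 (snd p)))"
    by (intro bounded_linear_Pair bounded_linear_add bounded_linear_compose[OF _ bounded_linear_fst]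
        bounded_linear_compose[OF _ bounded_linear_snd] bounded_clinearD(1) assms)
  then show ?thesis
    by (simp add: bounded_clinear_def block_op_def case_prod_beta' scaleC_prod_def
        bounded_clinearD(3)[OF assms(1)] bounded_clinearD(3)[OF assms(2)] bounded_clinearD(3)[OF assms(3)]
        bounded_clinearD(3)[OF assms(4)] scaleC_add_right)
qed

lemma selfadjoint_block_op:
  assumes A11: "selfadjoint A11" and A12: "bounded_clinear A12" and A21: "A21 = cadjoint A12"
    and A22: "selfadjoint A22"
  shows "selfadjoint (block_op A11 A12 A21 A22)"
proof -
  have s: "bounded_clinear A11" "sym_op A11" "bounded_clinear A22" "sym_op A22"
    using A11 A22 by (auto simp: selfadjoint_iff)
  have 21: "bounded_clinear A21" "A12 y \<bullet> x = y \<bullet> A21 x" for x y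
    using cadjoint[OF A12] by (simp_all add: A21)
  have cl: "bounded_clinear (block_op A11 A12 A21 A22)" by (intro bounded_clinear_block_op s A12 21(1))
  have 12: "A21 x \<bullet> y = x \<bullet> A12 y" for x y
    using 21(2)[of y x] by (simp add: inner_commute)
  have "block_op A11 A12 A21 A22 (a, b) \<bullet> (c, d) = (a, b) \<bullet> block_op A11 A12 A21 A22 (c, d)" for a b c d
    by (simp add: block_op_def inner_Pair inner_add_left inner_add_right sym_opD[OF s(2)] sym_opD[OF s(4)] 21(2) 12)
  with cl show ?thesis by (auto simp: selfadjoint_iff sym_op_def bounded_clinearD(1))
qed

section \<open>The signature decomposition\<close>

text \<open>\<open>P\<close> stands for the negative spectral projection and \<open>R\<close> for
  the root of the modulus; the algebra is separated from the choices and descriptions that define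
  them.\<close>

locale signature_decomposition =
  fixes X P R :: "'a::chilbert_space \<Rightarrow> 'a"
  assumes X: "selfadjoint X"
    and P: "bounded_clinear P" "sym_proj P" and XP: "X (P x) = P (X x)"
    and neg: "P x = x \<Longrightarrow> x \<noteq> 0 \<Longrightarrow> X x \<bullet> x < 0" and nonneg: "P x = 0 \<Longrightarrow> 0 \<le> X x \<bullet> x"
    and R: "bounded_clinear R" "pos_op R" and RR: "R (R x) = X x - 2 *\<^sub>R P (X x)"
    and RP: "R (P x) = P (R x)"
begin

definition J :: "'a \<Rightarrow> 'a" where "J x = x - 2 *\<^sub>R P x"

lemmas linP = sym_projD(1)[OF P(2)] and PP = sym_projD(3)[OF P(2)] and symP = sym_projD(4)[OF P(2)]
lemmas linR = bounded_clinearD(2)[OF R(1)]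

lemma symR: "sym_op R" and symX: "sym_op X" and clX: "bounded_clinear X"
  using R X by (auto simp: pos_op_def selfadjoint_iff)

lemmas linX = bounded_clinearD(2)[OF clX]

lemma J: "bounded_clinear J" "J x \<bullet> y = x \<bullet> J y" "J (J x) = x" "R (J x) = J (R x)" "X (J x) = J (X x)"
  "J (X x) = R (R x)"
proof -
  show "bounded_clinear J"
    unfolding J_def by (intro bounded_clinear_diff bounded_clinear_ident bounded_clinear_scaleR P)
  show "J x \<bullet> y = x \<bullet> J y" by (simp add: J_def inner_diff_left inner_diff_right symP)
  show "J (J x) = x" by (simp add: J_def linear_diff[OF linP] linear_add[OF linP] PP scaleR_2)
  show "R (J x) = J (R x)" by (simp add: J_def linear_diff[OF linR] linear_scale[OF linR] RP)
  show "X (J x) = J (X x)" by (simp add: J_def linear_diff[OF linX] linear_scale[OF linX] XP)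
  show "J (X x) = R (R x)" by (simp add: J_def RR)
qed

lemmas linJ = bounded_clinearD(2)[OF J(1)]

lemma J_form: "J a \<bullet> a = (norm (a - P a))\<^sup>2 - (norm (P a))\<^sup>2"
proof -
  have "P a \<bullet> P a = P a \<bullet> a" using symP[of "P a" a] by (simp add: PP)
  then show ?thesis
    by (simp add: J_def power2_norm_eq_inner inner_diff_left inner_diff_right inner_commute)
qed

lemma X_eq: "X x = R (J (R x))"
  using J(3)[of "X x"] by (simp add: J)

lemma X_form: "X x \<bullet> y = J (R x) \<bullet> R y"
  by (simp add: X_eq sym_opD[OF symR])

lemma R_eq_0_iff: "R x = 0 \<longleftrightarrow> X x = 0"
proof
  assume "R x = 0"
  then show "X x = 0" by (simp add: X_eq linear_0[OF linR] linear_0[OF linJ])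
next
  assume "X x = 0"
  then have "R (R x) = 0" by (simp add: RR linear_0[OF linP])
  then have "R x \<bullet> R x = 0" using sym_opD[OF symR, of "R x" x] by simp
  then show "R x = 0" by simp
qed

lemma range_P_iff: "p \<in> range P \<longleftrightarrow> P p = p"
  using PP by (metis rangeE rangeI)

text \<open>\<open>X\<close> is negative definite on the range of \<open>P\<close>, so
  \<open>R\<close> is injective there, and finite dimension makes it onto.\<close>

lemma R_range_P:
  assumes "edim (range P) = enat \<kappa>"
  shows "R ` range P = range P"
proof (rule image_eq_if_edim_eq[OF _ _ _ _ _ assms assms])
  show "R (x + y) = R x + R y" for x y by (rule linear_add[OF linR])
  show "R (c *\<^sub>C x) = c *\<^sub>C R x" for c x by (rule bounded_clinearD(3)[OF R(1)])
  show "complex_vector.subspace (range P)" by (rule subspace_range[OF P(1)])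
  show "R ` range P \<subseteq> range P" by (auto simp: RP)
  fix x assume "x \<in> range P" "R x = 0"
  then show "x = 0" using neg[of x] by (auto simp: range_P_iff R_eq_0_iff)
qed

text \<open>Orthogonality for the real inner product. It agrees with complex orthogonality because
  the kernel of \<open>X\<close> is closed under multiplication by the imaginary unit.\<close>

definition ker_perp :: "'a set" where "ker_perp = {s. \<forall>k. X k = 0 \<longrightarrow> s \<bullet> k = 0}"

lemma orth_complement_ker: "orth_complement (op_ker X) = ker_perp"
proof (intro equalityI subsetI)
  fix s assume "s \<in> orth_complement (op_ker X)"
  then show "s \<in> ker_perp" by (auto simp: orth_complement_def op_ker_def ker_perp_def inner_eq_Re_cinner)
next
  fix s assume s: "s \<in> ker_perp"
  have "cinner s k = 0" if k: "X k = 0" for k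
  proof (rule complex_eqI)
    show "Re (cinner s k) = Re 0" using s k by (simp add: ker_perp_def inner_eq_Re_cinner)
    have "X (\<i> *\<^sub>C k) = 0" by (simp add: bounded_clinearD(3)[OF clX] k)
    then show "Im (cinner s k) = Im 0" using s by (simp add: ker_perp_def Im_cinner)
  qed
  then show "s \<in> orth_complement (op_ker X)" by (simp add: orth_complement_def op_ker_def)
qed

lemma ker_perp_diff: "s \<in> ker_perp \<Longrightarrow> t \<in> ker_perp \<Longrightarrow> s - t \<in> ker_perp"
  by (simp add: ker_perp_def inner_diff_left)

lemma ker_perp_add: "s \<in> ker_perp \<Longrightarrow> t \<in> ker_perp \<Longrightarrow> s + t \<in> ker_perp"
  by (simp add: ker_perp_def inner_add_left)

lemma range_R_ker_perp: "R w \<in> ker_perp"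
proof -
  have "R k = 0" if "X k = 0" for k using that by (simp add: R_eq_0_iff)
  then show ?thesis by (simp add: ker_perp_def sym_opD[OF symR])
qed

lemma ker_perp_ker: "s \<in> ker_perp \<Longrightarrow> X s = 0 \<Longrightarrow> s = 0"
  using inner_eq_zero_iff by (auto simp: ker_perp_def)

lemma J_ker_perp: "s \<in> ker_perp \<Longrightarrow> J s \<in> ker_perp"
  by (simp add: ker_perp_def J linear_0[OF linJ])

lemma ker_perp_eqI: "s \<in> ker_perp \<Longrightarrow> t \<in> ker_perp \<Longrightarrow> R s = R t \<Longrightarrow> s = t"
  using ker_perp_ker[OF ker_perp_diff, of s t] R_eq_0_iff[of "s - t"] by (simp add: linear_diff[OF linR])

lemma abs_root_pinv:
  assumes R_eq: "abs_root X = R" and z: "z \<in> range R"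
  shows "abs_root_pinv X z \<in> ker_perp" "R (abs_root_pinv X z) = z"
proof -
  have "\<exists>K. sym_proj K \<and> (\<forall>x. X (K x) = 0) \<and> (\<forall>x. X x = 0 \<longrightarrow> K x = x)"
    by (rule projection_onto_kernel[OF symX]) blast
  then obtain K where K: "sym_proj K" "\<And>x. X (K x) = 0" "\<And>x. X x = 0 \<Longrightarrow> K x = x" by blast
  obtain x where x: "z = R x" using z by blast
  define s where "s = x - K x"
  have "s \<bullet> k = 0" if "X k = 0" for k
    using sym_projD(4)[OF K(1), of x k] K(3)[OF that] by (simp only: s_def inner_diff_left)
  then have s: "s \<in> ker_perp" by (simp add: ker_perp_def)
  have "R (K x) = 0" using K(2)[of x] by (simp only: R_eq_0_iff)
  then have Rs: "R s = z" by (simp add: s_def x linear_diff[OF linR])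
  have "abs_root_pinv X z = s"
    unfolding abs_root_pinv_def R_eq orth_complement_ker
  proof (rule the_equality)
    show "s \<in> ker_perp \<and> (\<exists>k\<in>op_ker X. z = R s + k)"
      using s Rs by (intro conjI bexI[of _ 0]) (simp_all add: op_ker_def linear_0[OF linX])
    fix s' assume s': "s' \<in> ker_perp \<and> (\<exists>k\<in>op_ker X. z = R s' + k)"
    then obtain k where k: "X k = 0" "z = R s' + k" by (auto simp: op_ker_def)
    \<comment> \<open>\<open>k\<close> lies in the kernel of \<open>X\<close> and also in the range
      of \<open>R\<close>, which is orthogonal to that kernel; hence it is 0.\<close>
    have "k = R (s - s')" using k Rs by (simp add: linear_diff[OF linR])
    then have "k = 0" using ker_perp_ker[of k] range_R_ker_perp k(1) by simp
    then have "R s' = R s" using k Rs by simp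
    then show "s' = s" by (rule ker_perp_eqI[rotated 2]) (use s s' in simp_all)
  qed
  with s Rs show "abs_root_pinv X z \<in> ker_perp" "R (abs_root_pinv X z) = z" by simp_all
qed

text \<open>If \<open>z - u\<close> is orthogonal to this subspace, then
  \<open>R (z - u) = 0\<close>, so \<open>z - u\<close> is a kernel vector, belongs to the subspace
  and is orthogonal to itself.\<close>

lemma dense_range_ker: "closure {R w + k | w k. X k = 0} = UNIV"
proof -
  define D where "D = {R w + k | w k. X k = 0}"
  have sub: "subspace D"
    unfolding subspace_def
  proof (intro conjI ballI allI)
    show "0 \<in> D" unfolding D_def
      using linear_0[OF linR] linear_0[OF linX] by (auto intro!: exI[of _ 0])
    fix x assume "x \<in> D"
    then obtain w k where x: "x = R w + k" "X k = 0" by (auto simp: D_def)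
    show "c *\<^sub>R x \<in> D" for c
    proof -
      have "c *\<^sub>R x = R (c *\<^sub>R w) + c *\<^sub>R k" "X (c *\<^sub>R k) = 0"
        using x by (simp_all add: scaleR_add_right linear_scale[OF linR] linear_scale[OF linX])
      then show ?thesis unfolding D_def by blast
    qed
    fix y assume "y \<in> D"
    then obtain w' k' where y: "y = R w' + k'" "X k' = 0" by (auto simp: D_def)
    have "x + y = R (w + w') + (k + k')" "X (k + k') = 0"
      using x y by (simp_all add: linear_add[OF linR] linear_add[OF linX])
    then show "x + y \<in> D" unfolding D_def by blast
  qed
  have "z \<in> closure D" for z
  proof -
    have "\<bar>z \<bullet> y\<bar> \<le> norm z * norm (id y)" for y by (simp add: Cauchy_Schwarz_ineq2)
    from riesz_subspace[OF sub linear_id bounded_linear.linear[OF bounded_linear_inner_right] this]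
    obtain u where u: "u \<in> closure D" "\<And>y. y \<in> D \<Longrightarrow> z \<bullet> y = u \<bullet> y" by auto
    have D: "(z - u) \<bullet> (R w + k) = 0" if "X k = 0" for w k
      using u(2)[of "R w + k"] that by (auto simp: D_def inner_diff_left)
    have "R (z - u) \<bullet> w = 0" for w
      using D[of 0 w] by (simp add: sym_opD[OF symR] linear_0[OF linX])
    then have "R (z - u) = 0" by (metis inner_eq_zero_iff)
    then have "X (z - u) = 0" by (simp add: R_eq_0_iff)
    then have "(z - u) \<bullet> (z - u) = 0" using D[of "z - u" 0] by (simp add: linear_0[OF linR])
    then show ?thesis using u(1) by simp
  qed
  then show ?thesis by (auto simp: D_def)
qed

text \<open>Approximate \<open>s\<close> by some \<open>R w + k\<close>. Since
  \<open>s - R w\<close> is orthogonal to \<open>k\<close>, dropping \<open>k\<close> does not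
  increase the distance.\<close>

lemma ker_perp_approx:
  assumes s: "s \<in> ker_perp" and "0 < e"
  obtains w where "norm (s - R w) < e"
proof -
  have "s \<in> closure {R w + k | w k. X k = 0}" using dense_range_ker by simp
  then obtain w k where wk: "X k = 0" "dist (R w + k) s < e"
    using \<open>0 < e\<close> by (auto simp: closure_approachable)
  have "(norm (s - (R w + k)))\<^sup>2 = (norm (s - R w))\<^sup>2 + (norm k)\<^sup>2"
  proof -
    have "(s - R w) \<bullet> k = 0"
      using ker_perp_diff[OF s range_R_ker_perp] wk(1) by (simp add: ker_perp_def)
    then have "((s - R w) - k) \<bullet> ((s - R w) - k) = (s - R w) \<bullet> (s - R w) + k \<bullet> k"
      unfolding inner_diff_left[of "s - R w" k] inner_diff_right[of _ "s - R w" k]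
      by (simp add: inner_commute)
    then show ?thesis by (simp add: power2_norm_eq_inner diff_diff_eq)
  qed
  then have "(norm (s - R w))\<^sup>2 \<le> (norm (s - (R w + k)))\<^sup>2" by simp
  then have "norm (s - R w) \<le> norm (s - (R w + k))" by (rule power2_le_imp_le) simp
  also have "\<dots> < e" using wk(2) by (simp add: dist_norm norm_minus_commute)
  finally show ?thesis by (rule that)
qed

text \<open>Linearity comes from injectivity of \<open>R\<close> on \<open>ker_perp\<close>. For
  boundedness, \<open>S\<close> is tested on the dense set of vectors \<open>R w + k\<close>, where
  \<open>S y \<bullet> (R w + k) = T y \<bullet> w\<close> is continuous in
  \<open>y\<close>.\<close>

lemma bounded_clinear_lift:
  fixes T S :: "'b::chilbert_space \<Rightarrow> 'a"
  assumes T: "bounded_clinear T" and S: "\<And>y. S y \<in> ker_perp" "\<And>y. R (S y) = T y"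
  shows "bounded_clinear S"
proof -
  have add: "S (x + y) = S x + S y" for x y
    by (rule ker_perp_eqI[OF S(1) ker_perp_add[OF S(1) S(1)]])
      (simp add: linear_add[OF linR] S(2) linear_add[OF bounded_clinearD(2)[OF T]])
  have scale: "S (c *\<^sub>C x) = c *\<^sub>C S x" for c x
  proof (rule ker_perp_eqI[OF S(1)])
    have "(c *\<^sub>C S x) \<bullet> k = 0" if "X k = 0" for k
    proof -
      have "X (cnj c *\<^sub>C k) = 0" using that by (simp add: bounded_clinearD(3)[OF clX])
      then have "S x \<bullet> (cnj c *\<^sub>C k) = 0" using S(1)[of x] by (simp add: ker_perp_def)
      then show ?thesis by (simp add: inner_scaleC_right)
    qed
    then show "c *\<^sub>C S x \<in> ker_perp" by (simp add: ker_perp_def)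
    show "R (S (c *\<^sub>C x)) = R (c *\<^sub>C S x)"
      by (simp add: S(2) bounded_clinearD(3)[OF T] bounded_clinearD(3)[OF R(1)])
  qed
  have "bounded_linear S"
  proof (rule bounded_linear_if_weakly_continuous[OF _ dense_range_ker])
    show "linear S" by (rule linearI) (simp_all add: add scale scaleR_scaleC)
    fix v assume "v \<in> {R w + k | w k. X k = 0}"
    then obtain w k where v: "v = R w + k" "X k = 0" by auto
    have "S y \<bullet> v = T y \<bullet> w" for y
    proof -
      have "S y \<bullet> k = 0" using S(1)[of y] v(2) by (simp add: ker_perp_def)
      moreover have "S y \<bullet> R w = T y \<bullet> w" using sym_opD[OF symR, of "S y" w] by (simp add: S(2))
      ultimately show ?thesis by (simp add: v(1) inner_add_right)
    qed
    then show "continuous_on UNIV (\<lambda>y. S y \<bullet> v)"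
      using continuous_on_inner[OF linear_continuous_on[OF bounded_clinearD(1)[OF T]] continuous_on_const, of UNIV w]
      by simp
  qed
  with scale show ?thesis by (simp add: bounded_clinear_def)
qed

end

lemma signature_decomposition_exists:
  assumes X: "selfadjoint X"
  obtains P where "signature_decomposition X P (abs_root X)" "nu_minus X = edim (range P)"
    "op_sign X = (\<lambda>x. x - 2 *\<^sub>R P x)"
proof -
  have clX: "bounded_clinear X" and symX: "sym_op X" using X by (auto simp: selfadjoint_iff)
  obtain P where P: "bounded_clinear P" "sym_proj P" "\<And>x. X (P x) = P (X x)"
    "\<And>x. P x = x \<Longrightarrow> x \<noteq> 0 \<Longrightarrow> X x \<bullet> x < 0" "\<And>x. P x = 0 \<Longrightarrow> 0 \<le> X x \<bullet> x"
    "spectral_subspace X {..<0} = range P" "op_sign X = (\<lambda>x. x - 2 *\<^sub>R P x)"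
    using negative_projection[OF X] by blast
  note p = sym_projD[OF P(2)] and linX = bounded_clinearD(2)[OF clX]
  \<comment> \<open>\<open>Y\<close> is the product of the signature and \<open>X\<close>. It is
    positive because \<open>X\<close> has opposite signs on the two parts of the decomposition, and
    its square is that of \<open>X\<close>, so it is the modulus.\<close>
  define Y where "Y x = X x - 2 *\<^sub>R P (X x)" for x
  have symY: "sym_op Y"
    unfolding Y_def using P(2) symX P(3)
    by (intro sym_op_diff sym_op_scaleR sym_op_compose_commute[of P X]) (simp_all add: sym_proj_def)
  have "0 \<le> Y x \<bullet> x" for x
  proof -
    define b where "b = x - P x"
    have "P b = 0" by (simp add: b_def linear_diff[OF p(1)] p(3))
    have "X (P x) \<bullet> P x \<le> 0" using P(4)[OF p(3)] linear_0[OF linX] by (cases "P x = 0") (auto simp: less_imp_le)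
    moreover have "0 \<le> X b \<bullet> b" using P(5)[OF \<open>P b = 0\<close>] .
    moreover have "Y x \<bullet> x = X b \<bullet> b - X (P x) \<bullet> P x"
    proof -
      have "X (P x) \<bullet> P x = X (P x) \<bullet> x" by (simp add: p(4)[symmetric] P(3) p(3))
      moreover have "X b \<bullet> P x = 0" using \<open>P b = 0\<close> by (simp add: p(4)[symmetric] P(3)[symmetric] linear_0[OF linX])
      then have "X b \<bullet> b = X b \<bullet> x" by (simp add: b_def inner_diff_right)
      moreover have "Y x = X b - X (P x)"
        by (simp add: Y_def b_def linear_diff[OF linX] P(3) scaleR_2)
      ultimately show ?thesis by (simp add: inner_diff_left)
    qed
    ultimately show ?thesis by simp
  qed
  then have "pos_op Y" using symY by (simp add: pos_op_def)
  moreover have clY: "bounded_clinear Y"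
    unfolding Y_def by (intro bounded_clinear_diff bounded_clinear_scaleR bounded_clinear_compose[of P X] P clX)
  ultimately have nY: "nonneg_op Y" by (simp add: nonneg_op_iff)
  have "Y (Y x) = X (X x)" for x
    by (simp add: Y_def linear_diff[OF linX] linear_add[OF linX] linear_diff[OF p(1)] linear_add[OF p(1)]
        P(3) p(3) scaleR_2)
  then have abs: "op_abs X = Y" unfolding op_abs_def by (intro op_sqrt_eqI nY) auto
  define R where "R = abs_root X"
  have R: "nonneg_op R" "R (R x) = Y x" "R \<in> bicommutant Y" for x
    using op_sqrt[OF nY] by (auto simp: R_def abs_root_def abs)
  have "P (R x) = R (P x)" for x
    by (rule bicommutantD[OF R(3) p(2)]) (simp add: Y_def P(3) linear_diff[OF p(1)] linear_scale[OF p(1)])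
  then have "signature_decomposition X P R"
    using X P R by unfold_locales (auto simp: nonneg_op_iff Y_def)
  with that P(6,7) show ?thesis by (simp add: R_def nu_minus_def)
qed

section \<open>Completions\<close>

lemma block_op_form:
  assumes "bounded_clinear A12" "A21 = cadjoint A12"
  shows "block_op A11 A12 A21 A22 (x, y) \<bullet> (x, y) = A11 x \<bullet> x + 2 * (A12 y \<bullet> x) + A22 y \<bullet> y"
proof -
  have "A21 x \<bullet> y = A12 y \<bullet> x"
    using cadjoint(2)[OF assms(1), of y x] by (simp add: assms(2) inner_commute)
  then show ?thesis by (simp add: block_op_def inner_Pair inner_add_left)
qed

lemma nu_minus_projection:
  assumes "selfadjoint A"
  obtains Q where "bounded_clinear Q" "sym_proj Q" "nu_minus A = edim (range Q)"
    "\<And>v. Q v = v \<Longrightarrow> v \<noteq> 0 \<Longrightarrow> A v \<bullet> v < 0" "\<And>v. Q v = 0 \<Longrightarrow> 0 \<le> A v \<bullet> v"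
proof (rule negative_projection[OF assms])
  fix Q assume "bounded_clinear Q" "sym_proj Q" "\<And>v. Q v = v \<Longrightarrow> v \<noteq> 0 \<Longrightarrow> A v \<bullet> v < 0"
    "\<And>v. Q v = 0 \<Longrightarrow> 0 \<le> A v \<bullet> v" "spectral_subspace A {..<0} = range Q"
  then show thesis by (intro that[of Q]) (auto simp: nu_minus_def)
qed

locale incomplete_block = signature_decomposition X P R
  for X P R :: "'a::chilbert_space \<Rightarrow> 'a" +
  fixes A12 :: "'b::chilbert_space \<Rightarrow> 'a" and A21 :: "'a \<Rightarrow> 'b" and \<kappa> :: nat
  assumes A12: "bounded_clinear A12" and A21: "A21 = cadjoint A12"
    and dimP: "edim (range P) = enat \<kappa>"
begin

abbreviation "A \<equiv> block_op X A12 A21"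

lemmas form = block_op_form[OF A12 A21, of X]

lemma form_neg: "P x = x \<Longrightarrow> x \<noteq> 0 \<Longrightarrow> A A22 (x, 0) \<bullet> (x, 0) < 0"
  using neg[of x] by (simp add: form linear_0[OF bounded_clinearD(2)[OF A12]])

context
  fixes A22 :: "'b \<Rightarrow> 'b"
  assumes A22: "selfadjoint A22"
begin

text \<open>The form is negative at nonzero vectors \<open>(x, 0)\<close> with \<open>x\<close> in
  the range of \<open>P\<close> and nonnegative on the kernel of \<open>Q\<close>, so
  \<open>Q\<close> is injective on the former. No completion can therefore have fewer than
  \<open>\<kappa>\<close> negative squares.\<close>

lemma range_P_embedding:
  assumes Q: "bounded_clinear Q" "\<And>v. Q v = 0 \<Longrightarrow> 0 \<le> A A22 v \<bullet> v" and dimQ: "edim (range Q) = enat n"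
  shows "\<kappa> \<le> n" and "n = \<kappa> \<Longrightarrow> (\<lambda>x. Q (x, 0)) ` range P = range Q"
proof -
  have add: "Q (x + y, 0) = Q (x, 0) + Q (y, 0)" for x y
    by (simp add: linear_add[OF bounded_clinearD(2)[OF Q(1)], symmetric])
  have scale: "Q (c *\<^sub>C x, 0) = c *\<^sub>C Q (x, 0)" for c x
    by (simp add: bounded_clinearD(3)[OF Q(1), symmetric] scaleC_prod_def)
  have inj: "x = 0" if "x \<in> range P" "Q (x, 0) = 0" for x
  proof (rule ccontr)
    assume "x \<noteq> 0"
    then have "A A22 (x, 0) \<bullet> (x, 0) < 0" using that(1) by (intro form_neg) (simp_all add: range_P_iff)
    with Q(2)[OF that(2)] show False by simp
  qed
  have sub: "(\<lambda>x. Q (x, 0)) ` range P \<subseteq> range Q" by blast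
  show "\<kappa> \<le> n"
    using edim_le_if_injective[of "\<lambda>x. Q (x, 0)", OF add scale subspace_range[OF P(1)] inj sub dimQ]
    by (simp add: dimP)
  show "(\<lambda>x. Q (x, 0)) ` range P = range Q" if "n = \<kappa>"
    using image_eq_if_edim_eq[of "\<lambda>x. Q (x, 0)", OF add scale subspace_range[OF P(1)] inj sub dimQ] that
    by (simp add: dimP)
qed

text \<open>The negative subspace \<open>range P \<times> 0\<close> has maximal dimension, so every vector can be moved along
  it into the kernel of \<open>Q\<close>.\<close>
lemma nonneg_correction:
  assumes "nu_minus (A A22) = enat \<kappa>"
  obtains p where "P p = p" "0 \<le> A A22 (x - p, y) \<bullet> (x - p, y)"
proof -
  have "selfadjoint (A A22)" by (rule selfadjoint_block_op[OF X A12 A21 A22])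
  then obtain Q where Q: "bounded_clinear Q" "sym_proj Q" "nu_minus (A A22) = edim (range Q)"
    and nonnegQ: "\<And>v. Q v = 0 \<Longrightarrow> 0 \<le> A A22 v \<bullet> v"
    using nu_minus_projection by metis
  have "(\<lambda>x. Q (x, 0)) ` range P = range Q"
    by (rule range_P_embedding(2)[OF Q(1) nonnegQ]) (use assms Q(3) in auto)
  then have "Q (x, y) \<in> (\<lambda>x. Q (x, 0)) ` range P" by simp
  then obtain p where p: "Q (x, y) = Q (p, 0)" "P p = p" by (auto simp: PP)
  have "Q (x - p, y) = 0"
    using p(1) linear_diff[OF bounded_clinearD(2)[OF Q(1)], of "(x, y)" "(p, 0)"] by simp
  then show ?thesis using that p(2) nonnegQ by blast
qed

lemma range_subset_if_completion:
  assumes "nu_minus (A A22) = enat \<kappa>"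
  shows "range A12 \<subseteq> range R"
proof
  fix z assume "z \<in> range A12"
  then obtain y where z: "z = A12 y" by blast
  have "P z \<in> R ` range P" by (simp add: R_range_P[OF dimP])
  then obtain u where u: "P z = R u" "P u = u" by (auto simp: PP)
  \<comment> \<open>The term \<open>(norm u)\<^sup>2\<close> pays for the unknown correction
    \<open>p\<close> in the estimate below, uniformly in \<open>x\<close> and
    \<open>t\<close>.\<close>
  define b where "b = A22 y \<bullet> y + (norm u)\<^sup>2"
  have lin12: "linear A12" and lin22: "linear A22"
    using A12 A22 bounded_clinearD(2) by (auto simp: selfadjoint_iff)
  have quad: "0 \<le> (norm (R x))\<^sup>2 + 2 * t * (z \<bullet> x) + t\<^sup>2 * b" if x: "P x = 0" for x t
  proof -
    obtain p where p: "P p = p" "0 \<le> A A22 (x - p, t *\<^sub>R y) \<bullet> (x - p, t *\<^sub>R y)"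
      using nonneg_correction[OF assms] by metis
    have RPx: "P (R x) = 0" and RPp: "P (R p) = R p"
      using x p(1) RP[of x] RP[of p] by (simp_all add: linear_0[OF linR])
    have "X (x - p) \<bullet> (x - p) = (norm (R x))\<^sup>2 - (norm (R p))\<^sup>2"
      by (simp add: X_form J_form linear_diff[OF linR] linear_diff[OF linP] RPx RPp)
    moreover have "z \<bullet> p = u \<bullet> R p"
      using symP[of z p] by (simp add: p(1) u(1) sym_opD[OF symR])
    ultimately have "0 \<le> (norm (R x))\<^sup>2 - (norm (R p))\<^sup>2 + 2 * t * (z \<bullet> x) - 2 * t * (u \<bullet> R p) + t\<^sup>2 * (A22 y \<bullet> y)"
      using p(2) by (simp add: form linear_scale[OF lin12] linear_scale[OF lin22] z inner_diff_right
          power2_eq_square algebra_simps)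
    \<comment> \<open>Adding the square of \<open>norm (R p + t *\<^sub>R u)\<close> cancels every
      term containing \<open>p\<close>.\<close>
    moreover have "0 \<le> (norm (R p))\<^sup>2 + 2 * t * (u \<bullet> R p) + t\<^sup>2 * (norm u)\<^sup>2"
      using zero_le_power2[of "norm (R p + t *\<^sub>R u)"]
      unfolding norm_add_scaleR_square by (simp add: inner_commute)
    ultimately show ?thesis by (simp add: b_def algebra_simps)
  qed
  have b: "0 \<le> b" using quad[of 0 1] by (simp add: linear_0[OF linP] linear_0[OF linR])
  have le: "\<bar>z \<bullet> x\<bar> \<le> sqrt b * norm (R x)" if "P x = 0" for x
  proof -
    have "(z \<bullet> x)\<^sup>2 \<le> (norm (R x))\<^sup>2 * b" by (rule quadratic_nonneg_discriminant[OF quad[OF that] b])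
    then have "sqrt ((z \<bullet> x)\<^sup>2) \<le> sqrt ((norm (R x))\<^sup>2 * b)" by (rule real_sqrt_le_mono)
    then show ?thesis by (simp add: real_sqrt_mult mult.commute)
  qed
  \<comment> \<open>The bound is available only on the kernel of \<open>P\<close>; applying it to
    \<open>x - P x\<close> extends it to all \<open>x\<close> once \<open>P z\<close> is subtracted.
    The part \<open>P z\<close> is in the range already.\<close>
  have "z - P z \<in> range R"
  proof (rule range_if_dominated[OF symR])
    fix x
    have "(z - P z) \<bullet> x = z \<bullet> (x - P x)" by (simp add: inner_diff_left inner_diff_right symP)
    also have "\<bar>\<dots>\<bar> \<le> sqrt b * norm (R (x - P x))" by (rule le) (simp add: linear_diff[OF linP] PP)
    also have "R (x - P x) = R x - P (R x)" by (simp add: linear_diff[OF linR] RP)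
    also have "sqrt b * norm (R x - P (R x)) \<le> sqrt b * norm (R x)"
      using sym_projD(6)[OF sym_proj_complement[OF P(2)]] b by (intro mult_left_mono) simp_all
    finally show "\<bar>(z - P z) \<bullet> x\<bar> \<le> sqrt b * norm (R x)" .
  qed
  then obtain w where "z - P z = R w" by blast
  then have "z = R (w + u)" using u(1) by (simp add: linear_add[OF linR] diff_eq_eq)
  then show "z \<in> range R" by simp
qed

end

section \<open>Completing the square\<close>

context
  fixes S :: "'b \<Rightarrow> 'a"
  assumes S: "bounded_clinear S" "\<And>y. S y \<in> ker_perp" "\<And>y. R (S y) = A12 y"
begin

definition S0 :: "'b \<Rightarrow> 'b" where "S0 y = cadjoint S (J (S y))"

lemma S0_form: "S0 y \<bullet> z = J (S y) \<bullet> S z"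
  using cadjoint(2)[OF S(1), of z "J (S y)"] by (simp add: S0_def inner_commute)

lemma selfadjoint_S0: "selfadjoint S0"
proof -
  have cl: "bounded_clinear S0"
    unfolding S0_def
    by (intro bounded_clinear_compose[OF cadjoint(1)[OF S(1)] bounded_clinear_compose[OF J(1) S(1)]])
  have "S0 y \<bullet> z = y \<bullet> S0 z" for y z
    by (metis S0_form J(2) inner_commute)
  with cl show ?thesis by (simp add: selfadjoint_iff sym_op_def bounded_clinearD(1))
qed

lemma form_square:
  "A A22 (x, y) \<bullet> (x, y) = J (R x + J (S y)) \<bullet> (R x + J (S y)) + (A22 y \<bullet> y - S0 y \<bullet> y)"
proof -
  define a b where "a = R x" and "b = J (S y)"
  have "J (a + b) \<bullet> (a + b) = J a \<bullet> a + 2 * (J a \<bullet> b) + J b \<bullet> b"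
    using J(2)[of b a] by (simp add: linear_add[OF linJ] inner_add_left inner_add_right inner_commute[of b "J a"])
  moreover have "J a \<bullet> a = X x \<bullet> x" by (simp add: X_form a_def)
  moreover have "J a \<bullet> b = A12 y \<bullet> x"
    using J(2)[of a b] by (simp add: a_def b_def J(3) S(3)[symmetric] sym_opD[OF symR] inner_commute)
  moreover have "J b \<bullet> b = S0 y \<bullet> y" by (simp add: b_def J(3) S0_form inner_commute[of "S y"])
  ultimately show ?thesis by (simp add: form a_def b_def)
qed

lemma nu_minus_completion_iff:
  assumes A22: "selfadjoint A22"
  shows "nu_minus (A A22) = enat \<kappa> \<longleftrightarrow> op_le S0 A22"
proof
  assume nu: "nu_minus (A A22) = enat \<kappa>"
  show "op_le S0 A22"
    unfolding op_le_iff
  proof (rule allI, rule ccontr)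
    fix y assume *: "\<not> S0 y \<bullet> y \<le> A22 y \<bullet> y"
    define d where "d = S0 y \<bullet> y - A22 y \<bullet> y"
    have d: "0 < d" using * by (simp add: d_def)
    \<comment> \<open>The squared error of the approximation is kept below the deficit
      \<open>d\<close>, so that the form stays negative at the chosen vector.\<close>
    obtain w where w: "norm (J (S y) - R w) < sqrt d"
      using ker_perp_approx[OF J_ker_perp[OF S(2)]] d by (metis real_sqrt_gt_zero)
    define e where "e = R (- w) + J (S y)"
    have e: "(norm e)\<^sup>2 < d"
    proof -
      have "norm e < sqrt d" using w by (simp add: e_def linear_neg[OF linR])
      then have "(norm e)\<^sup>2 < (sqrt d)\<^sup>2" by (intro power_strict_mono) auto
      then show ?thesis using d by simp
    qed
    obtain p where p: "P p = p" "0 \<le> A A22 (- w - p, y) \<bullet> (- w - p, y)"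
      using nonneg_correction[OF A22 nu] by metis
    have eq: "R (- w - p) + J (S y) = e - R p" by (simp add: e_def linear_diff[OF linR])
    have "P (R p) = R p" using RP[of p] p(1) by simp
    then have "(e - R p) - P (e - R p) = e - P e" by (simp add: linear_diff[OF linP])
    \<comment> \<open>The correction \<open>R p\<close> lies in the range of \<open>P\<close>, where
      the form of \<open>J\<close> is negative: it leaves the component \<open>e - P e\<close>
      unchanged and cannot spoil the upper bound.\<close>
    then have "J (e - R p) \<bullet> (e - R p) \<le> (norm (e - P e))\<^sup>2"
      unfolding J_form by (simp only:) simp
    also have "\<dots> \<le> (norm e)\<^sup>2"
      using sym_projD(6)[OF sym_proj_complement[OF P(2)], of e] by (intro power_mono) auto
    finally show False using p(2) e unfolding form_square eq by (simp add: d_def)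
  qed
next
  assume le: "op_le S0 A22"
  have "selfadjoint (A A22)" by (rule selfadjoint_block_op[OF X A12 A21 A22])
  then obtain Q where Q: "bounded_clinear Q" "sym_proj Q" "nu_minus (A A22) = edim (range Q)"
    and negQ: "\<And>v. Q v = v \<Longrightarrow> v \<noteq> 0 \<Longrightarrow> A A22 v \<bullet> v < 0"
    and nonnegQ: "\<And>v. Q v = 0 \<Longrightarrow> 0 \<le> A A22 v \<bullet> v"
    using nu_minus_projection by metis
  define L where "L v = P (R (fst v) + J (S (snd v)))" for v
  have linS: "linear S" by (rule bounded_clinearD(2)[OF S(1)])
  have add: "L (v + w) = L v + L w" for v w
    by (simp add: L_def linear_add[OF linP] linear_add[OF linR] linear_add[OF linJ] linear_add[OF linS])
  have scale: "L (c *\<^sub>C v) = c *\<^sub>C L v" for c v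
    by (simp add: L_def scaleC_prod_def bounded_clinearD(3)[OF P(1)] bounded_clinearD(3)[OF R(1)]
        bounded_clinearD(3)[OF J(1)] bounded_clinearD(3)[OF S(1)] flip: scaleC_add_right)
  have inj: "v = 0" if "v \<in> range Q" "L v = 0" for v
  proof (rule ccontr)
    assume "v \<noteq> 0"
    then have "A A22 v \<bullet> v < 0" using that(1) sym_projD(3)[OF Q(2)] by (intro negQ) auto
    moreover have "0 \<le> A A22 (fst v, snd v) \<bullet> (fst v, snd v)"
      unfolding form_square using that(2) le by (simp add: J_form L_def op_le_iff)
    ultimately show False by simp
  qed
  have "edim (range Q) \<le> enat \<kappa>"
    by (rule edim_le_if_injective[OF add scale subspace_range[OF Q(1)] inj _ dimP]) (auto simp: L_def)
  \<comment> \<open>Finiteness of the dimension comes first, because the lower bound from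
    \<open>range_P_embedding\<close> speaks of a finite \<open>n\<close>.\<close>
  then obtain n where n: "edim (range Q) = enat n" "n \<le> \<kappa>" by (cases "edim (range Q)") auto
  with range_P_embedding(1)[OF A22 Q(1) nonnegQ n(1)] Q(3) show "nu_minus (A A22) = enat \<kappa>" by simp
qed

end

end

theorem theorem2p1:
  fixes A11 :: "'a::chilbert_space \<Rightarrow> 'a"
    and A12 :: "'b::chilbert_space \<Rightarrow> 'a"
    and A21 :: "'a \<Rightarrow> 'b"
    and J :: "'a \<Rightarrow> 'a"
    and \<kappa> :: nat
  assumes "bounded_clinear A11" and "bounded_clinear A12" and "bounded_clinear A21"
    and "A11 = cadjoint A11" and "A21 = cadjoint A12"
    and "nu_minus A11 = enat \<kappa>"
    and "J = op_sign A11"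
  shows "((\<exists>A22. bounded_clinear A22 \<and> A22 = cadjoint A22 \<and>
            bounded_clinear (block_op A11 A12 A21 A22) \<and>
            nu_minus (block_op A11 A12 A21 A22) = nu_minus A11)
          \<longleftrightarrow> range A12 \<subseteq> range (abs_root A11)) \<and>
         (range A12 \<subseteq> range (abs_root A11) \<longrightarrow>
          (let S = abs_root_pinv A11 \<circ> A12; S0 = cadjoint S \<circ> J \<circ> S;
               \<A> = completion_set A11 A12 A21 \<kappa>
           in range A12 \<subseteq> abs_root_pinv_dom A11 \<and> bounded_clinear S \<and>
              S0 \<in> \<A> \<and> (\<forall>A22\<in>\<A>. op_le S0 A22) \<and>
              \<A> = {A22. bounded_clinear A22 \<and>
                     (\<exists>Y. nonneg_op Y \<and> A22 = (\<lambda>y. S0 y + Y y))}))"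
proof -
  have sa: "selfadjoint A11" using assms(1,4) by (simp add: selfadjoint_def)
  obtain P where dec: "signature_decomposition A11 P (abs_root A11)" and dim: "nu_minus A11 = edim (range P)"
    and sgn: "op_sign A11 = (\<lambda>x. x - 2 *\<^sub>R P x)"
    using signature_decomposition_exists[OF sa] by metis
  interpret sd: signature_decomposition A11 P "abs_root A11" by (rule dec)
  interpret incomplete_block A11 P "abs_root A11" A12 A21 \<kappa>
    by unfold_locales (use assms dim in auto)
  have Jeq: "J = sd.J" by (simp add: assms(7) sgn sd.J_def fun_eq_iff)
  define S where "S = abs_root_pinv A11 \<circ> A12"
  \<comment> \<open>Everything about \<open>S\<close> is conditional on the range inclusion, as
    \<open>abs_root_pinv\<close> carries no information outside its domain.\<close>
  have S: "bounded_clinear S" "\<And>y. S y \<in> sd.ker_perp" "\<And>y. abs_root A11 (S y) = A12 y"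
    if r: "range A12 \<subseteq> range (abs_root A11)"
  proof -
    show 1: "S y \<in> sd.ker_perp" "abs_root A11 (S y) = A12 y" for y
      using sd.abs_root_pinv[OF refl subsetD[OF r rangeI]] by (simp_all add: S_def)
    show "bounded_clinear S" by (rule sd.bounded_clinear_lift[OF assms(2) 1])
  qed
  have S0: "cadjoint S \<circ> J \<circ> S = S0 S" if "range A12 \<subseteq> range (abs_root A11)"
    by (simp add: Jeq fun_eq_iff S0_def[OF S[OF that]])
  have mem: "A22 \<in> completion_set A11 A12 A21 \<kappa> \<longleftrightarrow> selfadjoint A22 \<and> op_le (S0 S) A22"
    if "range A12 \<subseteq> range (abs_root A11)" for A22
    using nu_minus_completion_iff[OF S[OF that], of A22] by (auto simp: completion_set_def)
  have S0_mem: "S0 S \<in> completion_set A11 A12 A21 \<kappa>" if "range A12 \<subseteq> range (abs_root A11)"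
    using selfadjoint_S0[OF S[OF that]] by (simp add: mem[OF that] op_le_iff)
  have "(\<exists>A22. bounded_clinear A22 \<and> A22 = cadjoint A22 \<and>
            bounded_clinear (block_op A11 A12 A21 A22) \<and>
            nu_minus (block_op A11 A12 A21 A22) = nu_minus A11)
          \<longleftrightarrow> range A12 \<subseteq> range (abs_root A11)"
  proof
    assume "\<exists>A22. bounded_clinear A22 \<and> A22 = cadjoint A22 \<and>
            bounded_clinear (block_op A11 A12 A21 A22) \<and>
            nu_minus (block_op A11 A12 A21 A22) = nu_minus A11"
    then obtain A22 where "selfadjoint A22" "nu_minus (block_op A11 A12 A21 A22) = enat \<kappa>"
      using assms(6) by (auto simp: selfadjoint_def)
    then show "range A12 \<subseteq> range (abs_root A11)" by (rule range_subset_if_completion)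
  next
    assume r: "range A12 \<subseteq> range (abs_root A11)"
    have "selfadjoint (S0 S)" "nu_minus (block_op A11 A12 A21 (S0 S)) = nu_minus A11"
      using S0_mem[OF r] assms(6) by (auto simp: completion_set_def)
    then show "\<exists>A22. bounded_clinear A22 \<and> A22 = cadjoint A22 \<and>
            bounded_clinear (block_op A11 A12 A21 A22) \<and>
            nu_minus (block_op A11 A12 A21 A22) = nu_minus A11"
      using bounded_clinear_block_op[OF assms(1-3)] unfolding selfadjoint_def by blast
  qed
  moreover have "range A12 \<subseteq> abs_root_pinv_dom A11" if r: "range A12 \<subseteq> range (abs_root A11)"
  proof
    fix z assume "z \<in> range A12"
    then have "z = z + 0" "z \<in> range (abs_root A11)" "0 \<in> op_ker A11"
      using r linear_0[OF sd.linX] by (auto simp: op_ker_def)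
    then show "z \<in> abs_root_pinv_dom A11" unfolding abs_root_pinv_dom_def by blast
  qed
  moreover have "completion_set A11 A12 A21 \<kappa> =
      {A22. bounded_clinear A22 \<and> (\<exists>Y. nonneg_op Y \<and> A22 = (\<lambda>y. S0 S y + Y y))}"
    if r: "range A12 \<subseteq> range (abs_root A11)"
  proof -
    have s0: "bounded_clinear (S0 S)" "sym_op (S0 S)"
      using selfadjoint_S0[OF S[OF r]] by (simp_all add: selfadjoint_iff)
    show ?thesis
    proof (intro equalityI subsetI CollectI)
      fix A22 assume "A22 \<in> completion_set A11 A12 A21 \<kappa>"
      then have a: "bounded_clinear A22" "sym_op A22" "op_le (S0 S) A22"
        by (auto simp: mem[OF r] selfadjoint_iff)
      have "nonneg_op (\<lambda>y. A22 y - S0 S y)"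
        using a s0 by (simp add: nonneg_op_iff pos_op_def bounded_clinear_diff sym_op_diff op_le_iff inner_diff_left)
      then have "nonneg_op (\<lambda>y. A22 y - S0 S y) \<and> A22 = (\<lambda>y. S0 S y + (A22 y - S0 S y))" by simp
      with a(1) show "bounded_clinear A22 \<and> (\<exists>Y. nonneg_op Y \<and> A22 = (\<lambda>y. S0 S y + Y y))" by blast
    next
      fix A22 assume "A22 \<in> {A22. bounded_clinear A22 \<and> (\<exists>Y. nonneg_op Y \<and> A22 = (\<lambda>y. S0 S y + Y y))}"
      then obtain Y where "bounded_clinear A22" "nonneg_op Y" and eq: "A22 = (\<lambda>y. S0 S y + Y y)" by blast
      then show "A22 \<in> completion_set A11 A12 A21 \<kappa>"
        using s0 unfolding eq
        by (simp add: mem[OF r] selfadjoint_iff nonneg_op_iff pos_op_def sym_op_add op_le_iff inner_add_left)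
    qed
  qed
  ultimately show ?thesis
    using S(1) S0 S0_mem mem unfolding Let_def S_def[symmetric] by simp
qed

end
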